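(* Let $\mathcal{F}$ be a Riemannian foliation of an open subset $U$ of $\mathbb{R}^n$ with minimal leaves, i.e. every leaf of $\mathcal{F}$ is a minimal submanifold of $\mathbb{R}^n$. Then $\mathcal{F}$ is totally geodesic. More precisely, for each $p \in U$ there is a neighborhood $G$ of $p$ such that the leaves of the restriction $\mathcal{F}|_{G}$ are open subsets of the leaves of a foliation of $\mathbb{R}^n$ by parallel affine subspaces. In particular, any complex Riemannian foliation of an open subset of $\mathbb{C}^n$ is totally geodesic.
   Context: A foliation of an open subset $U$ of Euclidean space is Riemannian if the flat metric is bundle-like for it, i.e. the leaves are locally equidistant (a straight segment in $U$ orthogonal to the leaf at one of its points is orthogonal to every leaf it meets). It is totally geodesic if its leaves are totally geodesic submanifolds. A complex Riemannian foliation of an open subset of $\mathbb{C}^n\cong\mathbb{R}^{2n}$ is a Riemannian foliation whose leaves are complex submanifolds. *)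

theory Defs
  imports "HOL-Analysis.Analysis"
begin

section \<open>Smooth maps\<close>

primrec Ck_on :: "nat \<Rightarrow> 'a::real_normed_vector set \<Rightarrow> ('a \<Rightarrow> 'b::real_normed_vector) \<Rightarrow> bool" where
  "Ck_on 0 S f \<longleftrightarrow> continuous_on S f"
| "Ck_on (Suc k) S f \<longleftrightarrow> (\<forall>x\<in>S. f differentiable (at x)) \<and>
     (\<forall>v. Ck_on k S (\<lambda>x. frechet_derivative f (at x) v))"

text \<open>Only used for open \<open>S\<close>, as the derivatives are taken in the ambient space.\<close>
definition smooth_on :: "'a::real_normed_vector set \<Rightarrow> ('a \<Rightarrow> 'b::real_normed_vector) \<Rightarrow> bool" where
  "smooth_on S f \<longleftrightarrow> (\<forall>k. Ck_on k S f)"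

definition diffeomorphism_on :: "'a::euclidean_space set \<Rightarrow> ('a \<Rightarrow> 'a) \<Rightarrow> bool" where
  "diffeomorphism_on W \<phi> \<longleftrightarrow> open W \<and> open (\<phi> ` W) \<and> inj_on \<phi> W \<and>
     smooth_on W \<phi> \<and> smooth_on (\<phi> ` W) (inv_into W \<phi>)"


section \<open>Embedded submanifolds of Euclidean space\<close>

definition smooth_submanifold :: "nat \<Rightarrow> 'a::euclidean_space set \<Rightarrow> bool" where
  "smooth_submanifold k S \<longleftrightarrow> (\<forall>p\<in>S. \<exists>W \<phi> V. p \<in> W \<and> diffeomorphism_on W \<phi> \<and>
     subspace V \<and> dim V = k \<and> \<phi> ` (S \<inter> W) = \<phi> ` W \<inter> V)"

definition tangent_space :: "'a::euclidean_space set \<Rightarrow> 'a \<Rightarrow> 'a set" where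
  "tangent_space S p = {v. \<exists>\<gamma> e. 0 < e \<and> smooth_on {-e<..<e::real} \<gamma> \<and> \<gamma> ` {-e<..<e} \<subseteq> S \<and>
     \<gamma> 0 = p \<and> (\<gamma> has_vector_derivative v) (at 0)}"

definition normal_part :: "'a::euclidean_space set \<Rightarrow> 'a \<Rightarrow> 'a" where
  "normal_part T x = (THE w. x - w \<in> T \<and> (\<forall>v\<in>T. orthogonal v w))"

definition local_tangent_field :: "'a::euclidean_space set \<Rightarrow> 'a \<Rightarrow> ('a \<Rightarrow> 'a) \<Rightarrow> bool" where
  "local_tangent_field S p Y \<longleftrightarrow> (\<exists>W. open W \<and> p \<in> W \<and> smooth_on W Y \<and>
     (\<forall>x\<in>S \<inter> W. Y x \<in> tangent_space S x))"

text \<open>\<open>II(u, v)\<close> is the normal part of \<open>D\<^sub>u Y\<close>, where \<open>Y\<close> is any local vector field tangent to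
  \<open>S\<close> with \<open>Y(p) = v\<close>. For \<open>u\<close>, \<open>v\<close> tangent to a smooth submanifold \<open>S\<close> at \<open>p\<close> such a \<open>Y\<close>
  exists and the result does not depend on it.\<close>
definition second_fundamental_form :: "'a::euclidean_space set \<Rightarrow> 'a \<Rightarrow> 'a \<Rightarrow> 'a \<Rightarrow> 'a" where
  "second_fundamental_form S p u v =
     (let Y = (SOME Y. local_tangent_field S p Y \<and> Y p = v)
      in normal_part (tangent_space S p) (frechet_derivative Y (at p) u))"

definition orthonormal_basis_of :: "'a::euclidean_space set \<Rightarrow> 'a set \<Rightarrow> bool" where
  "orthonormal_basis_of T B \<longleftrightarrow>
     B \<subseteq> T \<and> span B = T \<and> pairwise orthogonal B \<and> (\<forall>e\<in>B. norm e = 1)"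

text \<open>The (unnormalised) mean curvature vector: the trace of the second fundamental form.\<close>
definition mean_curvature :: "'a::euclidean_space set \<Rightarrow> 'a \<Rightarrow> 'a" where
  "mean_curvature S p =
     (\<Sum>e\<in>(SOME B. orthonormal_basis_of (tangent_space S p) B). second_fundamental_form S p e e)"

definition minimal_submanifold :: "nat \<Rightarrow> 'a::euclidean_space set \<Rightarrow> bool" where
  "minimal_submanifold k S \<longleftrightarrow> smooth_submanifold k S \<and> (\<forall>p\<in>S. mean_curvature S p = 0)"

definition totally_geodesic_submanifold :: "nat \<Rightarrow> 'a::euclidean_space set \<Rightarrow> bool" where
  "totally_geodesic_submanifold k S \<longleftrightarrow> smooth_submanifold k S \<and>
     (\<forall>p\<in>S. \<forall>u\<in>tangent_space S p. \<forall>v\<in>tangent_space S p. second_fundamental_form S p u v = 0)"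

definition holomorphic_map_on :: "(complex^'n) set \<Rightarrow> (complex^'n \<Rightarrow> complex^'n) \<Rightarrow> bool" where
  "holomorphic_map_on W f \<longleftrightarrow>
     (\<forall>x\<in>W. \<exists>f'. (f has_derivative f') (at x) \<and> (\<forall>c v. f' (c *s v) = c *s f' v))"

definition biholomorphism_on :: "(complex^'n) set \<Rightarrow> (complex^'n \<Rightarrow> complex^'n) \<Rightarrow> bool" where
  "biholomorphism_on W \<phi> \<longleftrightarrow> open W \<and> open (\<phi> ` W) \<and> inj_on \<phi> W \<and>
     holomorphic_map_on W \<phi> \<and> holomorphic_map_on (\<phi> ` W) (inv_into W \<phi>)"

text \<open>Here \<open>m\<close> is the complex dimension; \<open>vec.subspace\<close> and \<open>vec.dim\<close> refer to the complex
  scalar multiplication \<open>*s\<close>, unlike \<open>subspace\<close> and \<open>dim\<close>.\<close>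
definition complex_submanifold :: "nat \<Rightarrow> (complex^'n) set \<Rightarrow> bool" where
  "complex_submanifold m S \<longleftrightarrow> (\<forall>p\<in>S. \<exists>W \<phi> V. p \<in> W \<and> biholomorphism_on W \<phi> \<and>
     vec.subspace V \<and> vec.dim V = m \<and> \<phi> ` (S \<inter> W) = \<phi> ` W \<inter> V)"


section \<open>Foliations of open subsets of Euclidean space\<close>

text \<open>A foliation is given by a foliated atlas. The plaques of a flat chart are the preimages of
  the slices of its image by translates of the linear subspace \<open>chart_dir\<close>; the image is convex,
  so plaques are connected.\<close>

record 'a flat_chart =
  chart_dom :: "'a set"
  chart_map :: "'a \<Rightarrow> 'a"
  chart_dir :: "'a set"

definition is_flat_chart :: "nat \<Rightarrow> ('a::euclidean_space) flat_chart \<Rightarrow> bool" where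
  "is_flat_chart k c \<longleftrightarrow> diffeomorphism_on (chart_dom c) (chart_map c) \<and>
     convex (chart_map c ` chart_dom c) \<and> subspace (chart_dir c) \<and> dim (chart_dir c) = k"

definition plaque :: "('a::euclidean_space) flat_chart \<Rightarrow> 'a \<Rightarrow> 'a set" where
  "plaque c x = {y \<in> chart_dom c. chart_map c y - chart_map c x \<in> chart_dir c}"

text \<open>Locally, the coordinate change maps slices to slices.\<close>
definition coherent :: "('a::euclidean_space) flat_chart \<Rightarrow> 'a flat_chart \<Rightarrow> bool" where
  "coherent c d \<longleftrightarrow> (\<forall>p \<in> chart_dom c \<inter> chart_dom d.
     \<exists>W. open W \<and> p \<in> W \<and> W \<subseteq> chart_dom c \<inter> chart_dom d \<and>
       (\<forall>x\<in>W. plaque c x \<inter> W = plaque d x \<inter> W))"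

definition foliation :: "nat \<Rightarrow> 'a::euclidean_space set \<Rightarrow> 'a flat_chart set \<Rightarrow> bool" where
  "foliation k U F \<longleftrightarrow> open U \<and> (\<forall>c\<in>F. is_flat_chart k c) \<and> \<Union> (chart_dom ` F) = U \<and>
     (\<forall>c\<in>F. \<forall>d\<in>F. coherent c d)"

text \<open>The leaves are the classes of points that can be joined by a finite chain of plaques.\<close>

definition plaque_rel :: "('a::euclidean_space) flat_chart set \<Rightarrow> ('a \<times> 'a) set" where
  "plaque_rel F = {(x, y). \<exists>c\<in>F. x \<in> chart_dom c \<and> y \<in> plaque c x}"

definition leaves :: "('a::euclidean_space) flat_chart set \<Rightarrow> 'a set set" where
  "leaves F = \<Union> (chart_dom ` F) // (plaque_rel F)\<^sup>+"

definition restrict_foliation ::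
  "('a::euclidean_space) flat_chart set \<Rightarrow> 'a set \<Rightarrow> 'a flat_chart set" where
  "restrict_foliation F G = {c. \<exists>d\<in>F. chart_map c = chart_map d \<and> chart_dir c = chart_dir d \<and>
     open (chart_dom c) \<and> chart_dom c \<subseteq> chart_dom d \<inter> G \<and> convex (chart_map c ` chart_dom c)}"

text \<open>A leaf is in general only an injectively immersed submanifold; the plaques it contains are
  embedded, and they are open in the leaf topology and cover the leaf. A property of submanifolds
  that is local (being minimal, totally geodesic or complex) therefore holds for the leaf if and
  only if it holds for its plaques.\<close>
definition leaf_locally ::
  "('a::euclidean_space) flat_chart set \<Rightarrow> ('a set \<Rightarrow> bool) \<Rightarrow> 'a set \<Rightarrow> bool" where
  "leaf_locally F P L \<longleftrightarrow> (\<forall>c\<in>F. \<forall>x \<in> chart_dom c \<inter> L. P (plaque c x))"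

definition leaf_tangent_space :: "('a::euclidean_space) flat_chart set \<Rightarrow> 'a \<Rightarrow> 'a set" where
  "leaf_tangent_space F x = {v. \<exists>c\<in>F. x \<in> chart_dom c \<and> v \<in> tangent_space (plaque c x) x}"

definition orthogonal_to_leaf_at :: "('a::euclidean_space) flat_chart set \<Rightarrow> 'a \<Rightarrow> 'a \<Rightarrow> bool" where
  "orthogonal_to_leaf_at F x w \<longleftrightarrow> (\<forall>v \<in> leaf_tangent_space F x. orthogonal w v)"

definition riemannian_foliation :: "nat \<Rightarrow> 'a::euclidean_space set \<Rightarrow> 'a flat_chart set \<Rightarrow> bool" where
  "riemannian_foliation k U F \<longleftrightarrow> foliation k U F \<and>
     (\<forall>a b. closed_segment a b \<subseteq> U \<longrightarrow>
       (\<exists>x \<in> closed_segment a b. orthogonal_to_leaf_at F x (b - a)) \<longrightarrow>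
       (\<forall>y \<in> closed_segment a b. orthogonal_to_leaf_at F y (b - a)))"

definition minimal_leaves :: "nat \<Rightarrow> ('a::euclidean_space) flat_chart set \<Rightarrow> bool" where
  "minimal_leaves k F \<longleftrightarrow> (\<forall>L \<in> leaves F. leaf_locally F (minimal_submanifold k) L)"

definition totally_geodesic_foliation :: "nat \<Rightarrow> ('a::euclidean_space) flat_chart set \<Rightarrow> bool" where
  "totally_geodesic_foliation k F \<longleftrightarrow>
     (\<forall>L \<in> leaves F. leaf_locally F (totally_geodesic_submanifold k) L)"

definition complex_riemannian_foliation ::
  "nat \<Rightarrow> (complex^'n) set \<Rightarrow> (complex^'n) flat_chart set \<Rightarrow> bool" where
  "complex_riemannian_foliation k U F \<longleftrightarrow> riemannian_foliation k U F \<and>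
     (\<forall>L \<in> leaves F. \<exists>m. leaf_locally F (complex_submanifold m) L)"

definition parallel_affine_foliation :: "nat \<Rightarrow> ('a::euclidean_space) flat_chart set \<Rightarrow> bool" where
  "parallel_affine_foliation k P \<longleftrightarrow> foliation k UNIV P \<and> (\<forall>L \<in> leaves P. affine L) \<and>
     (\<forall>L \<in> leaves P. \<forall>L' \<in> leaves P. affine_parallel L L')"

end

theory Submission
  imports Defs
begin

text \<open>
  Let \<open>T x\<close> be the tangent space of the leaf through \<open>x\<close>, let \<open>P x\<close> be the orthogonal projection onto
  it, and let \<open>w\<close> be normal to the leaf at \<open>x\<close>. As normal segments stay normal, the leaf tangent
  space at \<open>x + t w\<close> is the image of \<open>T x\<close> under \<open>1 + t B\<close>, where the part of the linear map \<open>B\<close>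
  tangent to the leaf is \<open>- A\<close> for the symmetric shape operator \<open>A\<close>, and its normal part \<open>R\<close> is
  O'Neill's integrability tensor of the normal bundle. Minimality says that the volume
  distortion of \<open>1 + t B\<close> is constant, i.e. \<open>det ((1 - t A)\<^sup>2 + t\<^sup>2 R\<^sup>T R) = 1\<close> for small \<open>t\<close>, hence for
  all \<open>t\<close>, the left-hand side being a polynomial. It dominates \<open>(det (1 - t A))\<^sup>2\<close>, so
  the polynomial \<open>det (1 - t A)\<close> is bounded, hence constant, which forces \<open>A = 0\<close> because \<open>A\<close> is
  symmetric; then \<open>R = 0\<close> as well. So \<open>B = 0\<close> for all \<open>x\<close> and \<open>w\<close>, the derivative of \<open>P\<close> vanishes, and
  \<open>T\<close> is locally constant. In the complex case \<open>T x\<close> is invariant under multiplication by \<open>\<i>\<close>, and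
  integrability makes the second fundamental form change sign under it, so its trace is zero.
\<close>

section \<open>Determinants\<close>

text \<open>Apart from the charts, everything is expressed by the first derivative of
  \<open>P\<close>: on two tangent vectors it is the second fundamental form, and for normal
  \<open>w\<close> the trace of \<open>v \<mapsto> DP x v w\<close> over the tangent space is the
  mean curvature in direction \<open>w\<close>. Determinants belong to square matrices on the whole
  space, whereas \<open>1 + t B\<close> maps one \<open>k\<close>-dimensional subspace onto another.
  The Gram form of \<open>(1 + t B) P0\<close> is therefore completed by the identity on the normal
  space; its determinant is the square of the volume distortion. It is polynomial in
  \<open>t\<close> because the ambient metric is flat: normal geodesics are straight lines, so
  \<open>B\<close> does not depend on \<open>t\<close> and no differential equation has to be
  solved. Constancy of \<open>det (1 - t A)\<close> by itself only makes \<open>A\<close> nilpotent.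
  The symmetry of \<open>A\<close>, which is the integrability of the leaf distribution, excludes
  nonzero nilpotents; it enters through \<open>det (1 - t A) * det (1 + t A) = det (1 - t\<^sup>2
  A\<^sup>T A)\<close>, without eigenvalues.\<close>

lemma abs_det_le_fact:
  fixes A :: "real^'n^'n"
  assumes "\<And>i j. \<bar>A $ i $ j\<bar> \<le> 1"
  shows "\<bar>det A\<bar> \<le> fact CARD('n)"
proof -
  have "\<bar>det A\<bar> \<le> (\<Sum>p\<in>{p. p permutes (UNIV::'n set)}. \<bar>of_int (sign p) * (\<Prod>i\<in>UNIV. A $ i $ p i)\<bar>)"
    unfolding det_def by (rule sum_abs)
  also have "\<dots> \<le> (\<Sum>p\<in>{p. p permutes (UNIV::'n set)}. 1)"
  proof (rule sum_mono)
    fix p assume "p \<in> {p. p permutes (UNIV::'n set)}"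
    have "(\<Prod>i\<in>UNIV. \<bar>A $ i $ p i\<bar>) \<le> 1"
      using assms by (intro prod_le_1) auto
    then show "\<bar>of_int (sign p) * (\<Prod>i\<in>UNIV. A $ i $ p i)\<bar> \<le> 1"
      by (simp add: abs_mult abs_prod sign_def)
  qed
  also have "\<dots> = fact CARD('n)"
    by (simp add: card_permutations)
  finally show ?thesis .
qed

text \<open>All powers of \<open>A\<close> are contractions, so their entries are bounded by 1 and
  \<open>\<bar>det A\<bar> ^ k\<close> stays below the fixed number \<open>fact CARD('n)\<close>.
  This is impossible for large \<open>k\<close> if \<open>\<bar>det A\<bar>\<close> exceeds
  1.\<close>

lemma abs_det_contraction_le_1:
  fixes A :: "real^'n^'n"
  assumes "\<And>x. norm (A *v x) \<le> norm x"
  shows "\<bar>det A\<bar> \<le> 1"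
proof -
  define Q where "Q k = (((**) A) ^^ k) (mat 1)" for k
  have Q: "norm (Q k *v x) \<le> norm x" for k x
  proof (induction k)
    case (Suc k)
    have "norm (Q (Suc k) *v x) = norm (A *v (Q k *v x))"
      by (simp add: Q_def matrix_vector_mul_assoc)
    also have "\<dots> \<le> norm x" using assms Suc order_trans by blast
    finally show ?case .
  qed (simp add: Q_def)
  have "\<bar>Q k $ i $ j\<bar> \<le> 1" for k i j
  proof -
    have "\<bar>Q k $ i $ j\<bar> = \<bar>(Q k *v axis j 1) $ i\<bar>"
      by (simp add: matrix_vector_mult_basis column_def)
    also have "\<dots> \<le> norm (Q k *v axis j 1)" by (rule component_le_norm_cart)
    also have "\<dots> \<le> 1" using Q[of k "axis j 1"] by (simp add: norm_axis_1)
    finally show ?thesis .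
  qed
  then have "\<bar>det (Q k)\<bar> \<le> fact CARD('n)" for k by (rule abs_det_le_fact)
  moreover have "det (Q k) = det A ^ k" for k
    by (induction k) (auto simp: Q_def det_mul)
  ultimately have *: "\<bar>det A\<bar> ^ k \<le> fact CARD('n)" for k by (simp add: power_abs)
  show ?thesis
  proof (rule ccontr)
    assume "\<not> \<bar>det A\<bar> \<le> 1"
    then obtain k where "fact CARD('n) < \<bar>det A\<bar> ^ k"
      using real_arch_pow[of "\<bar>det A\<bar>" "fact CARD('n)"] by auto
    with *[of k] show False by linarith
  qed
qed

text \<open>An expanding matrix is injective, hence invertible, and its inverse is a
  contraction.\<close>

lemma abs_det_expansion_ge_1:
  fixes A :: "real^'n^'n"
  assumes "\<And>x. norm x \<le> norm (A *v x)"
  shows "1 \<le> \<bar>det A\<bar>"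
proof -
  have "inj ((*v) A)"
  proof (rule injI)
    fix x y assume "A *v x = A *v y"
    then have "A *v (x - y) = 0" by (simp add: matrix_vector_mult_diff_distrib)
    then show "x = y" using assms[of "x - y"] by simp
  qed
  then obtain B where B: "B ** A = mat 1"
    using matrix_left_invertible_injective by blast
  then have AB: "A ** B = mat 1" by (simp add: matrix_left_right_inverse)
  have "norm (B *v x) \<le> norm x" for x
    using assms[of "B *v x"] by (simp add: matrix_vector_mul_assoc AB)
  then have "\<bar>det B\<bar> \<le> 1" by (rule abs_det_contraction_le_1)
  moreover have "\<bar>det A\<bar> * \<bar>det B\<bar> = 1"
    by (metis AB abs_mult abs_one det_I det_mul)
  ultimately show ?thesis
    by (metis abs_ge_zero mult.right_neutral mult_left_mono)
qed

text \<open>Jacobi's formula at the identity, by the product rule in the Leibniz expansion: only the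
  identity permutation contributes.\<close>

lemma has_real_derivative_det_at_mat_1:
  fixes A :: "real \<Rightarrow> real^'n^'n"
  assumes "\<And>i j. ((\<lambda>t. A t $ i $ j) has_real_derivative D $ i $ j) (at t0)"
    and A0: "A t0 = mat 1"
  shows "((\<lambda>t. det (A t)) has_real_derivative trace D) (at t0)"
proof -
  let ?P = "{p. p permutes (UNIV::'n set)}"
  let ?d = "\<lambda>p. of_int (sign p) * (\<Sum>k\<in>UNIV. D $ k $ p k * (\<Prod>i\<in>UNIV - {k}. A t0 $ i $ p i))"
  have "((\<lambda>t. \<Sum>p\<in>?P. of_int (sign p) * (\<Prod>i\<in>UNIV. A t $ i $ p i)) has_real_derivative
          (\<Sum>p\<in>?P. ?d p)) (at t0)"
    by (intro DERIV_sum DERIV_cmult has_field_derivative_prod assms)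
  moreover have "?d p = 0" if "p \<in> ?P - {id}" for p
  proof -
    from that have p: "p permutes UNIV" and "p \<noteq> id" by auto
    have "(\<Prod>i\<in>UNIV - {k}. A t0 $ i $ p i) = 0" for k
    proof -
      \<comment> \<open>A permutation other than \<open>id\<close> moves at least two indices, so a
        vanishing off-diagonal factor survives when the factor \<open>k\<close> is removed.\<close>
      have "\<exists>i. i \<noteq> k \<and> p i \<noteq> i"
      proof (rule ccontr)
        assume "\<nexists>i. i \<noteq> k \<and> p i \<noteq> i"
        then have fixed: "p i = i" if "i \<noteq> k" for i using that by blast
        have "p k = k"
          by (metis fixed p permutes_inj_on[OF p, of UNIV] inj_onD UNIV_I)
        with fixed have "p = id" 
        proof (intro ext)
          fix x show "p x = id x" using fixed[of x] \<open>p k = k\<close> by (cases "x = k") auto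
        qed
        with \<open>p \<noteq> id\<close> show False by simp
      qed
      then obtain i where "i \<noteq> k" "p i \<noteq> i" by blast
      then show ?thesis by (intro prod_zero) (auto simp: A0 mat_def intro!: bexI[of _ i])
    qed
    then show ?thesis by (simp only: mult_zero_right sum.neutral_const)
  qed
  then have "(\<Sum>p\<in>?P. ?d p) = (\<Sum>p\<in>{id}. ?d p)"
    by (intro sum.mono_neutral_right) (auto simp: finite_permutations permutes_id)
  moreover have "\<dots> = trace D"
    by (simp add: A0 mat_def trace_def)
  ultimately show ?thesis by (simp add: det_def)
qed

section \<open>Polynomial functions of one real variable\<close>

lemma real_polynomial_function_det:
  fixes A :: "real \<Rightarrow> real^'n^'n"
  assumes "\<And>i j. real_polynomial_function (\<lambda>t. A t $ i $ j)"
  shows "real_polynomial_function (\<lambda>t. det (A t))"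
  unfolding det_def using assms
  by (auto intro!: real_polynomial_function_sum real_polynomial_function.intros(4)
      real_polynomial_function_prod real_polynomial_function.intros(2) finite_permutations)

lemma real_polynomial_function_eqI:
  fixes f :: "real \<Rightarrow> real"
  assumes f: "real_polynomial_function f" and "infinite S" "\<And>t. t \<in> S \<Longrightarrow> f t = c"
  shows "f = (\<lambda>_. c)"
proof -
  have "real_polynomial_function (\<lambda>t. f t - c)"
    using f by (intro real_polynomial_function_diff real_polynomial_function.intros(2))
  then obtain a n where a: "(\<lambda>t. f t - c) = (\<lambda>t. \<Sum>i\<le>n. a i * t ^ i)"
    unfolding real_polynomial_function_iff_sum by blast
  have "a k = 0" if "k \<le> n" for k
  proof (rule ccontr)
    assume "a k \<noteq> 0"
    with that have "finite {t. (\<Sum>i\<le>n. a i * t ^ i) = 0}"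
      using polyfun_rootbound[of n a] by blast
    moreover have "S \<subseteq> {t. (\<Sum>i\<le>n. a i * t ^ i) = 0}"
      using assms(3) by (auto simp flip: a[THEN fun_cong])
    ultimately show False using \<open>infinite S\<close> finite_subset by blast
  qed
  then have "(\<Sum>i\<le>n. a i * t ^ i) = 0" for t by simp
  then show ?thesis using a by (auto simp: fun_eq_iff)
qed

lemma bounded_real_polynomial_function_const:
  fixes f :: "real \<Rightarrow> real"
  assumes f: "real_polynomial_function f" and b: "\<And>t. \<bar>f t\<bar> \<le> b"
  shows "f t = f s"
proof -
  obtain a n where a: "f = (\<lambda>t. \<Sum>i\<le>n. a i * t ^ i)"
    using f unfolding real_polynomial_function_iff_sum by blast
  have "a k = 0" if "k \<noteq> 0" "k \<le> n" for k
  proof (rule ccontr)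
    assume "a k \<noteq> 0"
    with that have "eventually (\<lambda>z. norm (\<Sum>i\<le>n. a i * z^i) \<ge> b + 1) at_infinity"
      by (intro polyfun_extremal) auto
    then obtain B where "\<And>z. B \<le> norm z \<Longrightarrow> norm (\<Sum>i\<le>n. a i * z^i) \<ge> b + 1"
      unfolding eventually_at_infinity by blast
    from this[of "\<bar>B\<bar>"] have "b + 1 \<le> \<bar>f \<bar>B\<bar>\<bar>" by (simp add: a)
    with b[of "\<bar>B\<bar>"] show False by linarith
  qed
  then have "f t = a 0" for t
    unfolding a by (subst sum.mono_neutral_right[of _ "{0}"]) auto
  then show ?thesis by simp
qed

section \<open>Determinants and Gram matrices\<close>

lemma trace_transpose_mult_self_eq_0_iff:
  fixes A :: "real^'n^'m"
  shows "trace (transpose A ** A) = 0 \<longleftrightarrow> A = 0"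
proof -
  have "trace (transpose A ** A) = (\<Sum>i\<in>UNIV. \<Sum>k\<in>UNIV. (A $ k $ i)\<^sup>2)"
    by (simp add: trace_def matrix_matrix_mult_def transpose_def power2_eq_square)
  then show ?thesis
    by (auto simp: sum_nonneg_eq_0_iff sum_nonneg vec_eq_iff)
qed

text \<open>In the variable \<open>s = t\<^sup>2\<close> the determinant is a polynomial whose
  derivative at 0 is \<open>c\<close> times the sum of the squared entries of \<open>A\<close>. The
  hypothesis covers only \<open>s \<ge> 0\<close>, but that is an infinite set, so the polynomial is
  constant on both sides of 0. Both signs of \<open>c\<close> occur below.\<close>

lemma det_mat_1_plus_gram_const_imp_0:
  fixes A :: "real^'n^'n"
  assumes "c \<noteq> 0" and det: "\<And>t. det (mat 1 + (c * t\<^sup>2) *\<^sub>R (transpose A ** A)) = 1"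
  shows "A = 0"
proof -
  let ?S = "transpose A ** A"
  let ?f = "\<lambda>s. det (mat 1 + s *\<^sub>R (c *\<^sub>R ?S))"
  have lin: "real_polynomial_function (\<lambda>t::real. t)"
    by (intro real_polynomial_function.intros(1) bounded_linear_ident)
  have "real_polynomial_function ?f"
    by (rule real_polynomial_function_det) (auto intro!: real_polynomial_function.intros(2-4) lin)
  moreover have "?f s = 1" if "s \<in> {0..}" for s
    using det[of "sqrt s"] that by (simp add: mult.commute)
  ultimately have "?f = (\<lambda>_. 1)"
    by (rule real_polynomial_function_eqI[OF _ infinite_Ici])
  moreover have "(?f has_real_derivative trace (c *\<^sub>R ?S)) (at 0)"
    by (rule has_real_derivative_det_at_mat_1) (auto intro!: derivative_eq_intros)
  ultimately have "trace (c *\<^sub>R ?S) = 0"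
    using DERIV_const DERIV_unique by metis
  then have "c * trace ?S = 0" by (simp add: trace_def sum_distrib_left)
  then show ?thesis using \<open>c \<noteq> 0\<close> by (simp add: trace_transpose_mult_self_eq_0_iff)
qed

lemma matrix_add_rdistrib:
  fixes A B C :: "real^'n^'n"
  shows "(A + B) ** C = A ** C + B ** C"
  by (simp add: vec_eq_iff matrix_matrix_mult_def sum.distrib distrib_right)

lemma matrix_diff_rdistrib:
  fixes A B C :: "real^'n^'n"
  shows "(A - B) ** C = A ** C - B ** C"
  by (simp add: vec_eq_iff matrix_matrix_mult_def sum_subtractf left_diff_distrib)

lemma norm_matrix_vector_gram:
  fixes G :: "real^'n^'m"
  shows "(G *v x) \<bullet> (G *v x) = x \<bullet> ((transpose G ** G) *v x)"
proof -
  have "x \<bullet> ((transpose G ** G) *v x) = x \<bullet> ((G *v x) v* G)"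
    by (simp only: matrix_vector_mul_assoc[symmetric] transpose_matrix_vector)
  also have "\<dots> = (G *v x) \<bullet> (G *v x)"
    by (subst inner_commute) (rule dot_lmul_matrix)
  finally show ?thesis ..
qed

text \<open>If \<open>N\<close> is invertible with inverse \<open>K\<close>, multiplication by
  \<open>transpose K\<close> and \<open>K\<close> turns the sum into the identity plus a Gram
  matrix. Such a matrix expands every vector, by Cauchy-Schwarz, so its determinant has absolute
  value at least 1.\<close>

lemma abs_det_le_abs_det_gram_sum:
  fixes N R :: "real^'n^'n"
  shows "(det N)\<^sup>2 \<le> \<bar>det (transpose N ** N + transpose R ** R)\<bar>"
proof (cases "det N = 0")
  case False
  then obtain K where NK: "N ** K = mat 1"
    by (meson invertible_def invertible_det_nz)
  let ?E = "mat 1 + transpose (R ** K) ** (R ** K)"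
  have eq: "transpose K ** (transpose N ** N + transpose R ** R) ** K = ?E"
  proof -
    have "transpose K ** (transpose N ** N) ** K = transpose (N ** K) ** (N ** K)"
      by (simp add: matrix_transpose_mul matrix_mul_assoc)
    moreover have "transpose K ** (transpose R ** R) ** K = transpose (R ** K) ** (R ** K)"
      by (simp add: matrix_transpose_mul matrix_mul_assoc)
    ultimately show ?thesis
      by (simp add: matrix_add_ldistrib matrix_add_rdistrib NK transpose_mat)
  qed
  have "norm x \<le> norm (?E *v x)" for x
  proof -
    have "norm x * norm x \<le> x \<bullet> x + (R ** K *v x) \<bullet> (R ** K *v x)"
      by (simp add: dot_square_norm power2_eq_square)
    also have "(R ** K *v x) \<bullet> (R ** K *v x) = x \<bullet> ((transpose (R ** K) ** (R ** K)) *v x)"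
      by (rule norm_matrix_vector_gram)
    also have "x \<bullet> x + \<dots> = x \<bullet> (?E *v x)"
      by (simp add: matrix_vector_mult_add_rdistrib inner_add_right)
    also have "\<dots> \<le> norm x * norm (?E *v x)" by (rule norm_cauchy_schwarz)
    finally show ?thesis by (cases "x = 0") auto
  qed
  then have "1 \<le> \<bar>det ?E\<bar>" by (rule abs_det_expansion_ge_1)
  also have "det ?E = det K * det K * det (transpose N ** N + transpose R ** R)"
    by (simp add: det_mul det_transpose flip: eq)
  finally have K: "1 \<le> (det K)\<^sup>2 * \<bar>det (transpose N ** N + transpose R ** R)\<bar>"
    by (simp add: abs_mult power2_eq_square)
  have "det N * det K = 1" by (metis NK det_I det_mul)
  then have NK2: "(det N)\<^sup>2 * (det K)\<^sup>2 = 1" by (simp flip: power_mult_distrib)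
  have "(det N)\<^sup>2 \<le> (det N)\<^sup>2 * ((det K)\<^sup>2 * \<bar>det (transpose N ** N + transpose R ** R)\<bar>)"
    using mult_left_mono[OF K, of "(det N)\<^sup>2"] by simp
  also have "\<dots> = \<bar>det (transpose N ** N + transpose R ** R)\<bar>"
    by (simp only: mult.assoc[symmetric] NK2 mult_1)
  finally show ?thesis .
qed simp

lemma scaleR_matrix_simps:
  fixes A :: "real^'n^'n"
  shows "(t *\<^sub>R A) ** B = t *\<^sub>R (A ** B)" "A ** (t *\<^sub>R B) = t *\<^sub>R (A ** B)"
    "transpose (t *\<^sub>R A) = t *\<^sub>R transpose A"
  by (simp_all add: vec_eq_iff matrix_matrix_mult_def transpose_def sum_distrib_left mult_ac)

lemma gram_pencil_det_const_imp_0: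
  fixes A R :: "real^'n^'n"
  assumes sym: "transpose A = A" and "\<delta> > 0"
    and det: "\<And>t. \<bar>t\<bar> < \<delta> \<Longrightarrow>
      det ((mat 1 - t *\<^sub>R A) ** (mat 1 - t *\<^sub>R A) + t\<^sup>2 *\<^sub>R (transpose R ** R)) = 1"
  shows "A = 0" "R = 0"
proof -
  let ?M = "\<lambda>t. (mat 1 - t *\<^sub>R A) ** (mat 1 - t *\<^sub>R A) + t\<^sup>2 *\<^sub>R (transpose R ** R)"
  have lin: "real_polynomial_function (\<lambda>t. t)"
    by (intro real_polynomial_function.intros(1) bounded_linear_ident)
  note pol = real_polynomial_function.intros(2-4) real_polynomial_function_diff
    real_polynomial_function_sum lin
  have "real_polynomial_function (\<lambda>t. det (?M t))"
    by (rule real_polynomial_function_det)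
      (auto simp: matrix_matrix_mult_def power2_eq_square intro!: pol)
  then have "(\<lambda>t. det (?M t)) = (\<lambda>_. 1)"
    by (rule real_polynomial_function_eqI[where S = "{-\<delta><..<\<delta>}"]) (use \<open>\<delta> > 0\<close> det in auto)
  then have M1: "det (?M t) = 1" for t by metis
  \<comment> \<open>Symmetry of \<open>A\<close> makes the first summand of \<open>?M t\<close> the
    Gram matrix of \<open>mat 1 - t *\<^sub>R A\<close>; the second is that of
    \<open>t *\<^sub>R R\<close>.\<close>
  have bound: "\<bar>det (mat 1 - t *\<^sub>R A)\<bar> \<le> 1" for t
  proof -
    have "transpose (mat 1 - t *\<^sub>R A) = mat 1 - t *\<^sub>R A"
      using sym by (simp add: vec_eq_iff transpose_def mat_def)
    then have "(det (mat 1 - t *\<^sub>R A))\<^sup>2 \<le> 1"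
      using abs_det_le_abs_det_gram_sum[of "mat 1 - t *\<^sub>R A" "t *\<^sub>R R"] M1[of t]
      by (simp add: scaleR_matrix_simps power2_eq_square)
    then show ?thesis by (simp add: abs_square_le_1)
  qed
  have "real_polynomial_function (\<lambda>t. det (mat 1 - t *\<^sub>R A))"
    by (rule real_polynomial_function_det) (auto intro!: pol)
  then have N1: "det (mat 1 - t *\<^sub>R A) = 1" for t
    using bounded_real_polynomial_function_const[of "\<lambda>t. det (mat 1 - t *\<^sub>R A)" 1 t 0] bound by simp
  \<comment> \<open>The product of the pencil at \<open>t\<close> and at \<open>- t\<close> has no
    odd terms, and by symmetry its quadratic term is a Gram matrix.\<close>
  have "det (mat 1 + (- 1 * t\<^sup>2) *\<^sub>R (transpose A ** A)) = 1" for t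
  proof -
    have "A ** (mat 1 - (- t) *\<^sub>R A) = A + t *\<^sub>R (A ** A)"
      by (simp add: matrix_add_ldistrib scaleR_matrix_simps)
    moreover have "(mat 1 - t *\<^sub>R A) ** (mat 1 - (- t) *\<^sub>R A)
        = (mat 1 - (- t) *\<^sub>R A) - t *\<^sub>R (A ** (mat 1 - (- t) *\<^sub>R A))"
      by (simp only: matrix_diff_rdistrib matrix_mul_lid scaleR_matrix_simps)
    ultimately have "(mat 1 - t *\<^sub>R A) ** (mat 1 - (- t) *\<^sub>R A)
        = mat 1 + (- 1 * t\<^sup>2) *\<^sub>R (A ** A)"
      by (simp add: power2_eq_square scaleR_add_right)
    moreover have "det ((mat 1 - t *\<^sub>R A) ** (mat 1 - (- t) *\<^sub>R A)) = 1"
      by (simp only: det_mul N1 mult_1)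
    ultimately show ?thesis by (simp only: sym)
  qed
  then show A0: "A = 0" by (rule det_mat_1_plus_gram_const_imp_0[rotated]) simp
  show "R = 0"
    by (rule det_mat_1_plus_gram_const_imp_0[of 1]) (use M1 A0 in simp_all)
qed

lemma trace_transpose: "trace (transpose A) = trace (A :: real^'n^'n)"
  by (simp add: trace_def transpose_def)

lemma trace_uminus: "trace (- A) = - trace (A :: real^'n^'n)"
  by (simp add: trace_def sum_negf)

lemma matrix_uminus_mul:
  fixes A B :: "real^'n^'n"
  shows "(- A) ** B = - (A ** B)"
  by (simp add: vec_eq_iff matrix_matrix_mult_def sum_negf)

lemma transpose_add: "transpose (A + B) = transpose A + transpose (B :: real^'n^'m)"
  by (simp add: vec_eq_iff transpose_def)

lemma transpose_diff: "transpose (A - B) = transpose A - transpose (B :: real^'n^'m)"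
  by (simp add: vec_eq_iff transpose_def)

lemma matrix_diff_ldistrib:
  fixes A B C :: "real^'n^'n"
  shows "C ** (A - B) = C ** A - C ** B"
  by (simp add: vec_eq_iff matrix_matrix_mult_def sum_subtractf right_diff_distrib)

section \<open>Volume distortion of a pencil\<close>

text \<open>The trace is the logarithmic derivative of \<open>det M\<close> when \<open>E\<close>
  moves with velocity \<open>D\<close>, and it equals \<open>-2 * trace (X ** P)\<close>.
  Geometrically \<open>X ** P\<close> carries the shape operator of the displaced leaf, so the
  vanishing trace is the minimality of that leaf.\<close>

lemma trace_gram_derivative_eq_0:
  fixes P0 P X E D K M :: "real^'n^'n"
  assumes P0: "transpose P0 = P0" "P0 ** P0 = P0" and P: "transpose P = P"
    and E: "E ** P0 = E" and PE: "P ** E = E"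
    and onto: "\<And>x. \<exists>v. P *v x = E *v v"
    and XE: "X ** E = - (P ** D)" and XP: "trace (X ** P) = 0"
    and M: "M = transpose E ** E + (mat 1 - P0)" and KM: "K ** M = mat 1"
  shows "trace (K ** (transpose D ** E + transpose E ** D)) = 0"
proof -
  have Mt: "transpose M = M"
    by (simp add: M P0 transpose_add transpose_diff matrix_transpose_mul transpose_mat)
  have MK: "M ** K = mat 1" using KM by (simp add: matrix_left_right_inverse)
  have Kt: "transpose K = K"
  proof -
    have "transpose K = transpose K ** (M ** K)" by (simp add: MK)
    also have "\<dots> = transpose (M ** K) ** K"
      by (simp add: matrix_transpose_mul Mt matrix_mul_assoc)
    finally show ?thesis by (simp add: MK transpose_mat)
  qed
  \<comment> \<open>On the range of \<open>P0\<close> the matrix \<open>K\<close> inverts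
    \<open>transpose E ** E\<close>, so this is the usual formula for the orthogonal projection onto
    the image of \<open>E\<close>. It is shown to agree with \<open>P\<close>.\<close>
  define R where "R = E ** K ** transpose E"
  have Rt: "transpose R = R"
    by (simp add: R_def matrix_transpose_mul Kt matrix_mul_assoc)
  have "M ** P0 = transpose E ** E"
    by (simp add: M matrix_add_rdistrib matrix_diff_rdistrib P0 E flip: matrix_mul_assoc)
  then have "K ** (transpose E ** E) = P0"
    by (metis KM matrix_mul_assoc matrix_mul_lid)
  then have RE: "R ** E = E"
    by (simp add: R_def E flip: matrix_mul_assoc)
  have "R ** P = P"
  proof (rule iffD2[OF matrix_eq], rule allI)
    fix x
    obtain v where v: "P *v x = E *v v" using onto by blast
    have "(R ** P) *v x = (R ** E) *v v" by (simp add: v flip: matrix_vector_mul_assoc)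
    then show "(R ** P) *v x = P *v x" by (simp add: RE v)
  qed
  then have "transpose (R ** P) = P" by (simp add: P)
  then have "P ** R = P" by (simp add: matrix_transpose_mul P Rt)
  moreover have "P ** R = R" by (simp add: R_def matrix_mul_assoc PE)
  ultimately have PR: "P = R" by simp
  have "transpose (P ** E) = transpose E" by (simp add: PE)
  then have EP: "transpose E ** P = transpose E" by (simp add: matrix_transpose_mul P)
  have "X ** P = - (P ** D ** K ** transpose E)"
    unfolding PR[unfolded R_def, THEN arg_cong[of _ _ "\<lambda>Z. X ** Z"]]
    by (simp add: matrix_mul_assoc XE matrix_uminus_mul)
  then have "trace (P ** D ** (K ** transpose E)) = 0"
    using XP by (simp add: trace_uminus matrix_mul_assoc)
  then have "trace ((K ** transpose E) ** (P ** D)) = 0"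
    by (simp only: trace_mul_sym[of "K ** transpose E"])
  then have 1: "trace (K ** (transpose E ** D)) = 0"
    by (metis EP matrix_mul_assoc)
  have "trace (K ** (transpose D ** E)) = trace (transpose (K ** (transpose D ** E)))"
    by (simp add: trace_transpose)
  also have "transpose (K ** (transpose D ** E)) = (transpose E ** D) ** K"
    by (simp add: matrix_transpose_mul Kt matrix_mul_assoc)
  also have "trace ((transpose E ** D) ** K) = trace (K ** (transpose E ** D))"
    by (rule trace_mul_sym)
  finally show ?thesis by (simp add: 1 matrix_add_ldistrib trace_add)
qed

lemma matrix_pencil_eq_0:
  fixes P0 D :: "real^'n^'n" and P X :: "real \<Rightarrow> real^'n^'n"
  assumes "\<delta> > 0" and P0: "transpose P0 = P0" "P0 ** P0 = P0" and D: "D ** P0 = D"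
    and sym: "transpose (P0 ** D) = P0 ** D"
    and P: "\<And>t. \<bar>t\<bar> < \<delta> \<Longrightarrow> transpose (P t) = P t"
    and PE: "\<And>t. \<bar>t\<bar> < \<delta> \<Longrightarrow> P t ** (P0 + t *\<^sub>R D) = P0 + t *\<^sub>R D"
    and onto: "\<And>t x. \<bar>t\<bar> < \<delta> \<Longrightarrow> \<exists>v. P t *v x = (P0 + t *\<^sub>R D) *v v"
    and XE: "\<And>t. \<bar>t\<bar> < \<delta> \<Longrightarrow> X t ** (P0 + t *\<^sub>R D) = - (P t ** D)"
    and XP: "\<And>t. \<bar>t\<bar> < \<delta> \<Longrightarrow> trace (X t ** P t) = 0"
    and inj: "\<And>t v. \<bar>t\<bar> < \<delta> \<Longrightarrow> (P0 + t *\<^sub>R D) *v v = 0 \<Longrightarrow> P0 *v v = 0"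
  shows "D = 0"
proof -
  define E where "E t = P0 + t *\<^sub>R D" for t
  \<comment> \<open>As \<open>E t\<close> vanishes on the kernel of \<open>P0\<close>, this is block
    diagonal: the Gram form of \<open>E t\<close> on the range of \<open>P0\<close> and the identity
    on its complement. The second block makes \<open>M t\<close> invertible without affecting the
    determinant.\<close>
  define M where "M t = transpose (E t) ** E t + (mat 1 - P0)" for t
  have EP0: "E t ** P0 = E t" for t
    by (simp add: E_def matrix_add_rdistrib scaleR_matrix_simps P0 D)
  have deriv: "((\<lambda>t. det (M t)) has_real_derivative 0) (at t)" if t: "\<bar>t\<bar> < \<delta>" for t
  proof -
    have "inj ((*v) (M t))"
    proof (rule linear_injective_0[THEN iffD2, rule_format])
      fix v assume "M t *v v = 0"
      then have "0 = v \<bullet> (M t *v v)" by simp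
      also have "\<dots> = (E t *v v) \<bullet> (E t *v v) + v \<bullet> ((mat 1 - P0) *v v)"
        by (simp add: M_def matrix_vector_mult_add_rdistrib inner_add_right norm_matrix_vector_gram)
      also have "(mat 1 - P0) = transpose (mat 1 - P0) ** (mat 1 - P0)"
        by (simp add: transpose_diff transpose_mat P0 matrix_diff_rdistrib matrix_diff_ldistrib)
      also have "v \<bullet> ((transpose (mat 1 - P0) ** (mat 1 - P0)) *v v)
          = ((mat 1 - P0) *v v) \<bullet> ((mat 1 - P0) *v v)"
        by (rule norm_matrix_vector_gram[symmetric])
      finally have "E t *v v = 0" "(mat 1 - P0) *v v = 0"
        by (smt (verit) inner_ge_zero inner_eq_zero_iff)+
      then show "v = 0"
        using inj[OF t, of v] by (simp add: E_def matrix_vector_mult_diff_rdistrib)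
    qed simp
    \<comment> \<open>Multiplying by the inverse of \<open>M t\<close> moves the differentiation of
      the determinant to the identity matrix, where Jacobi's formula is available.\<close>
    then obtain K where KM: "K ** M t = mat 1"
      using matrix_left_invertible_injective by blast
    let ?D = "transpose D ** E t + transpose (E t) ** D"
    have "((\<lambda>s. M s $ i $ j) has_real_derivative ?D $ i $ j) (at t)" for i j
      unfolding M_def E_def
      by (auto simp: matrix_matrix_mult_def transpose_def sum.distrib[symmetric]
          intro!: derivative_eq_intros sum.cong)
    then have "((\<lambda>s. (K ** M s) $ i $ j) has_real_derivative (K ** ?D) $ i $ j) (at t)" for i j
      unfolding matrix_matrix_mult_def[of K] by (auto intro!: DERIV_sum DERIV_cmult)
    then have "((\<lambda>s. det (K ** M s)) has_real_derivative trace (K ** ?D)) (at t)"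
      by (intro has_real_derivative_det_at_mat_1) (auto simp: KM)
    also have "trace (K ** ?D) = 0"
      by (rule trace_gram_derivative_eq_0[OF P0 P[OF t] EP0 _ _ _ XP[OF t] M_def KM])
        (use PE[OF t] onto[OF t] XE[OF t] in \<open>auto simp: E_def\<close>)
    finally have "((\<lambda>s. det (M t) * det (K ** M s)) has_real_derivative det (M t) * 0) (at t)"
      by (rule DERIV_cmult)
    moreover have "det (M t) * det (K ** M s) = det (M s)" for s
      by (metis KM det_I det_mul mult.commute mult.left_neutral mult.assoc)
    ultimately show ?thesis by simp
  qed
  have "det (M t) = det (M 0)" if t: "\<bar>t\<bar> < \<delta>" for t
  proof -
    obtain c where "\<forall>s\<in>{-\<delta><..<\<delta>}. det (M s) = c"
      by (rule has_field_derivative_zero_constant[THEN exE, of "{-\<delta><..<\<delta>}" "\<lambda>t. det (M t)"])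
        (auto intro!: has_field_derivative_at_within deriv)
    then show ?thesis using t \<open>\<delta> > 0\<close> by (simp add: abs_less_iff)
  qed
  moreover have "M 0 = mat 1" by (simp add: M_def E_def P0)
  ultimately have det1: "det (M t) = 1" if "\<bar>t\<bar> < \<delta>" for t using that by simp
  \<comment> \<open>The tangential part of \<open>D\<close> with the sign of the shape operator, and
    the normal part.\<close>
  let ?A = "- (P0 ** D)" and ?R = "D - P0 ** D"
  have sym': "transpose D ** P0 = P0 ** D" using sym by (simp add: matrix_transpose_mul P0)
  have M_eq: "M t = (mat 1 - t *\<^sub>R ?A) ** (mat 1 - t *\<^sub>R ?A) + t\<^sup>2 *\<^sub>R (transpose ?R ** ?R)" for t
  proof -
    have P0D: "P0 ** (P0 ** D) = P0 ** D" by (metis P0(2) matrix_mul_assoc)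
    have 1: "(P0 ** D) ** (P0 ** D) = transpose D ** (P0 ** D)"
      by (metis P0D sym' matrix_mul_assoc)
    have R: "transpose ?R ** ?R = transpose D ** D - transpose D ** (P0 ** D)"
      by (simp add: transpose_diff sym matrix_diff_rdistrib matrix_diff_ldistrib 1)
        (simp add: matrix_mul_assoc sym')
    show ?thesis
      unfolding R
      by (simp add: M_def E_def transpose_add scaleR_matrix_simps P0 matrix_add_rdistrib
          matrix_add_ldistrib sym' 1 power2_eq_square algebra_simps del: matrix_mul_assoc)
  qed
  have "transpose ?A = ?A" using sym by (simp add: vec_eq_iff transpose_def)
  from gram_pencil_det_const_imp_0[OF this \<open>\<delta> > 0\<close>, of ?R] det1[unfolded M_eq]
  have "?A = 0" "?R = 0" by blast+
  then show ?thesis by simp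
qed

section \<open>Linear pencils\<close>

text \<open>Matrices are indexed by a finite type, whereas \<open>'a\<close> is an arbitrary
  Euclidean space such as \<open>complex^'m\<close>, whose real dimension is twice
  \<open>CARD('m)\<close>. The enumeration \<open>h\<close> of the standard basis by a type
  \<open>'n\<close> mediates between the two.\<close>

definition coords :: "('n::finite \<Rightarrow> 'a::euclidean_space) \<Rightarrow> 'a \<Rightarrow> real^'n" where
  "coords h z = (\<chi> i. z \<bullet> h i)"

definition matrix_wrt :: "('n::finite \<Rightarrow> 'a::euclidean_space) \<Rightarrow> ('a \<Rightarrow> 'a) \<Rightarrow> real^'n^'n" where
  "matrix_wrt h f = (\<chi> i j. f (h j) \<bullet> h i)"

context
  fixes h :: "'n::finite \<Rightarrow> 'a::euclidean_space"
  assumes h: "bij_betw h UNIV Basis"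
begin

lemma sum_basis_reindex: "(\<Sum>i\<in>UNIV. g (h i)) = (\<Sum>b\<in>Basis. g b)"
  using sum.reindex_bij_betw[OF h] .

lemma coords_eq_iff: "coords h x = coords h y \<longleftrightarrow> x = y"
proof
  assume "coords h x = coords h y"
  then have "x \<bullet> h i = y \<bullet> h i" for i by (simp add: coords_def vec_eq_iff)
  moreover have "b \<in> Basis \<Longrightarrow> \<exists>i. b = h i" for b
    using h unfolding bij_betw_def by blast
  ultimately show "x = y" by (metis euclidean_eqI)
qed simp

lemma coords_0: "coords h z = 0 \<longleftrightarrow> z = 0"
  using coords_eq_iff[of z 0] by (simp add: coords_def vec_eq_iff)

lemma ex_coords: "\<exists>z. x = coords h z"
proof
  have inj: "inj h" and hB: "h i \<in> Basis" for i using h by (auto simp: bij_betw_def)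
  have "h j \<bullet> h i = (if i = j then 1 else 0)" for i j
    using hB inj by (auto simp: inner_Basis inj_eq)
  then have "(\<Sum>j\<in>UNIV. x $ j *\<^sub>R h j) \<bullet> h i = x $ i" for i
    by (simp add: inner_sum_left if_distrib[of "\<lambda>z. _ * z"] cong: if_cong)
  then show "x = coords h (\<Sum>j\<in>UNIV. x $ j *\<^sub>R h j)"
    by (simp add: coords_def vec_eq_iff)
qed

lemma matrix_wrt_vector:
  assumes "linear f"
  shows "matrix_wrt h f *v coords h z = coords h (f z)"
proof -
  interpret linear f by fact
  have "f z = f (\<Sum>b\<in>Basis. (z \<bullet> b) *\<^sub>R b)" by (simp add: euclidean_representation)
  also have "\<dots> = (\<Sum>b\<in>Basis. (z \<bullet> b) *\<^sub>R f b)" by (simp add: sum scale)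
  also have "\<dots> = (\<Sum>i\<in>UNIV. (z \<bullet> h i) *\<^sub>R f (h i))" by (rule sum_basis_reindex[symmetric])
  finally show ?thesis
    by (simp add: matrix_wrt_def coords_def matrix_vector_mult_def vec_eq_iff inner_sum_left mult.commute)
qed

lemma matrix_wrt_eqI:
  assumes "\<And>z. A *v coords h z = B *v coords h z"
  shows "A = B"
  using assms ex_coords by (metis matrix_eq)

lemma matrix_wrt_mult:
  assumes "linear f" "linear g"
  shows "matrix_wrt h f ** matrix_wrt h g = matrix_wrt h (\<lambda>z. f (g z))"
  by (rule matrix_wrt_eqI)
    (simp add: assms matrix_wrt_vector linear_compose[unfolded o_def] flip: matrix_vector_mul_assoc)

lemma trace_matrix_wrt: "trace (matrix_wrt h f) = (\<Sum>b\<in>Basis. f b \<bullet> b)"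
  using sum_basis_reindex[of "\<lambda>b. f b \<bullet> b"] by (simp add: trace_def matrix_wrt_def)

lemma transpose_matrix_wrt:
  assumes "\<And>x y. f x \<bullet> y = x \<bullet> f y"
  shows "transpose (matrix_wrt h f) = matrix_wrt h f"
proof -
  have "f (h i) \<bullet> h j = f (h j) \<bullet> h i" for i j
    by (subst assms) (rule inner_commute)
  then show ?thesis by (simp add: transpose_def matrix_wrt_def vec_eq_iff)
qed

text \<open>The coordinate-free form of the matrix statement. The hypotheses speak about
  \<open>B\<close> on the range of \<open>P0\<close>, so \<open>D\<close> is taken to be the matrix
  of \<open>B\<close> after \<open>P0\<close>; this also yields \<open>D ** P0 = D\<close>.\<close>

lemma linear_pencil_eq_0:
  fixes P0 B :: "'a \<Rightarrow> 'a" and P X :: "real \<Rightarrow> 'a \<Rightarrow> 'a"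
  assumes "\<delta> > 0" and B: "linear B"
    and P0: "linear P0" "\<And>x y. P0 x \<bullet> y = x \<bullet> P0 y" "\<And>x. P0 (P0 x) = P0 x"
    and sym: "\<And>u v. P0 u = u \<Longrightarrow> P0 v = v \<Longrightarrow> B u \<bullet> v = u \<bullet> B v"
    and P: "\<And>t. \<bar>t\<bar> < \<delta> \<Longrightarrow> linear (P t)" "\<And>t x y. \<bar>t\<bar> < \<delta> \<Longrightarrow> P t x \<bullet> y = x \<bullet> P t y"
    and X: "\<And>t. \<bar>t\<bar> < \<delta> \<Longrightarrow> linear (X t)"
    and PE: "\<And>t v. \<bar>t\<bar> < \<delta> \<Longrightarrow> P0 v = v \<Longrightarrow> P t (v + t *\<^sub>R B v) = v + t *\<^sub>R B v"
    and onto: "\<And>t x. \<bar>t\<bar> < \<delta> \<Longrightarrow> \<exists>v. P0 v = v \<and> P t x = v + t *\<^sub>R B v"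
    and XE: "\<And>t v. \<bar>t\<bar> < \<delta> \<Longrightarrow> P0 v = v \<Longrightarrow> X t (v + t *\<^sub>R B v) = - P t (B v)"
    and XP: "\<And>t. \<bar>t\<bar> < \<delta> \<Longrightarrow> (\<Sum>b\<in>Basis. X t (P t b) \<bullet> b) = 0"
    and inj: "\<And>t v. \<bar>t\<bar> < \<delta> \<Longrightarrow> P0 v = v \<Longrightarrow> v + t *\<^sub>R B v = 0 \<Longrightarrow> v = 0"
    and "P0 v = v"
  shows "B v = 0"
proof -
  have BP0: "linear (\<lambda>z. B (P0 z))" using linear_compose[OF P0(1) B] by (simp add: o_def)
  let ?E = "\<lambda>t z. P0 z + t *\<^sub>R B (P0 z)"
  have lin_E: "linear (?E t)" for t
    using P0(1) BP0 by (intro linear_compose_add linear_compose_scale_right)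
  let ?D = "matrix_wrt h (\<lambda>z. B (P0 z))"
  have E: "matrix_wrt h P0 + t *\<^sub>R ?D = matrix_wrt h (?E t)" for t
    by (simp add: matrix_wrt_def vec_eq_iff inner_add_left)
  have "?D = 0"
  proof (rule matrix_pencil_eq_0[of \<delta> "matrix_wrt h P0" ?D "\<lambda>t. matrix_wrt h (P t)" "\<lambda>t. matrix_wrt h (X t)"],
      unfold E)
    show "matrix_wrt h P0 ** matrix_wrt h P0 = matrix_wrt h P0" "?D ** matrix_wrt h P0 = ?D"
      by (simp_all add: matrix_wrt_mult P0 BP0)
    have "P0 (B (P0 x)) \<bullet> y = x \<bullet> P0 (B (P0 y))" for x y
      using P0(2)[of "B (P0 x)" y] P0(2)[of x "B (P0 y)"] sym[of "P0 x" "P0 y"] P0(3) by simp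
    then show "transpose (matrix_wrt h P0 ** ?D) = matrix_wrt h P0 ** ?D"
      by (simp add: matrix_wrt_mult P0 BP0 transpose_matrix_wrt)
    fix t :: real
    assume t: "\<bar>t\<bar> < \<delta>"
    show "matrix_wrt h (P t) ** matrix_wrt h (?E t) = matrix_wrt h (?E t)"
      by (simp add: matrix_wrt_mult P[OF t] lin_E PE[OF t] P0)
    show "matrix_wrt h (X t) ** matrix_wrt h (?E t) = - (matrix_wrt h (P t) ** ?D)"
      by (simp add: matrix_wrt_mult P[OF t] lin_E X[OF t] BP0 XE[OF t] P0)
        (simp add: matrix_wrt_def vec_eq_iff)
    show "trace (matrix_wrt h (X t) ** matrix_wrt h (P t)) = 0"
      by (simp add: matrix_wrt_mult P[OF t] X[OF t] trace_matrix_wrt XP[OF t])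
    show "\<exists>v. matrix_wrt h (P t) *v x = matrix_wrt h (?E t) *v v" for x
    proof -
      obtain z where z: "x = coords h z" using ex_coords by blast
      obtain v where "P0 v = v" "P t z = v + t *\<^sub>R B v" using onto[OF t] by blast
      then have "matrix_wrt h (P t) *v x = matrix_wrt h (?E t) *v coords h v"
        by (simp add: z matrix_wrt_vector P[OF t] lin_E)
      then show ?thesis ..
    qed
    show "matrix_wrt h P0 *v x = 0" if "matrix_wrt h (?E t) *v x = 0" for x
    proof -
      obtain z where z: "x = coords h z" using ex_coords by blast
      then have "?E t z = 0" using that by (simp add: matrix_wrt_vector lin_E coords_0)
      then have "P0 z = 0" using inj[OF t, of "P0 z"] P0 by simp
      then show ?thesis by (simp add: z matrix_wrt_vector P0 coords_0)
    qed
  qed (use \<open>\<delta> > 0\<close> P P0 in \<open>simp_all add: transpose_matrix_wrt\<close>)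
  then have "coords h (B (P0 v)) = 0"
    using matrix_wrt_vector[OF BP0, of v] by simp
  then show ?thesis using \<open>P0 v = v\<close> by (simp add: coords_0)
qed

end

section \<open>Smooth maps and second derivatives\<close>

lemma frechet_derivative_worksI:
  "f differentiable F \<Longrightarrow> (f has_derivative frechet_derivative f F) F"
  by (rule frechet_derivative_works[THEN iffD1])

lemma frechet_derivative_cong_open:
  assumes "open S" "x \<in> S" "\<And>y. y \<in> S \<Longrightarrow> f y = g y"
  shows "frechet_derivative f (at x) = frechet_derivative g (at x)"
proof -
  have "(f has_derivative F) (at x) \<longleftrightarrow> (g has_derivative F) (at x)" for F
  proof
    show "(f has_derivative F) (at x) \<Longrightarrow> (g has_derivative F) (at x)"
      by (rule has_derivative_transform_within_open[OF _ assms])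
    show "(g has_derivative F) (at x) \<Longrightarrow> (f has_derivative F) (at x)"
      by (rule has_derivative_transform_within_open[OF _ assms(1,2) assms(3)[symmetric]])
  qed
  then show ?thesis by (simp add: frechet_derivative_def)
qed

lemma differentiable_cong_open:
  assumes "open S" "x \<in> S" "\<And>y. y \<in> S \<Longrightarrow> f y = g y" "f differentiable (at x)"
  shows "g differentiable (at x)"
proof -
  obtain D where "(f has_derivative D) (at x)" using assms(4) by (auto simp: differentiable_def)
  then have "(g has_derivative D) (at x)"
    by (rule has_derivative_transform_within_open[OF _ assms(1-3)])
  then show ?thesis by (auto simp: differentiable_def)
qed

lemma Ck_on_cong:
  assumes "open S" "\<And>x. x \<in> S \<Longrightarrow> f x = g x"
  shows "Ck_on k S f \<longleftrightarrow> Ck_on k S g"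
  using assms
proof (induction k arbitrary: f g)
  case 0
  then show ?case by (simp cong: continuous_on_cong)
next
  case (Suc k)
  have "Ck_on k S (\<lambda>x. frechet_derivative f (at x) v) \<longleftrightarrow> Ck_on k S (\<lambda>x. frechet_derivative g (at x) v)" for v
    using frechet_derivative_cong_open[OF Suc.prems(1) _ Suc.prems(2)] Suc.prems(1) by (intro Suc.IH) auto
  moreover have "(\<forall>x\<in>S. f differentiable (at x)) \<longleftrightarrow> (\<forall>x\<in>S. g differentiable (at x))"
  proof (intro iffI ballI)
    fix x assume "\<forall>x\<in>S. f differentiable (at x)" "x \<in> S"
    then show "g differentiable (at x)"
      using differentiable_cong_open[OF \<open>open S\<close> _ Suc.prems(2), of x] by simp
  next
    fix x assume "\<forall>x\<in>S. g differentiable (at x)" "x \<in> S"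
    then show "f differentiable (at x)"
      using differentiable_cong_open[OF \<open>open S\<close> _ Suc.prems(2)[symmetric], of x] by simp
  qed
  ultimately show ?case by simp
qed

text \<open>Allows an explicit derivative formula in place of \<open>frechet_derivative\<close>. The
  closure properties below then become inductions on \<open>k\<close> through the sum, product and
  chain rules.\<close>

lemma Ck_on_SucI:
  assumes "open S" "\<And>x. x \<in> S \<Longrightarrow> (f has_derivative D x) (at x)"
    "\<And>v. Ck_on k S (\<lambda>x. D x v)"
  shows "Ck_on (Suc k) S f"
proof -
  have "D x v = frechet_derivative f (at x) v" if "x \<in> S" for x v
    by (simp add: frechet_derivative_at[OF assms(2)[OF that], symmetric])
  then have "Ck_on k S (\<lambda>x. frechet_derivative f (at x) v)" for v
    using Ck_on_cong[OF \<open>open S\<close>, of "\<lambda>x. D x v" "\<lambda>x. frechet_derivative f (at x) v" k] assms(3)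
    by blast
  then show ?thesis using assms(2) by (auto simp: differentiable_def)
qed

lemma Ck_on_Suc_imp_Ck_on: "Ck_on (Suc k) S f \<Longrightarrow> Ck_on k S f"
proof (induction k arbitrary: f)
  case 0
  then show ?case
    by (auto intro!: continuous_at_imp_continuous_on differentiable_imp_continuous_within)
next
  case (Suc k)
  then show ?case by (metis Ck_on.simps(2))
qed

lemma Ck_on_const: "Ck_on k S (\<lambda>_. c)"
  by (induction k arbitrary: c) (simp_all add: frechet_derivative_const)

lemma Ck_on_bounded_linear:
  assumes "bounded_linear L" "open S" "Ck_on k S f"
  shows "Ck_on k S (\<lambda>x. L (f x))"
  using assms(3)
proof (induction k arbitrary: f)
  case 0
  then show ?case using assms(1) by (auto intro: bounded_linear.continuous_on)
next
  case (Suc k)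
  have D: "((\<lambda>x. L (f x)) has_derivative (\<lambda>v. L (frechet_derivative f (at x) v))) (at x)" if "x \<in> S" for x
    using Suc.prems that
    by (intro bounded_linear.has_derivative[OF assms(1)]) (simp add: frechet_derivative_worksI)
  moreover have "Ck_on k S (\<lambda>x. L (frechet_derivative f (at x) v))" for v
    using Suc by simp
  ultimately show ?case by (rule Ck_on_SucI[OF \<open>open S\<close>])
qed

lemma Ck_on_add:
  assumes "open S" "Ck_on k S f" "Ck_on k S g"
  shows "Ck_on k S (\<lambda>x. f x + g x)"
  using assms(2,3)
proof (induction k arbitrary: f g)
  case 0
  then show ?case by (simp add: continuous_on_add)
next
  case (Suc k)
  have D: "((\<lambda>x. f x + g x) has_derivative (\<lambda>v. frechet_derivative f (at x) v + frechet_derivative g (at x) v)) (at x)"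
    if "x \<in> S" for x
    using Suc.prems that by (intro has_derivative_add) (simp_all add: frechet_derivative_worksI)
  moreover have "Ck_on k S (\<lambda>x. frechet_derivative f (at x) v + frechet_derivative g (at x) v)" for v
    using Suc by simp
  ultimately show ?case by (rule Ck_on_SucI[OF \<open>open S\<close>])
qed

lemma Ck_on_sum:
  assumes "open S" "\<And>i. i \<in> I \<Longrightarrow> Ck_on k S (f i)"
  shows "Ck_on k S (\<lambda>x. \<Sum>i\<in>I. f i x)"
  using assms(2)
  by (induction I rule: infinite_finite_induct) (auto intro: Ck_on_const Ck_on_add[OF \<open>open S\<close>])

lemma Ck_on_scaleR:
  fixes g :: "'a::real_normed_vector \<Rightarrow> 'b::real_normed_vector"
  assumes "open S" "Ck_on k S r" "Ck_on k S g"
  shows "Ck_on k S (\<lambda>x. r x *\<^sub>R g x)"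
  using assms(2,3)
proof (induction k arbitrary: r g)
  case 0
  then show ?case by (simp add: continuous_on_scaleR)
next
  case (Suc k)
  let ?D = "\<lambda>x v. r x *\<^sub>R frechet_derivative g (at x) v + frechet_derivative r (at x) v *\<^sub>R g x"
  have D: "((\<lambda>x. r x *\<^sub>R g x) has_derivative ?D x) (at x)" if "x \<in> S" for x
    using Suc.prems that by (intro has_derivative_scaleR) (simp_all add: frechet_derivative_worksI)
  moreover have "Ck_on k S (\<lambda>x. ?D x v)" for v
    using Suc.prems by (intro Ck_on_add[OF \<open>open S\<close>] Suc.IH) (simp_all add: Ck_on_Suc_imp_Ck_on)
  ultimately show ?case by (rule Ck_on_SucI[OF \<open>open S\<close>])
qed

lemma linear_sum_Basis:
  fixes f :: "'a::euclidean_space \<Rightarrow> 'b::real_vector"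
  assumes "linear f"
  shows "f z = (\<Sum>b\<in>Basis. (z \<bullet> b) *\<^sub>R f b)"
proof -
  interpret linear f by fact
  have "f z = f (\<Sum>b\<in>Basis. (z \<bullet> b) *\<^sub>R b)" by (simp add: euclidean_representation)
  then show ?thesis by (simp add: sum scale)
qed

text \<open>In the chain rule the derivative of \<open>f\<close> is applied to a vector that varies
  with \<open>x\<close>, while the recursion controls only fixed directions. Expanding that vector
  in the standard basis leaves products of scalar functions with derivatives in fixed
  directions.\<close>

lemma Ck_on_compose:
  fixes g :: "'a::real_normed_vector \<Rightarrow> 'b::euclidean_space" and f :: "'b \<Rightarrow> 'c::real_normed_vector"
  assumes "open S" "open T" "g ` S \<subseteq> T" "Ck_on k S g" "Ck_on k T f"
  shows "Ck_on k S (\<lambda>x. f (g x))"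
  using assms(4,5)
proof (induction k arbitrary: f)
  case 0
  then show ?case using assms(3) continuous_on_compose2[of T f S g] by simp
next
  case (Suc k)
  let ?D = "\<lambda>x v. frechet_derivative f (at (g x)) (frechet_derivative g (at x) v)"
  have f: "(f has_derivative frechet_derivative f (at (g x))) (at (g x))" if "x \<in> S" for x
    using Suc.prems(2) assms(3) that by (intro frechet_derivative_worksI) auto
  have g: "(g has_derivative frechet_derivative g (at x)) (at x)" if "x \<in> S" for x
    using Suc.prems that by (auto intro: frechet_derivative_worksI)
  have "?D x = (\<lambda>v. \<Sum>b\<in>Basis. (frechet_derivative g (at x) v \<bullet> b) *\<^sub>R frechet_derivative f (at (g x)) b)"
    if "x \<in> S" for x
    using linear_sum_Basis[OF has_derivative_linear[OF f[OF that]]] by blast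
  then have D: "((\<lambda>x. f (g x)) has_derivative
      (\<lambda>v. \<Sum>b\<in>Basis. (frechet_derivative g (at x) v \<bullet> b) *\<^sub>R frechet_derivative f (at (g x)) b)) (at x)"
    if "x \<in> S" for x
    using has_derivative_compose[OF g[OF that] f[OF that]] that by simp
  have "Ck_on k S (\<lambda>x. \<Sum>b\<in>Basis. (frechet_derivative g (at x) v \<bullet> b) *\<^sub>R frechet_derivative f (at (g x)) b)" for v
    using Suc.prems
    by (intro Ck_on_sum Ck_on_scaleR Ck_on_bounded_linear[OF bounded_linear_inner_left] \<open>open S\<close> Suc.IH)
      (simp_all add: Ck_on_Suc_imp_Ck_on)
  with D show ?case by (rule Ck_on_SucI[OF \<open>open S\<close>])
qed

lemma smooth_on_id_plus: "smooth_on S (\<lambda>x. x + c)"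
proof -
  have D: "((\<lambda>x. x + c) has_derivative (\<lambda>v. v)) (at x)" for x :: 'a
    by (auto intro!: derivative_eq_intros)
  then have "frechet_derivative (\<lambda>x. x + c) (at x) = (\<lambda>v. v)" for x :: 'a
    using frechet_derivative_at by metis
  then have "Ck_on k S (\<lambda>x. x + c)" for k
    using D by (cases k) (auto simp: Ck_on_const differentiable_def intro!: continuous_intros)
  then show ?thesis by (simp add: smooth_on_def)
qed

lemma smooth_on_line:
  fixes c :: "'a::real_normed_vector"
  shows "smooth_on S (\<lambda>s::real. c + s *\<^sub>R a)"
proof -
  have D: "((\<lambda>s. c + s *\<^sub>R a) has_derivative (\<lambda>v. v *\<^sub>R a)) (at x)" for x :: real
    by (auto intro!: derivative_eq_intros)
  then have "frechet_derivative (\<lambda>s. c + s *\<^sub>R a) (at x) = (\<lambda>v. v *\<^sub>R a)" for x :: real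
    using frechet_derivative_at by metis
  then have "Ck_on k S (\<lambda>s. c + s *\<^sub>R a)" for k
    using D by (cases k) (auto simp: Ck_on_const differentiable_def intro!: continuous_intros)
  then show ?thesis by (simp add: smooth_on_def)
qed

lemma smooth_on_compose:
  fixes g :: "'a::real_normed_vector \<Rightarrow> 'b::euclidean_space" and f :: "'b \<Rightarrow> 'c::real_normed_vector"
  assumes "open S" "open T" "g ` S \<subseteq> T" "smooth_on S g" "smooth_on T f"
  shows "smooth_on S (\<lambda>x. f (g x))"
  using assms Ck_on_compose unfolding smooth_on_def by blast

lemma smooth_on_cong:
  assumes "open S" "\<And>x. x \<in> S \<Longrightarrow> f x = g x" "smooth_on S f"
  shows "smooth_on S g"
  using assms Ck_on_cong[of S f g] unfolding smooth_on_def by blast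

lemma smooth_on_frechet_derivative:
  "smooth_on S f \<Longrightarrow> smooth_on S (\<lambda>x. frechet_derivative f (at x) v)"
  unfolding smooth_on_def using Ck_on.simps(2) by blast

lemma smooth_on_has_derivative:
  "smooth_on S f \<Longrightarrow> x \<in> S \<Longrightarrow> (f has_derivative frechet_derivative f (at x)) (at x)"
  unfolding smooth_on_def using Ck_on.simps(2) frechet_derivative_worksI by blast

lemma smooth_on_continuous_on: "smooth_on S f \<Longrightarrow> continuous_on S f"
  unfolding smooth_on_def using Ck_on.simps(1) by blast

section \<open>Symmetry of second derivatives\<close>

text \<open>Two applications of the mean value theorem: along \<open>a\<close> to the difference in
  direction \<open>b\<close>, then along \<open>b\<close> to the derivative in direction
  \<open>a\<close>.\<close>

lemma second_difference_mean_value: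
  fixes g :: "'a::real_normed_vector \<Rightarrow> real"
  assumes g: "\<And>z. z \<in> S \<Longrightarrow> (g has_derivative g' z) (at z)"
    and h: "\<And>z. z \<in> S \<Longrightarrow> ((\<lambda>z. g' z a) has_derivative h z) (at z)"
    and S: "\<And>u w. 0 \<le> u \<Longrightarrow> u \<le> s \<Longrightarrow> 0 \<le> w \<Longrightarrow> w \<le> s \<Longrightarrow> y + u *\<^sub>R a + w *\<^sub>R b \<in> S"
    and "0 < s"
  shows "\<exists>u w. 0 < u \<and> u < s \<and> 0 < w \<and> w < s \<and>
    g (y + s *\<^sub>R a + s *\<^sub>R b) - g (y + s *\<^sub>R a) - g (y + s *\<^sub>R b) + g y
      = s * (s * h (y + u *\<^sub>R a + w *\<^sub>R b) b)"
proof -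
  let ?d = "\<lambda>u. g (y + u *\<^sub>R a + s *\<^sub>R b) - g (y + u *\<^sub>R a + 0 *\<^sub>R b)"
  have gd: "((\<lambda>u. g (y + u *\<^sub>R a + w *\<^sub>R b)) has_real_derivative g' (y + u *\<^sub>R a + w *\<^sub>R b) a) (at u)"
    if "0 \<le> u" "u \<le> s" "0 \<le> w" "w \<le> s" for u w
  proof -
    have *: "((\<lambda>u. y + u *\<^sub>R a + w *\<^sub>R b) has_derivative (\<lambda>v. v *\<^sub>R a)) (at u)"
      by (auto intro!: derivative_eq_intros)
    have "((\<lambda>u. g (y + u *\<^sub>R a + w *\<^sub>R b)) has_derivative (\<lambda>v. g' (y + u *\<^sub>R a + w *\<^sub>R b) (v *\<^sub>R a))) (at u)"
      using has_derivative_compose[OF * g[OF S[OF that]]] .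
    moreover have "(\<lambda>v. g' (y + u *\<^sub>R a + w *\<^sub>R b) (v *\<^sub>R a)) = (\<lambda>v. g' (y + u *\<^sub>R a + w *\<^sub>R b) a * v)"
      using linear_scale[OF has_derivative_linear[OF g[OF S[OF that]]]] by (auto simp: mult.commute)
    ultimately show ?thesis by (simp add: has_field_derivative_def)
  qed
  have "\<exists>u. 0 < u \<and> u < s \<and> ?d s - ?d 0 =
      (s - 0) * (g' (y + u *\<^sub>R a + s *\<^sub>R b) a - g' (y + u *\<^sub>R a + 0 *\<^sub>R b) a)"
    using \<open>0 < s\<close> by (intro MVT2 DERIV_diff gd) auto
  then obtain u where u: "0 < u" "u < s" and du: "?d s - ?d 0 =
      s * (g' (y + u *\<^sub>R a + s *\<^sub>R b) a - g' (y + u *\<^sub>R a + 0 *\<^sub>R b) a)"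
    by auto
  have hd: "((\<lambda>w. g' (y + u *\<^sub>R a + w *\<^sub>R b) a) has_real_derivative h (y + u *\<^sub>R a + w *\<^sub>R b) b) (at w)"
    if "0 \<le> w" "w \<le> s" for w
  proof -
    have in_S: "y + u *\<^sub>R a + w *\<^sub>R b \<in> S" using S u that by simp
    have *: "((\<lambda>w. y + u *\<^sub>R a + w *\<^sub>R b) has_derivative (\<lambda>v. v *\<^sub>R b)) (at w)"
      by (auto intro!: derivative_eq_intros)
    have "((\<lambda>w. g' (y + u *\<^sub>R a + w *\<^sub>R b) a) has_derivative (\<lambda>v. h (y + u *\<^sub>R a + w *\<^sub>R b) (v *\<^sub>R b))) (at w)"
      using has_derivative_compose[OF * h[OF in_S]] .
    moreover have "(\<lambda>v. h (y + u *\<^sub>R a + w *\<^sub>R b) (v *\<^sub>R b)) = (\<lambda>v. h (y + u *\<^sub>R a + w *\<^sub>R b) b * v)"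
      using linear_scale[OF has_derivative_linear[OF h[OF in_S]]] by (auto simp: mult.commute)
    ultimately show ?thesis by (simp add: has_field_derivative_def)
  qed
  have "\<exists>w. 0 < w \<and> w < s \<and> g' (y + u *\<^sub>R a + s *\<^sub>R b) a - g' (y + u *\<^sub>R a + 0 *\<^sub>R b) a =
      (s - 0) * h (y + u *\<^sub>R a + w *\<^sub>R b) b"
    using \<open>0 < s\<close> by (intro MVT2 hd) auto
  then obtain w where "0 < w" "w < s" "g' (y + u *\<^sub>R a + s *\<^sub>R b) a - g' (y + u *\<^sub>R a + 0 *\<^sub>R b) a =
      s * h (y + u *\<^sub>R a + w *\<^sub>R b) b"
    by auto
  with u du show ?thesis
    by (intro exI[of _ u] exI[of _ w]) (simp add: algebra_simps)
qed

text \<open>Schwarz's theorem. The second difference over a small parallelogram is symmetric in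
  \<open>a\<close> and \<open>b\<close>, hence equals \<open>s\<^sup>2\<close> times a value of
  either mixed derivative nearby; continuity brings both values back to \<open>y\<close>.\<close>

lemma symmetric_second_derivative:
  fixes g :: "'a::real_normed_vector \<Rightarrow> real"
  assumes "open S" "y \<in> S"
    and g: "\<And>z. z \<in> S \<Longrightarrow> (g has_derivative g' z) (at z)"
    and ha: "\<And>z. z \<in> S \<Longrightarrow> ((\<lambda>z. g' z a) has_derivative ha z) (at z)"
    and hb: "\<And>z. z \<in> S \<Longrightarrow> ((\<lambda>z. g' z b) has_derivative hb z) (at z)"
    and ca: "continuous_on S (\<lambda>z. ha z b)" and cb: "continuous_on S (\<lambda>z. hb z a)"
  shows "ha y b = hb y a"
proof (rule ccontr)
  assume ne: "ha y b \<noteq> hb y a"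
  define e where "e = \<bar>ha y b - hb y a\<bar> / 2"
  have "e > 0" using ne by (simp add: e_def)
  have near_y: "\<forall>\<^sub>F z in nhds y. dist (k z) (k y) < e" if "continuous_on S k" for k :: "'a \<Rightarrow> real"
  proof -
    have "isCont k y" using that \<open>open S\<close> \<open>y \<in> S\<close> by (simp add: continuous_on_eq_continuous_at)
    then show ?thesis
      using \<open>e > 0\<close> by (simp add: isCont_def tendsto_at_iff_tendsto_nhds tendstoD)
  qed
  have "\<forall>\<^sub>F z in nhds y. z \<in> S" using \<open>open S\<close> \<open>y \<in> S\<close> by (rule eventually_nhds_in_open)
  with near_y[OF ca] near_y[OF cb]
  have "\<forall>\<^sub>F z in nhds y. z \<in> S \<and> dist (ha z b) (ha y b) < e \<and> dist (hb z a) (hb y a) < e"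
    by (simp add: eventually_conj)
  then obtain r where "r > 0" and r: "\<And>z. dist z y < r \<Longrightarrow>
      z \<in> S \<and> dist (ha z b) (ha y b) < e \<and> dist (hb z a) (hb y a) < e"
    unfolding eventually_nhds_metric by blast
  \<comment> \<open>The size \<open>s\<close> keeps the parallelogram spanned by
    \<open>s *\<^sub>R a\<close> and \<open>s *\<^sub>R b\<close> inside the ball of radius
    \<open>r\<close>; the summand 1 covers the case of two zero vectors.\<close>
  define N where "N = norm a + norm b + 1"
  define s where "s = r / (2 * N)"
  have "N > 0" unfolding N_def by (smt (verit) norm_ge_zero)
  then have "s > 0" using \<open>r > 0\<close> by (simp add: s_def)
  have sr: "s * (norm a + norm b) < r"
  proof -
    have "s * (norm a + norm b) \<le> s * N" using \<open>s > 0\<close> by (simp add: N_def)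
    also have "\<dots> = r / 2" using \<open>N > 0\<close> by (simp add: s_def)
    finally show ?thesis using \<open>r > 0\<close> by simp
  qed
  have near: "dist (y + u *\<^sub>R a + w *\<^sub>R b) y < r" if "0 \<le> u" "u \<le> s" "0 \<le> w" "w \<le> s" for u w
  proof -
    have "dist (y + u *\<^sub>R a + w *\<^sub>R b) y = norm (u *\<^sub>R a + w *\<^sub>R b)" by (simp add: dist_norm add.assoc)
    also have "\<dots> \<le> u * norm a + w * norm b" using that norm_triangle_ineq[of "u *\<^sub>R a" "w *\<^sub>R b"] by simp
    also have "\<dots> \<le> s * norm a + s * norm b" using that by (intro add_mono mult_right_mono) auto
    finally show ?thesis using sr by (simp add: distrib_left)
  qed
  have "\<exists>u w. 0 < u \<and> u < s \<and> 0 < w \<and> w < s \<and>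
    g (y + s *\<^sub>R a + s *\<^sub>R b) - g (y + s *\<^sub>R a) - g (y + s *\<^sub>R b) + g y
      = s * (s * ha (y + u *\<^sub>R a + w *\<^sub>R b) b)"
    by (rule second_difference_mean_value[OF g ha _ \<open>s > 0\<close>]) (use near r in auto)
  then obtain u w where uw: "0 < u" "u < s" "0 < w" "w < s"
    "g (y + s *\<^sub>R a + s *\<^sub>R b) - g (y + s *\<^sub>R a) - g (y + s *\<^sub>R b) + g y = s * (s * ha (y + u *\<^sub>R a + w *\<^sub>R b) b)"
    by blast
  have in_S: "y + u *\<^sub>R b + w *\<^sub>R a \<in> S" if "0 \<le> u" "u \<le> s" "0 \<le> w" "w \<le> s" for u w
    using near[of w u] r[of "y + w *\<^sub>R a + u *\<^sub>R b"] that by (simp add: add_ac)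
  have "\<exists>u w. 0 < u \<and> u < s \<and> 0 < w \<and> w < s \<and>
    g (y + s *\<^sub>R b + s *\<^sub>R a) - g (y + s *\<^sub>R b) - g (y + s *\<^sub>R a) + g y
      = s * (s * hb (y + u *\<^sub>R b + w *\<^sub>R a) a)"
    by (rule second_difference_mean_value[OF g hb in_S \<open>s > 0\<close>])
  then obtain u' w' where uw': "0 < u'" "u' < s" "0 < w'" "w' < s"
    "g (y + s *\<^sub>R b + s *\<^sub>R a) - g (y + s *\<^sub>R b) - g (y + s *\<^sub>R a) + g y = s * (s * hb (y + u' *\<^sub>R b + w' *\<^sub>R a) a)"
    by blast
  have "s * (s * ha (y + u *\<^sub>R a + w *\<^sub>R b) b) = s * (s * hb (y + u' *\<^sub>R b + w' *\<^sub>R a) a)"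
  proof -
    have "g (y + s *\<^sub>R b + s *\<^sub>R a) = g (y + s *\<^sub>R a + s *\<^sub>R b)" by (simp add: add_ac)
    with uw(5) uw'(5) show ?thesis by linarith
  qed
  then have "ha (y + u *\<^sub>R a + w *\<^sub>R b) b = hb (y + w' *\<^sub>R a + u' *\<^sub>R b) a"
    using \<open>s > 0\<close> by (simp add: add_ac)
  moreover have "dist (ha (y + u *\<^sub>R a + w *\<^sub>R b) b) (ha y b) < e"
    using r near[of u w] uw by auto
  moreover have "dist (hb (y + w' *\<^sub>R a + u' *\<^sub>R b) a) (hb y a) < e"
    using r near[of w' u'] uw' by auto
  ultimately show False by (simp add: e_def dist_real_def abs_real_def split: if_splits)
qed

lemma smooth_on_symmetric_second_derivative:
  fixes f :: "'a::real_normed_vector \<Rightarrow> 'b::euclidean_space"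
  assumes "open S" "y \<in> S" and f: "smooth_on S f"
  shows "frechet_derivative (\<lambda>z. frechet_derivative f (at z) a) (at y) b =
         frechet_derivative (\<lambda>z. frechet_derivative f (at z) b) (at y) a"
proof (rule euclidean_eqI)
  fix e :: 'b
  note sm = f smooth_on_frechet_derivative[OF f]
  have "smooth_on S (\<lambda>z. frechet_derivative (\<lambda>z. frechet_derivative f (at z) c) (at z) d)" for c d
    by (intro smooth_on_frechet_derivative f)
  then have co: "continuous_on S (\<lambda>z. frechet_derivative (\<lambda>z. frechet_derivative f (at z) c) (at z) d \<bullet> e)" for c d
    by (intro continuous_on_inner smooth_on_continuous_on continuous_on_const)
  show "frechet_derivative (\<lambda>z. frechet_derivative f (at z) a) (at y) b \<bullet> e =
         frechet_derivative (\<lambda>z. frechet_derivative f (at z) b) (at y) a \<bullet> e"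
    by (rule symmetric_second_derivative[OF assms(1,2), of "\<lambda>z. f z \<bullet> e" "\<lambda>z v. frechet_derivative f (at z) v \<bullet> e"
        a "\<lambda>z v. frechet_derivative (\<lambda>z. frechet_derivative f (at z) a) (at z) v \<bullet> e" b
          "\<lambda>z v. frechet_derivative (\<lambda>z. frechet_derivative f (at z) b) (at z) v \<bullet> e"])
      (auto intro!: has_derivative_inner_left smooth_on_has_derivative[OF sm(1)]
        smooth_on_has_derivative[OF sm(2)] co)
qed

section \<open>Orthogonal projections\<close>

lemma linear_family_derivative_linear:
  fixes P :: "'a::real_normed_vector \<Rightarrow> 'b::euclidean_space \<Rightarrow> 'c::real_normed_vector"
  assumes lin: "\<And>y. linear (P y)"
    and D: "\<And>z. ((\<lambda>y. P y z) has_derivative (\<lambda>v. D v z)) (at y)"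
  shows "linear (D v)"
proof (rule linearI)
  fix z z' :: 'b and c :: real
  have "((\<lambda>y. P y z + P y z') has_derivative (\<lambda>v. D v z + D v z')) (at y)"
    by (intro has_derivative_add D)
  then have "((\<lambda>y. P y (z + z')) has_derivative (\<lambda>v. D v z + D v z')) (at y)"
    by (simp add: linear_add[OF lin])
  from has_derivative_unique[OF this D] show "D v (z + z') = D v z + D v z'" by metis
  have "((\<lambda>y. c *\<^sub>R P y z) has_derivative (\<lambda>v. c *\<^sub>R D v z)) (at y)"
    by (intro has_derivative_scaleR_right D)
  then have "((\<lambda>y. P y (c *\<^sub>R z)) has_derivative (\<lambda>v. c *\<^sub>R D v z)) (at y)"
    by (simp add: linear_scale[OF lin])
  from has_derivative_unique[OF this D] show "D v (c *\<^sub>R z) = c *\<^sub>R D v z" by metis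
qed

text \<open>A product rule when \<open>P\<close> is known to be differentiable only on each fixed
  vector: \<open>Z s\<close> is expanded in the finite standard basis, and linearity of
  \<open>P\<close> and \<open>D\<close> reassembles the sum.\<close>

lemma has_derivative_linear_family:
  fixes P :: "'a::real_normed_vector \<Rightarrow> 'b::euclidean_space \<Rightarrow> 'c::real_normed_vector"
  assumes lin: "\<And>y. linear (P y)"
    and D: "\<And>z. ((\<lambda>y. P y z) has_derivative (\<lambda>v. D v z)) (at (Y s))"
    and Y: "(Y has_derivative Y') (at s)"
    and Z: "(Z has_derivative Z') (at s)"
  shows "((\<lambda>s. P (Y s) (Z s)) has_derivative (\<lambda>v. D (Y' v) (Z s) + P (Y s) (Z' v))) (at s)"
proof -
  have "((\<lambda>s. P (Y s) b) has_derivative (\<lambda>v. D (Y' v) b)) (at s)" for b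
    using has_derivative_compose[OF Y D] .
  then have "((\<lambda>s. \<Sum>b\<in>Basis. (Z s \<bullet> b) *\<^sub>R P (Y s) b) has_derivative
      (\<lambda>v. \<Sum>b\<in>Basis. (Z s \<bullet> b) *\<^sub>R D (Y' v) b + (Z' v \<bullet> b) *\<^sub>R P (Y s) b)) (at s)"
    by (intro has_derivative_sum has_derivative_scaleR has_derivative_inner_left Z)
  then show ?thesis
    by (simp add: sum.distrib flip: linear_sum_Basis[OF lin]
        linear_sum_Basis[OF linear_family_derivative_linear[OF lin D]])
qed

lemma has_vector_derivative_linear_family:
  fixes P :: "'a::real_normed_vector \<Rightarrow> 'b::euclidean_space \<Rightarrow> 'c::real_normed_vector"
  assumes lin: "\<And>y. linear (P y)"
    and D: "\<And>z. ((\<lambda>y. P y z) has_derivative (\<lambda>v. D v z)) (at (Y s))"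
    and Y: "(Y has_vector_derivative v) (at s)"
    and Z: "(Z has_vector_derivative u) (at s)"
  shows "((\<lambda>s. P (Y s) (Z s)) has_vector_derivative (D v (Z s) + P (Y s) u)) (at s)"
proof -
  have "D (r *\<^sub>R v) (Z s) + P (Y s) (r *\<^sub>R u) = r *\<^sub>R (D v (Z s) + P (Y s) u)" for r
    using linear_scale[OF lin] linear_scale[OF has_derivative_linear[OF D]]
    by (simp add: scaleR_add_right)
  then show ?thesis
    using has_derivative_linear_family[OF lin D Y[unfolded has_vector_derivative_def] Z[unfolded has_vector_derivative_def]]
    unfolding has_vector_derivative_def by simp
qed

lemma eventually_curve_in_open:
  assumes "(\<gamma> has_vector_derivative v) (at s)" "open W" "\<gamma> s \<in> W"
  shows "\<forall>\<^sub>F r in nhds s. \<gamma> r \<in> W"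
proof -
  have "isCont \<gamma> s" by (rule has_vector_derivative_continuous[OF assms(1)])
  then have "(\<gamma> \<longlongrightarrow> \<gamma> s) (nhds s)" by (simp add: isCont_def tendsto_at_iff_tendsto_nhds)
  then show ?thesis using assms(2,3) by (rule topological_tendstoD)
qed

text \<open>Built on \<open>normal_part\<close>, so that the normal component in the second
  fundamental form is the complement of the projection by definition.\<close>

definition orth_proj :: "'a::euclidean_space set \<Rightarrow> 'a \<Rightarrow> 'a" where
  "orth_proj T x = x - normal_part T x"

lemma normal_part_eqI:
  assumes "subspace T" "x - w \<in> T" "\<And>v. v \<in> T \<Longrightarrow> v \<bullet> w = 0"
  shows "normal_part T x = w"
  unfolding normal_part_def
proof (rule the_equality)
  fix w' assume w': "x - w' \<in> T \<and> (\<forall>v\<in>T. orthogonal v w')"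
  have "(x - w) - (x - w') \<in> T" using subspace_diff[OF assms(1,2)] w' by blast
  then have "w' - w \<in> T" by simp
  then have "(w' - w) \<bullet> w' = 0" "(w' - w) \<bullet> w = 0"
    using w' assms(3) by (auto simp: orthogonal_def)
  then have "(w' - w) \<bullet> (w' - w) = 0" by (simp only: inner_diff_right)
  then show "w' = w" by simp
qed (use assms in \<open>auto simp: orthogonal_def\<close>)

lemma orth_proj_eqI:
  assumes "subspace T" "p \<in> T" "\<And>v. v \<in> T \<Longrightarrow> v \<bullet> (x - p) = 0"
  shows "orth_proj T x = p"
  using normal_part_eqI[OF assms(1), of x "x - p"] assms by (simp add: orth_proj_def)

lemma orth_proj:
  assumes "subspace T"
  shows orth_proj_mem: "orth_proj T x \<in> T"
    and orth_proj_orthogonal: "v \<in> T \<Longrightarrow> v \<bullet> (x - orth_proj T x) = 0"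
proof -
  obtain y z where yz: "y \<in> span T" "\<And>w. w \<in> span T \<Longrightarrow> orthogonal z w" "x = y + z"
    using orthogonal_subspace_decomp_exists by blast
  have "span T = T" using assms by simp
  then have "orth_proj T x = y"
    using yz unfolding \<open>span T = T\<close> by (intro orth_proj_eqI[OF assms]) (auto simp: orthogonal_def inner_commute)
  then show "orth_proj T x \<in> T" "v \<in> T \<Longrightarrow> v \<bullet> (x - orth_proj T x) = 0"
    using yz unfolding \<open>span T = T\<close> by (auto simp: orthogonal_def inner_commute)
qed

lemma orth_proj_id: "subspace T \<Longrightarrow> v \<in> T \<Longrightarrow> orth_proj T v = v"
  by (rule orth_proj_eqI) auto

lemma orth_proj_eq_self_iff: "subspace T \<Longrightarrow> orth_proj T v = v \<longleftrightarrow> v \<in> T"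
  using orth_proj_id orth_proj_mem by metis

lemma orth_proj_inner:
  assumes "subspace T"
  shows "orth_proj T x \<bullet> y = x \<bullet> orth_proj T y"
proof -
  have "orth_proj T x \<bullet> (y - orth_proj T y) = 0" "orth_proj T y \<bullet> (x - orth_proj T x) = 0"
    using orth_proj[OF assms] by auto
  then show ?thesis by (simp add: inner_diff_right inner_commute)
qed

lemma linear_orth_proj:
  assumes "subspace T"
  shows "linear (orth_proj T)"
proof (rule linearI)
  fix x y c
  show "orth_proj T (x + y) = orth_proj T x + orth_proj T y"
  proof (rule orth_proj_eqI[OF assms])
    fix v assume "v \<in> T"
    then show "v \<bullet> (x + y - (orth_proj T x + orth_proj T y)) = 0"
      using orth_proj_orthogonal[OF assms \<open>v \<in> T\<close>, of x] orth_proj_orthogonal[OF assms \<open>v \<in> T\<close>, of y]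
      by (simp add: inner_diff_right inner_add_right)
  qed (use assms in \<open>auto intro: subspace_add orth_proj_mem\<close>)
  show "orth_proj T (c *\<^sub>R x) = c *\<^sub>R orth_proj T x"
  proof (rule orth_proj_eqI[OF assms])
    fix v assume "v \<in> T"
    then show "v \<bullet> (c *\<^sub>R x - c *\<^sub>R orth_proj T x) = 0"
      using orth_proj_orthogonal[OF assms \<open>v \<in> T\<close>, of x] by (simp flip: scaleR_diff_right)
  qed (use assms in \<open>auto intro: subspace_scale orth_proj_mem\<close>)
qed

lemma orth_proj_eq_0_iff:
  assumes "subspace T"
  shows "orth_proj T w = 0 \<longleftrightarrow> (\<forall>v\<in>T. v \<bullet> w = 0)"
  using orth_proj_orthogonal[OF assms, of _ w] orth_proj_eqI[OF assms, of 0 w] subspace_0[OF assms] by auto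

text \<open>One Gram-Schmidt step: enlarging the subspace by \<open>e\<close> adds the rank-one
  projection onto the residue \<open>r\<close>.\<close>

lemma orth_proj_span_insert:
  fixes A :: "'a::euclidean_space set"
  assumes "e \<notin> span A"
  defines "r \<equiv> e - orth_proj (span A) e"
  shows "r \<noteq> 0"
    and "orth_proj (span (insert e A)) z = orth_proj (span A) z + ((z \<bullet> r) / (r \<bullet> r)) *\<^sub>R r"
proof -
  let ?p = "orth_proj (span A)"
  show r: "r \<noteq> 0" using orth_proj_mem[OF subspace_span, of A e] assms by auto
  have sub: "span A \<subseteq> span (insert e A)" by (rule span_mono) auto
  have "e \<in> span (insert e A)" by (simp add: span_base)
  then have r_in: "r \<in> span (insert e A)"
    unfolding r_def using sub orth_proj_mem[OF subspace_span, of A e] by (intro span_diff) auto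
  show "orth_proj (span (insert e A)) z = ?p z + ((z \<bullet> r) / (r \<bullet> r)) *\<^sub>R r"
  proof (rule orth_proj_eqI[OF subspace_span])
    show "?p z + ((z \<bullet> r) / (r \<bullet> r)) *\<^sub>R r \<in> span (insert e A)"
      using r_in sub orth_proj_mem[OF subspace_span, of A z] by (intro span_add span_scale) auto
    fix v assume "v \<in> span (insert e A)"
    then obtain k where k: "v - k *\<^sub>R e \<in> span A" using span_breakdown_eq by blast
    let ?w = "z - (?p z + ((z \<bullet> r) / (r \<bullet> r)) *\<^sub>R r)"
    have orth: "u \<bullet> ?w = 0" if "u \<in> span A" for u
      using orth_proj_orthogonal[OF subspace_span that, of z] orth_proj_orthogonal[OF subspace_span that, of e]
      by (simp add: r_def algebra_simps inner_diff_right inner_add_right)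
    have "?p z \<bullet> r = 0"
      using orth_proj_orthogonal[OF subspace_span orth_proj_mem[OF subspace_span], of A z e] by (simp add: r_def)
    then have "r \<bullet> ?w = 0"
      using r by (simp add: inner_diff_right inner_add_right inner_commute)
    moreover have "v = (v - k *\<^sub>R e) + k *\<^sub>R ?p e + k *\<^sub>R r"
      by (simp add: r_def algebra_simps)
    moreover have "(v - k *\<^sub>R e) + k *\<^sub>R ?p e \<in> span A"
      using k orth_proj_mem[OF subspace_span, of A e] by (intro span_add span_scale) auto
    ultimately show "v \<bullet> ?w = 0"
      using orth by (metis inner_add_left inner_scaleR_left add.right_neutral mult_zero_right)
  qed
qed

text \<open>Gram-Schmidt by induction on the frame. Each rank-one update divides by the squared norm
  of a residue, which independence keeps away from zero.\<close>

lemma orth_proj_frame_differentiable: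
  fixes E :: "'i \<Rightarrow> 'a::real_normed_vector \<Rightarrow> 'b::euclidean_space"
  assumes "finite I" "open W"
    and diff: "\<And>i x. i \<in> I \<Longrightarrow> x \<in> W \<Longrightarrow> E i differentiable (at x)"
    and indep: "\<And>x. x \<in> W \<Longrightarrow> inj_on (\<lambda>i. E i x) I \<and> independent ((\<lambda>i. E i x) ` I)"
    and "x \<in> W"
  shows "(\<lambda>x. orth_proj (span ((\<lambda>i. E i x) ` I)) z) differentiable (at x)"
  using assms(1) diff indep \<open>x \<in> W\<close>
proof (induction I arbitrary: z x rule: finite_induct)
  case empty
  have "orth_proj {0} z = 0" by (rule orth_proj_eqI) (auto simp: subspace_single_0)
  then show ?case by simp
next
  case (insert i I)
  let ?P = "\<lambda>x. orth_proj (span ((\<lambda>i. E i x) ` I))"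
  have IH: "(\<lambda>x. ?P x z) differentiable (at x)" if "x \<in> W" for x z
    proof (rule insert.IH)
    fix x assume "x \<in> W"
    then show "inj_on (\<lambda>i. E i x) I \<and> independent ((\<lambda>i. E i x) ` I)"
      using insert.prems(2)[of x] independent_mono[of "(\<lambda>i. E i x) ` insert i I" "(\<lambda>i. E i x) ` I"]
      by auto
  qed (use insert.prems(1) that in auto)
  define R where "R x = E i x - ?P x (E i x)" for x
  have notin: "E i x \<notin> span ((\<lambda>i. E i x) ` I)" if "x \<in> W" for x
  proof -
    have "E i x \<notin> (\<lambda>i. E i x) ` I"
      using insert.prems(2)[OF that] insert.hyps(2) by (auto simp: inj_on_def)
    then show ?thesis
      using insert.prems(2)[OF that] independent_insert[of "E i x" "(\<lambda>i. E i x) ` I"] by simp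
  qed
  have "R differentiable (at x)" if "x \<in> W" for x
  proof -
    have "(\<lambda>x. \<Sum>b\<in>Basis. (E i x \<bullet> b) *\<^sub>R ?P x b) differentiable (at x)"
      using insert.prems(1) IH that by (intro differentiable_sum differentiable_scaleR differentiable_inner) auto
    then have "(\<lambda>x. ?P x (E i x)) differentiable (at x)"
      by (simp flip: linear_sum_Basis[OF linear_orth_proj[OF subspace_span]])
    then show ?thesis
      unfolding R_def using insert.prems(1) that by (intro differentiable_diff) auto
  qed
  moreover have "R x \<noteq> 0"
    using orth_proj_span_insert(1)[OF notin[OF \<open>x \<in> W\<close>]] by (simp add: R_def)
  ultimately have "(\<lambda>x. ?P x z + ((z \<bullet> R x) / (R x \<bullet> R x)) *\<^sub>R R x) differentiable (at x)"
    using IH \<open>x \<in> W\<close>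
    by (intro differentiable_add differentiable_scaleR differentiable_divide differentiable_inner) auto
  moreover have "?P x z + ((z \<bullet> R x) / (R x \<bullet> R x)) *\<^sub>R R x
      = orth_proj (span ((\<lambda>i. E i x) ` insert i I)) z" if "x \<in> W" for x
    using orth_proj_span_insert(2)[OF notin[OF that], of z] by (simp add: R_def)
  ultimately show ?case
    by (rule differentiable_cong_open[OF \<open>open W\<close> \<open>x \<in> W\<close>, rotated])
qed

section \<open>Riemannian distributions\<close>

text \<open>The condition \<open>integrable\<close> is Frobenius's: extending \<open>u\<close> and
  \<open>v\<close> by projection to tangent fields, the difference of the two sides is their Lie
  bracket at \<open>x\<close>. Subspaces are demanded at every point, also outside \<open>U\<close>,
  so that \<open>P y\<close> is linear for all \<open>y\<close>.\<close>

locale riemannian_distribution =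
  fixes U :: "'a::euclidean_space set" and T :: "'a \<Rightarrow> 'a set" and k :: nat
  assumes open_U: "open U"
    and subspace_T: "subspace (T x)"
    and dim_T: "x \<in> U \<Longrightarrow> dim (T x) = k"
    and differentiable_proj: "x \<in> U \<Longrightarrow> (\<lambda>y. orth_proj (T y) z) differentiable (at x)"
    and integrable: "\<lbrakk>x \<in> U; u \<in> T x; v \<in> T x\<rbrakk> \<Longrightarrow>
      frechet_derivative (\<lambda>y. orth_proj (T y) v) (at x) u = frechet_derivative (\<lambda>y. orth_proj (T y) u) (at x) v"
    and bundle_like: "\<lbrakk>closed_segment a b \<subseteq> U; x \<in> closed_segment a b; y \<in> closed_segment a b;
      \<And>v. v \<in> T x \<Longrightarrow> v \<bullet> (b - a) = 0; v \<in> T y\<rbrakk> \<Longrightarrow> v \<bullet> (b - a) = 0"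
begin

abbreviation P where "P y \<equiv> orth_proj (T y)"

abbreviation DP where "DP y v z \<equiv> frechet_derivative (\<lambda>y. P y z) (at y) v"

lemma linear_P: "linear (P y)"
  by (rule linear_orth_proj[OF subspace_T])

lemma P_inner: "P y z \<bullet> z' = z \<bullet> P y z'"
  by (rule orth_proj_inner[OF subspace_T])

lemma P_mem: "P y z \<in> T y"
  by (rule orth_proj_mem[OF subspace_T])

lemma P_P: "P y (P y z) = P y z"
  by (rule orth_proj_id[OF subspace_T P_mem])

lemma P_has_derivative: "x \<in> U \<Longrightarrow> ((\<lambda>y. P y z) has_derivative (\<lambda>v. DP x v z)) (at x)"
  using frechet_derivative_worksI[OF differentiable_proj] by simp

lemma linear_DP: "x \<in> U \<Longrightarrow> linear (\<lambda>v. DP x v z)"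
  by (rule has_derivative_linear[OF P_has_derivative])

lemma linear_DP2: "x \<in> U \<Longrightarrow> linear (DP x v)"
  by (rule linear_family_derivative_linear[OF linear_P P_has_derivative])

lemma DP_inner:
  assumes "x \<in> U"
  shows "DP x v z \<bullet> z' = z \<bullet> DP x v z'"
proof -
  have "((\<lambda>y. P y z \<bullet> z') has_derivative (\<lambda>v. DP x v z \<bullet> z')) (at x)"
    by (intro has_derivative_inner_left P_has_derivative assms)
  moreover have "((\<lambda>y. z \<bullet> P y z') has_derivative (\<lambda>v. z \<bullet> DP x v z')) (at x)"
    by (intro has_derivative_inner_right P_has_derivative assms)
  ultimately show ?thesis
    unfolding P_inner using has_derivative_unique by metis
qed

text \<open>The derivative of \<open>P\<^sup>2 = P\<close>. It implies that \<open>DP x v\<close>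
  exchanges tangent and normal vectors, which the next two lemmas record.\<close>

lemma DP_product:
  assumes "x \<in> U"
  shows "DP x v z = DP x v (P x z) + P x (DP x v z)"
proof -
  have "((\<lambda>y. P y (P y z)) has_derivative (\<lambda>v. DP x v (P x z) + P x (DP x v z))) (at x)"
    by (rule has_derivative_linear_family[OF linear_P P_has_derivative[OF assms] has_derivative_ident
          P_has_derivative[OF assms]])
  from has_derivative_unique[OF P_has_derivative[OF assms] this[unfolded P_P]] show ?thesis
    by metis
qed

lemma P_DP_tangent: "x \<in> U \<Longrightarrow> z \<in> T x \<Longrightarrow> P x (DP x v z) = 0"
  using DP_product[where x = x and v = v and z = z] orth_proj_id[OF subspace_T, of z x] by simp

lemma P_DP_normal: "x \<in> U \<Longrightarrow> P x z = 0 \<Longrightarrow> P x (DP x v z) = DP x v z"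
  using DP_product[where x = x and v = v and z = z] linear_0[OF linear_DP2, of x v] by simp

lemma P_curve_has_vector_derivative:
  assumes "Y s \<in> U" "(Y has_vector_derivative v) (at s)" "(Z has_vector_derivative u) (at s)"
  shows "((\<lambda>s. P (Y s) (Z s)) has_vector_derivative (DP (Y s) v (Z s) + P (Y s) u)) (at s)"
  by (rule has_vector_derivative_linear_family[where P = P and D = "\<lambda>v z. DP (Y s) v z",
        OF linear_P P_has_derivative[OF assms(1)] assms(2,3)])

lemma P_along_normal_segment:
  assumes "P x w = 0" "closed_segment x (x + t *\<^sub>R w) \<subseteq> U"
  shows "P (x + t *\<^sub>R w) w = 0"
proof (cases "t = 0")
  case False
  have "v \<bullet> (x + t *\<^sub>R w - x) = 0" if "v \<in> T (x + t *\<^sub>R w)" for v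
  proof (rule bundle_like[OF assms(2) _ _ _ that])
    show "v \<bullet> (x + t *\<^sub>R w - x) = 0" if "v \<in> T x" for v
      using assms(1) that unfolding orth_proj_eq_0_iff[OF subspace_T] by simp
  qed auto
  then show ?thesis using False unfolding orth_proj_eq_0_iff[OF subspace_T] by simp
qed (use assms in simp)

text \<open>The normal bundle is invariant under \<open>(x, w) \<mapsto> (x + t w, w)\<close>. This map is symplectic, so it
  also preserves the characteristic distribution of the normal bundle; the next two lemmas say so
  without mentioning the symplectic form. They yield the holonomy Jacobi fields \<open>v + t B v\<close> along
  the normal segment, which fill the leaf tangent spaces.\<close>

lemma P_normal_shift:
  assumes "x \<in> U" "P x w = 0" "ball x r \<subseteq> U" "x + t *\<^sub>R w \<in> ball x r" "P (x + t *\<^sub>R w) n = 0"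
  shows "P x n = t *\<^sub>R DP x n w"
proof -
  let ?y = "x + t *\<^sub>R w"
  have "r > 0" using assms(4) by (metis ball_empty empty_iff not_le)
  have y: "P ?y w = 0"
    using assms(3,4) \<open>r > 0\<close> closed_segment_subset[OF _ assms(4) convex_ball, of x]
    by (intro P_along_normal_segment assms(2)) auto
  \<comment> \<open>All vectors \<open>w + s *\<^sub>R n\<close> are normal at the fixed point
    \<open>?y\<close>. Going back along them by the parameter \<open>- t\<close> leads to
    \<open>x - (s * t) *\<^sub>R n\<close>, where they are still normal; the claim is the derivative
    of this at \<open>s = 0\<close>.\<close>
  have Y: "((\<lambda>s. x + s *\<^sub>R (- t *\<^sub>R n)) has_vector_derivative (- t *\<^sub>R n)) (at 0)"
    by (auto intro!: derivative_eq_intros)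
  have Z: "((\<lambda>s. w + s *\<^sub>R n) has_vector_derivative n) (at 0)"
    by (auto intro!: derivative_eq_intros)
  have "((\<lambda>s. P (x + s *\<^sub>R (- t *\<^sub>R n)) (w + s *\<^sub>R n)) has_vector_derivative
      (DP x (- t *\<^sub>R n) w + P x n)) (at 0)"
    using P_curve_has_vector_derivative[OF _ Y Z] assms(1) by simp
  moreover have "((\<lambda>s. P (x + s *\<^sub>R (- t *\<^sub>R n)) (w + s *\<^sub>R n)) has_vector_derivative 0) (at 0)"
  proof -
    have "\<forall>\<^sub>F s in nhds 0. x + s *\<^sub>R (- t *\<^sub>R n) \<in> ball x r"
      by (rule eventually_curve_in_open[OF Y open_ball]) (simp add: \<open>r > 0\<close>)
    then have "\<forall>\<^sub>F s in nhds 0. P (x + s *\<^sub>R (- t *\<^sub>R n)) (w + s *\<^sub>R n) = 0"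
    proof eventually_elim
      case (elim s)
      have eq: "?y + (- t) *\<^sub>R (w + s *\<^sub>R n) = x + s *\<^sub>R (- t *\<^sub>R n)" by (simp add: algebra_simps)
      have "P (?y + (- t) *\<^sub>R (w + s *\<^sub>R n)) (w + s *\<^sub>R n) = 0"
      proof (rule P_along_normal_segment)
        show "P ?y (w + s *\<^sub>R n) = 0"
          by (simp add: linear_add[OF linear_P] linear_scale[OF linear_P] y assms)
        show "closed_segment ?y (?y + - t *\<^sub>R (w + s *\<^sub>R n)) \<subseteq> U"
          unfolding eq using elim assms(4) assms(3) closed_segment_subset[OF _ _ convex_ball] by blast
      qed
      then show ?case by (simp only: eq)
    qed
    then show ?thesis
      by (subst has_vector_derivative_cong_ev[where g = "\<lambda>_. 0"]) (auto dest: eventually_nhds_x_imp_x)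
  qed
  ultimately have "DP x (- t *\<^sub>R n) w + P x n = 0"
    by (rule vector_derivative_unique_at)
  then show ?thesis
  proof -
    have "DP x (- t *\<^sub>R n) w = - t *\<^sub>R DP x n w"
      by (rule linear_scale[OF linear_DP[OF assms(1)]])
    with \<open>DP x (- t *\<^sub>R n) w + P x n = 0\<close> show ?thesis by simp
  qed
qed

lemma DP_normal_shift:
  assumes "x \<in> U" "P x w = 0" "ball x r \<subseteq> U" "x + t *\<^sub>R w \<in> ball x r"
    and u: "P x u = - DP x v w"
  shows "DP (x + t *\<^sub>R w) (v + t *\<^sub>R u) w = - P (x + t *\<^sub>R w) u"
proof -
  let ?y = "x + t *\<^sub>R w"
  have "r > 0" using assms(4) by (metis ball_empty empty_iff not_le)
  have "?y \<in> U" using assms by blast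
  define Y where "Y s = x + s *\<^sub>R v" for s
  \<comment> \<open>A field of normal vectors along the line \<open>Y\<close>. The hypothesis on the
    tangential part of \<open>u\<close> is exactly what makes the velocity of \<open>Z\<close> at 0
    equal to \<open>u\<close>.\<close>
  define Z where "Z s = (w + s *\<^sub>R u) - P (Y s) (w + s *\<^sub>R u)" for s
  have Y0: "Y 0 = x" and Z0: "Z 0 = w" by (simp_all add: Y_def Z_def assms)
  have Y: "(Y has_vector_derivative v) (at 0)"
    unfolding Y_def by (auto intro!: derivative_eq_intros)
  have "((\<lambda>s. w + s *\<^sub>R u) has_vector_derivative u) (at 0)"
    by (auto intro!: derivative_eq_intros)
  moreover from this have "((\<lambda>s. P (Y s) (w + s *\<^sub>R u)) has_vector_derivative (DP x v w + P x u)) (at 0)"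
    using P_curve_has_vector_derivative[OF _ Y, of "\<lambda>s. w + s *\<^sub>R u" u] assms(1) by (simp add: Y0)
  ultimately have "(Z has_vector_derivative (u - (DP x v w + P x u))) (at 0)"
    unfolding Z_def by (rule has_vector_derivative_diff)
  then have Z: "(Z has_vector_derivative u) (at 0)" by (simp add: u)
  have YZ: "((\<lambda>s. Y s + t *\<^sub>R Z s) has_vector_derivative (v + t *\<^sub>R u)) (at 0)"
    using Y Z by (auto intro!: derivative_eq_intros)
  have "((\<lambda>s. P (Y s + t *\<^sub>R Z s) (Z s)) has_vector_derivative (DP ?y (v + t *\<^sub>R u) w + P ?y u)) (at 0)"
    using P_curve_has_vector_derivative[OF _ YZ Z] \<open>?y \<in> U\<close> by (simp add: Y0 Z0)
  moreover have "((\<lambda>s. P (Y s + t *\<^sub>R Z s) (Z s)) has_vector_derivative 0) (at 0)"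
  proof -
    have "\<forall>\<^sub>F s in nhds 0. Y s \<in> ball x r" "\<forall>\<^sub>F s in nhds 0. Y s + t *\<^sub>R Z s \<in> ball x r"
      using eventually_curve_in_open[OF Y open_ball] eventually_curve_in_open[OF YZ open_ball] assms(4) \<open>r > 0\<close>
      by (simp_all add: Y0 Z0)
    then have "\<forall>\<^sub>F s in nhds 0. P (Y s + t *\<^sub>R Z s) (Z s) = 0"
    proof eventually_elim
      case (elim s)
      show ?case
      proof (rule P_along_normal_segment)
        show "P (Y s) (Z s) = 0" by (simp add: Z_def linear_diff[OF linear_P] P_P)
        show "closed_segment (Y s) (Y s + t *\<^sub>R Z s) \<subseteq> U"
          using elim assms(3) closed_segment_subset[OF _ _ convex_ball] by blast
      qed
    qed
    then show ?thesis
      by (subst has_vector_derivative_cong_ev[where g = "\<lambda>_. 0"]) (auto dest: eventually_nhds_x_imp_x)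
  qed
  ultimately have "DP ?y (v + t *\<^sub>R u) w + P ?y u = 0"
    by (rule vector_derivative_unique_at)
  then show ?thesis by (simp add: eq_neg_iff_add_eq_0)
qed

text \<open>It suffices to treat \<open>DP x z v \<bullet> w\<close> with \<open>v\<close> tangent
  and \<open>w\<close> normal, because the symmetric operator \<open>DP x z\<close> exchanges the
  two spaces. The point \<open>x\<close> and the normal vector \<open>w\<close> are fixed, and
  minimality is used along the whole segment in direction \<open>w\<close>.\<close>

theorem harmonic_imp_parallel:
  fixes h :: "'n::finite \<Rightarrow> 'a"
  assumes h: "bij_betw h UNIV Basis"
    and harmonic: "\<And>x w. x \<in> U \<Longrightarrow> P x w = 0 \<Longrightarrow> (\<Sum>b\<in>Basis. DP x (P x b) w \<bullet> b) = 0"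
    and x: "x \<in> U"
  shows "DP x v z = 0"
proof -
  have key: "DP x z v \<bullet> w = 0" if v: "v \<in> T x" and w: "P x w = 0" for v z w
  proof -
    \<comment> \<open>This is forced by \<open>P_normal_shift\<close>: a vector \<open>n\<close>
      normal at \<open>x + t *\<^sub>R w\<close> satisfies
      \<open>v \<bullet> n = t * (DP x n v \<bullet> w)\<close> for tangent \<open>v\<close>, so
      \<open>v + t *\<^sub>R B v\<close> is orthogonal to all such \<open>n\<close>.\<close>
    define B where "B v = - (\<Sum>b\<in>Basis. (DP x b v \<bullet> w) *\<^sub>R b)" for v
    have B_inner: "B v \<bullet> z = - (DP x z v \<bullet> w)" for v z
    proof -
      have "DP x z v \<bullet> w = (\<Sum>b\<in>Basis. (z \<bullet> b) * (DP x b v \<bullet> w))"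
        by (subst linear_sum_Basis[OF linear_DP[OF x]]) (simp add: inner_sum_left)
      then show ?thesis by (simp add: B_def inner_sum_left inner_commute[of z] mult.commute)
    qed
    have B: "linear B"
      by (rule linearI; rule vector_eq_ldot[THEN iffD1], rule allI)
        (simp_all add: inner_commute[of _ "B _"] inner_add_right B_inner linear_add[OF linear_DP2[OF x]]
          linear_scale[OF linear_DP2[OF x]] inner_add_left)
    then obtain \<beta> where \<beta>: "\<beta> > 0" "\<And>v. norm (B v) \<le> \<beta> * norm v"
      using linear_bounded_pos by blast
    obtain r where r: "r > 0" "ball x r \<subseteq> U"
      using open_U x open_contains_ball by blast
    \<comment> \<open>The first bound keeps \<open>x + t *\<^sub>R w\<close> in the ball, the second
      makes \<open>1 + t B\<close> injective.\<close>
    define \<delta> where "\<delta> = min (r / (norm w + 1)) (1 / \<beta>)"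
    have "0 < norm w + 1" by (smt (verit) norm_ge_zero)
    then have "\<delta> > 0" using r \<beta> by (simp add: \<delta>_def)
    have in_ball: "x + t *\<^sub>R w \<in> ball x r" if "\<bar>t\<bar> < \<delta>" for t
    proof -
      have "\<bar>t\<bar> * (norm w + 1) < r"
        using that \<open>0 < norm w + 1\<close> by (simp add: \<delta>_def pos_less_divide_eq)
      then show ?thesis by (simp add: dist_norm algebra_simps)
    qed
    have inj: "v = 0" if "\<bar>t\<bar> < \<delta>" "v + t *\<^sub>R B v = 0" for t v
    proof -
      have "norm v = \<bar>t\<bar> * norm (B v)"
        using that(2) by (metis add_eq_0_iff norm_minus_cancel norm_scaleR)
      also have "\<dots> \<le> \<bar>t\<bar> * \<beta> * norm v" using \<beta>(2)[of v] by (simp add: mult.assoc mult_left_mono)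
      finally have "(1 - \<bar>t\<bar> * \<beta>) * norm v \<le> 0" by (simp add: left_diff_distrib)
      moreover have "1 - \<bar>t\<bar> * \<beta> > 0" using that(1) \<beta>(1) by (simp add: \<delta>_def pos_less_divide_eq)
      ultimately show ?thesis by (simp add: mult_le_0_iff)
    qed
    have P_iff: "P y v = v \<longleftrightarrow> v \<in> T y" for y v by (rule orth_proj_eq_self_iff[OF subspace_T])
    have PE: "P (x + t *\<^sub>R w) (v + t *\<^sub>R B v) = v + t *\<^sub>R B v" if t: "\<bar>t\<bar> < \<delta>" and v: "v \<in> T x" for t v
    proof -
      let ?z = "v + t *\<^sub>R B v"
      define n where "n = ?z - P (x + t *\<^sub>R w) ?z"
      have n: "P (x + t *\<^sub>R w) n = 0" by (simp add: n_def linear_diff[OF linear_P] P_P)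
      have "v \<bullet> n = v \<bullet> P x n" using v P_iff P_inner by metis
      also have "\<dots> = t * (v \<bullet> DP x n w)"
        using P_normal_shift[OF x w r(2) in_ball[OF t] n] by simp
      also have "\<dots> = t * (DP x n v \<bullet> w)" by (simp add: DP_inner[OF x])
      finally have "?z \<bullet> n = 0" by (simp add: inner_add_left B_inner)
      moreover have "P (x + t *\<^sub>R w) ?z \<bullet> n = 0" by (simp add: P_inner n)
      ultimately have "n \<bullet> n = 0" by (simp add: n_def inner_diff_left)
      then show ?thesis by (simp add: n_def)
    qed
    \<comment> \<open>The image of \<open>T x\<close> under \<open>1 + t B\<close> lies in the
      displaced tangent space by \<open>PE\<close>, and both have dimension
      \<open>k\<close>.\<close>
    have onto: "\<exists>v. P x v = v \<and> P (x + t *\<^sub>R w) z = v + t *\<^sub>R B v" if t: "\<bar>t\<bar> < \<delta>" for t z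
    proof -
      let ?L = "\<lambda>v. v + t *\<^sub>R B v"
      have L: "linear ?L" using B by (intro linear_compose_add linear_compose_scale_right linear_id[unfolded id_def])
      have "inj ?L" using linear_injective_0[OF L] inj[OF t] by blast
      then have "inj_on ?L (span (T x))" by (rule inj_on_subset) simp
      then have "dim (?L ` T x) = dim (T x)" by (rule dim_image_eq[OF L])
      moreover have "x + t *\<^sub>R w \<in> U" using in_ball[OF t] r by blast
      ultimately have "dim (?L ` T x) \<ge> dim (T (x + t *\<^sub>R w))" by (simp add: dim_T x)
      moreover have "?L ` T x \<subseteq> T (x + t *\<^sub>R w)" using PE[OF t] P_iff by auto
      ultimately have "?L ` T x = T (x + t *\<^sub>R w)"
        using linear_subspace_image[OF L subspace_T] subspace_T by (intro subspace_dim_equal) auto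
      then show ?thesis using P_mem[of "x + t *\<^sub>R w" z] P_iff by auto
    qed
    \<comment> \<open>Integrability exchanges the arguments of \<open>DP\<close>, and the tangential
      part of \<open>B v\<close> becomes the value that \<open>DP_normal_shift\<close>
      requires.\<close>
    have PB: "P x (B v) = - DP x v w" if v: "v \<in> T x" for v
    proof -
      let ?s = "P x (B v) + DP x v w"
      have s: "P x ?s = ?s" by (simp add: linear_add[OF linear_P] P_P P_DP_normal[OF x w])
      then have "?s \<in> T x" using P_iff by blast
      then have "DP x v ?s = DP x ?s v" using integrable[OF x v] by simp
      moreover have "?s \<bullet> ?s = B v \<bullet> ?s + DP x v w \<bullet> ?s"
        by (metis P_inner inner_add_left s)
      ultimately have "?s \<bullet> ?s = 0" by (simp add: B_inner DP_inner[OF x] inner_commute)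
      then show ?thesis by (simp add: eq_neg_iff_add_eq_0)
    qed
    have "B v = 0"
    proof (rule linear_pencil_eq_0[OF h \<open>\<delta> > 0\<close> B linear_P P_inner P_P, of x "\<lambda>t. P (x + t *\<^sub>R w)" "\<lambda>t v. DP (x + t *\<^sub>R w) v w"])
      show "B u \<bullet> v = u \<bullet> B v" if "P x u = u" "P x v = v" for u v
        using integrable[OF x, of u v] that P_iff by (simp add: B_inner inner_commute[of u])
      fix t :: real assume t: "\<bar>t\<bar> < \<delta>"
      have yU: "x + t *\<^sub>R w \<in> U" using in_ball[OF t] r by blast
      show "linear (\<lambda>v. DP (x + t *\<^sub>R w) v w)" by (rule linear_DP[OF yU])
      show "P (x + t *\<^sub>R w) (v + t *\<^sub>R B v) = v + t *\<^sub>R B v" if "P x v = v" for v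
        using PE[OF t] that P_iff by blast
      show "DP (x + t *\<^sub>R w) (v + t *\<^sub>R B v) w = - P (x + t *\<^sub>R w) (B v)" if "P x v = v" for v
        using DP_normal_shift[OF x w r(2) in_ball[OF t] PB] that P_iff by blast
      \<comment> \<open>The vector \<open>w\<close> stays normal along the segment, so minimality
        applies at every displaced point with the same \<open>w\<close>.\<close>
      have "P (x + t *\<^sub>R w) w = 0"
        using r in_ball[OF t] centre_in_ball[of x r]
        by (intro P_along_normal_segment w order_trans[OF closed_segment_subset[OF _ _ convex_ball] r(2)]) auto
      then show "(\<Sum>b\<in>Basis. DP (x + t *\<^sub>R w) (P (x + t *\<^sub>R w) b) w \<bullet> b) = 0"
        by (rule harmonic[OF yU])
      show "v = 0" if "v + t *\<^sub>R B v = 0" for v using inj[OF t that] .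
    qed (use linear_P P_inner onto v P_iff in auto)
    then show ?thesis using B_inner[of v z] by simp
  qed
  \<comment> \<open>The derivative is normal here, so it may itself be taken as
    \<open>w\<close>.\<close>
  have tangent: "DP x v z = 0" if "z \<in> T x" for v z
  proof -
    let ?d = "DP x v z"
    have "?d \<bullet> ?d = 0" using key[OF that P_DP_tangent[OF x that]] .
    then show ?thesis by simp
  qed
  have normal: "DP x v z = 0" if "P x z = 0" for v z
  proof -
    let ?d = "DP x v z"
    have "?d \<in> T x" using P_DP_normal[OF x that, of v] P_mem by metis
    then have "?d \<bullet> ?d = 0" using DP_inner[OF x, where v = v and z = z and z' = ?d] tangent by simp
    then show ?thesis by simp
  qed
  have "DP x v z = DP x v (P x z) + DP x v (z - P x z)"
    by (simp flip: linear_add[OF linear_DP2[OF x]])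
  also have "\<dots> = 0"
    using tangent[OF P_mem] normal[of "z - P x z"] by (simp add: linear_diff[OF linear_P] P_P)
  finally show ?thesis .
qed

end

section \<open>Flat charts\<close>

text \<open>The projection onto the complement of \<open>V\<close> is linear and annihilates
  \<open>f r - f s\<close> near \<open>s\<close>, hence also the velocity.\<close>

lemma has_vector_derivative_in_subspace:
  fixes f :: "real \<Rightarrow> 'a::euclidean_space"
  assumes "subspace V" "(f has_vector_derivative w) (at s)"
    and ev: "\<forall>\<^sub>F r in nhds s. f r - f s \<in> V"
  shows "w \<in> V"
proof -
  interpret bounded_linear "orth_proj V"
    by (rule linear_conv_bounded_linear[THEN iffD1, OF linear_orth_proj[OF assms(1)]])
  have "((\<lambda>r. (f r - f s) - orth_proj V (f r - f s)) has_vector_derivative (w - orth_proj V w)) (at s)"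
    using assms(2) by (auto intro!: derivative_eq_intros has_vector_derivative)
  moreover have "((\<lambda>r. (f r - f s) - orth_proj V (f r - f s)) has_vector_derivative 0) (at s)"
  proof (subst has_vector_derivative_cong_ev[where g = "\<lambda>_. 0"])
    show "\<forall>\<^sub>F r in nhds s. r \<in> UNIV \<longrightarrow> (f r - f s) - orth_proj V (f r - f s) = 0"
      using ev by eventually_elim (simp add: orth_proj_id[OF assms(1)])
  qed (use eventually_nhds_x_imp_x[OF ev] in \<open>simp_all add: orth_proj_id[OF assms(1)]\<close>)
  ultimately have "w - orth_proj V w = 0" by (rule vector_derivative_unique_at)
  then show ?thesis using orth_proj_eq_self_iff[OF assms(1), of w] by simp
qed

lemma curve_displacement_in_subspace:
  fixes f :: "real \<Rightarrow> 'a::euclidean_space"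
  assumes "subspace V" "\<And>s. s \<in> {0..1} \<Longrightarrow> (f has_vector_derivative f' s) (at s)"
    "\<And>s. s \<in> {0..1} \<Longrightarrow> f' s \<in> V"
  shows "f 1 - f 0 \<in> V"
proof -
  interpret bounded_linear "orth_proj V"
    by (rule linear_conv_bounded_linear[THEN iffD1, OF linear_orth_proj[OF assms(1)]])
  have "((\<lambda>r. f r - orth_proj V (f r)) has_vector_derivative 0) (at s within {0..1})" if "s \<in> {0..1}" for s
  proof -
    have "((\<lambda>r. f r - orth_proj V (f r)) has_vector_derivative (f' s - orth_proj V (f' s))) (at s within {0..1})"
      using has_vector_derivative_at_within[OF assms(2)[OF that]]
      by (auto intro!: derivative_eq_intros has_vector_derivative)
    then show ?thesis by (simp add: orth_proj_id[OF assms(1) assms(3)[OF that]])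
  qed
  then obtain k where "\<And>s. s \<in> {0..1} \<Longrightarrow> f s - orth_proj V (f s) = k"
    using has_vector_derivative_zero_constant[of "{0..1}" "\<lambda>r. f r - orth_proj V (f r)"] by auto
  then have *: "f 1 - orth_proj V (f 1) = k" "f 0 - orth_proj V (f 0) = k" by auto
  have "orth_proj V (f 1) = f 1 - k" by (simp flip: *(1))
  moreover have "orth_proj V (f 0) = f 0 - k" by (simp flip: *(2))
  ultimately have "orth_proj V (f 1 - f 0) = f 1 - f 0" by (simp add: diff)
  then show ?thesis using orth_proj_eq_self_iff[OF assms(1)] by blast
qed

text \<open>A linear-algebra description of the tangent space of the plaque, from which its
  dimension and the differentiability of the projection are read off. The agreement with velocities
  of curves is \<open>tangent_space_plaque\<close>.\<close>

definition chart_tangent :: "'a::euclidean_space flat_chart \<Rightarrow> 'a \<Rightarrow> 'a set" where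
  "chart_tangent c x = {v. frechet_derivative (chart_map c) (at x) v \<in> chart_dir c}"

locale flat_chart_context =
  fixes c :: "'a::euclidean_space flat_chart" and k :: nat
  assumes flat_chart: "is_flat_chart k c"
begin

abbreviation "W \<equiv> chart_dom c"
abbreviation "\<phi> \<equiv> chart_map c"
abbreviation "\<psi> \<equiv> inv_into W \<phi>"
abbreviation "V \<equiv> chart_dir c"
abbreviation "D\<phi> x \<equiv> frechet_derivative \<phi> (at x)"
abbreviation "D\<psi> y \<equiv> frechet_derivative \<psi> (at y)"

lemma open_W: "open W" and open_image: "open (\<phi> ` W)" and inj_\<phi>: "inj_on \<phi> W"
  and smooth_\<phi>: "smooth_on W \<phi>" and smooth_\<psi>: "smooth_on (\<phi> ` W) \<psi>"
  and subspace_V: "subspace V" and dim_V: "dim V = k"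
  using flat_chart by (auto simp: is_flat_chart_def diffeomorphism_on_def)

lemma \<psi>_\<phi>: "x \<in> W \<Longrightarrow> \<psi> (\<phi> x) = x"
  using inv_into_f_f[OF inj_\<phi>] .

lemma \<phi>_\<psi>: "y \<in> \<phi> ` W \<Longrightarrow> \<phi> (\<psi> y) = y"
  by (rule f_inv_into_f)

lemma \<psi>_in: "y \<in> \<phi> ` W \<Longrightarrow> \<psi> y \<in> W"
  by (rule inv_into_into)

lemma \<phi>_deriv: "x \<in> W \<Longrightarrow> (\<phi> has_derivative D\<phi> x) (at x)"
  by (rule smooth_on_has_derivative[OF smooth_\<phi>])

lemma \<psi>_deriv: "y \<in> \<phi> ` W \<Longrightarrow> (\<psi> has_derivative D\<psi> y) (at y)"
  by (rule smooth_on_has_derivative[OF smooth_\<psi>])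

lemma D\<psi>_D\<phi>:
  assumes "x \<in> W"
  shows "D\<psi> (\<phi> x) (D\<phi> x v) = v"
proof -
  have "((\<lambda>x. \<psi> (\<phi> x)) has_derivative (\<lambda>v. D\<psi> (\<phi> x) (D\<phi> x v))) (at x)"
    using has_derivative_compose[OF \<phi>_deriv[OF assms] \<psi>_deriv] assms by blast
  moreover have "((\<lambda>x. \<psi> (\<phi> x)) has_derivative (\<lambda>v. v)) (at x)"
    by (rule has_derivative_transform_within_open[OF has_derivative_ident open_W assms]) (simp add: \<psi>_\<phi>)
  ultimately show ?thesis using has_derivative_unique by metis
qed

lemma D\<phi>_D\<psi>:
  assumes "x \<in> W"
  shows "D\<phi> x (D\<psi> (\<phi> x) a) = a"
proof -
  have y: "\<phi> x \<in> \<phi> ` W" using assms by blast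
  have "((\<lambda>y. \<phi> (\<psi> y)) has_derivative (\<lambda>v. D\<phi> (\<psi> (\<phi> x)) (D\<psi> (\<phi> x) v))) (at (\<phi> x))"
    using has_derivative_compose[OF \<psi>_deriv[OF y] \<phi>_deriv] \<psi>_in[OF y] by blast
  moreover have "((\<lambda>y. \<phi> (\<psi> y)) has_derivative (\<lambda>v. v)) (at (\<phi> x))"
    by (rule has_derivative_transform_within_open[OF has_derivative_ident open_image y]) (simp add: \<phi>_\<psi>)
  ultimately have "(\<lambda>v. D\<phi> (\<psi> (\<phi> x)) (D\<psi> (\<phi> x) v)) = (\<lambda>v. v)" by (rule has_derivative_unique)
  then show ?thesis unfolding \<psi>_\<phi>[OF assms] by metis
qed

lemma chart_tangent_eq_image:
  assumes "x \<in> W"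
  shows "chart_tangent c x = D\<psi> (\<phi> x) ` V"
proof (intro equalityI subsetI)
  fix v assume "v \<in> chart_tangent c x"
  then have "D\<phi> x v \<in> V" by (simp add: chart_tangent_def)
  then show "v \<in> D\<psi> (\<phi> x) ` V" by (rule rev_image_eqI) (simp add: D\<psi>_D\<phi>[OF assms])
next
  fix v assume "v \<in> D\<psi> (\<phi> x) ` V"
  then obtain a where "a \<in> V" "v = D\<psi> (\<phi> x) a" by blast
  then show "v \<in> chart_tangent c x" by (simp add: chart_tangent_def D\<phi>_D\<psi>[OF assms])
qed

lemma linear_D\<psi>: "x \<in> W \<Longrightarrow> linear (D\<psi> (\<phi> x))"
  using has_derivative_linear[OF \<psi>_deriv] by blast

lemma inj_D\<psi>: "x \<in> W \<Longrightarrow> inj (D\<psi> (\<phi> x))"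
  by (rule inj_on_inverseI) (rule D\<phi>_D\<psi>)

lemma subspace_chart_tangent: "x \<in> W \<Longrightarrow> subspace (chart_tangent c x)"
  using linear_subspace_image[OF linear_D\<psi> subspace_V] by (simp add: chart_tangent_eq_image)

lemma dim_chart_tangent:
  assumes "x \<in> W"
  shows "dim (chart_tangent c x) = k"
proof -
  have "dim (D\<psi> (\<phi> x) ` V) = dim V"
    by (rule dim_image_eq[OF linear_D\<psi>[OF assms] inj_on_subset[OF inj_D\<psi>[OF assms] subset_UNIV]])
  then show ?thesis by (simp add: chart_tangent_eq_image[OF assms] dim_V)
qed

lemma plaque_self: "x \<in> W \<Longrightarrow> x \<in> plaque c x"
  by (simp add: plaque_def subspace_0[OF subspace_V])

lemma plaque_eq: "y \<in> plaque c x \<Longrightarrow> plaque c y = plaque c x"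
proof -
  assume "y \<in> plaque c x"
  then have V: "\<phi> y - \<phi> x \<in> V" by (simp add: plaque_def)
  have "\<phi> z - \<phi> y \<in> V \<longleftrightarrow> \<phi> z - \<phi> x \<in> V" for z
    using subspace_diff[OF subspace_V _ V, of "\<phi> z - \<phi> x"] subspace_add[OF subspace_V _ V, of "\<phi> z - \<phi> y"] by auto
  then show ?thesis by (simp add: plaque_def)
qed

lemma plaque_curve_velocity:
  assumes x: "x \<in> W" and "(\<gamma> has_vector_derivative v) (at 0)" "\<gamma> 0 = x"
    and "\<forall>\<^sub>F s in nhds 0. \<gamma> s \<in> plaque c x"
  shows "v \<in> chart_tangent c x"
proof -
  have "((\<lambda>s. \<phi> (\<gamma> s)) has_derivative (\<lambda>s. D\<phi> x (s *\<^sub>R v))) (at 0)"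
    using has_derivative_compose[OF assms(2)[unfolded has_vector_derivative_def], of \<phi> "D\<phi> x"] \<phi>_deriv[OF x] assms(3) by simp
  then have "((\<lambda>s. \<phi> (\<gamma> s)) has_vector_derivative D\<phi> x v) (at 0)"
    by (simp add: has_vector_derivative_def linear_scale[OF has_derivative_linear[OF \<phi>_deriv[OF x]]])
  moreover have "\<forall>\<^sub>F s in nhds 0. \<phi> (\<gamma> s) - \<phi> (\<gamma> 0) \<in> V"
    using assms(4) by eventually_elim (simp add: plaque_def assms(3))
  ultimately show ?thesis
    unfolding chart_tangent_def using has_vector_derivative_in_subspace[OF subspace_V] by blast
qed

text \<open>The curve is the preimage under the chart of a straight line in the slice;
  \<open>e\<close> keeps this line in the open image of the chart.\<close>

lemma plaque_curve_exists:
  assumes x: "x \<in> W" and v: "v \<in> chart_tangent c x"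
  obtains \<gamma> e where "0 < e" "smooth_on {-e<..<e::real} \<gamma>" "\<gamma> ` {-e<..<e} \<subseteq> plaque c x" "\<gamma> 0 = x"
    "(\<gamma> has_vector_derivative v) (at 0)"
proof -
  let ?a = "D\<phi> x v"
  have a: "?a \<in> V" using v by (simp add: chart_tangent_def)
  obtain r where r: "r > 0" "ball (\<phi> x) r \<subseteq> \<phi> ` W"
    using open_image x open_contains_ball by blast
  define e where "e = r / (norm ?a + 1)"
  have N: "0 < norm ?a + 1" by (smt (verit) norm_ge_zero)
  have e: "e > 0" using r N by (simp add: e_def)
  have line: "\<phi> x + s *\<^sub>R ?a \<in> \<phi> ` W" if "s \<in> {-e<..<e}" for s
  proof -
    have "\<bar>s\<bar> < e" using that by auto
    then have "\<bar>s\<bar> * (norm ?a + 1) < r" using N by (simp add: e_def pos_less_divide_eq)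
    then have "\<phi> x + s *\<^sub>R ?a \<in> ball (\<phi> x) r" by (simp add: dist_norm algebra_simps)
    then show ?thesis using r by blast
  qed
  define \<gamma> where "\<gamma> s = \<psi> (\<phi> x + s *\<^sub>R ?a)" for s
  have "smooth_on {-e<..<e} \<gamma>"
    unfolding \<gamma>_def by (rule smooth_on_compose[OF _ open_image _ smooth_on_line smooth_\<psi>]) (use line in auto)
  moreover have "\<gamma> ` {-e<..<e} \<subseteq> plaque c x"
    using line a by (auto simp: \<gamma>_def plaque_def \<phi>_\<psi> \<psi>_in subspace_scale[OF subspace_V])
  moreover have "\<gamma> 0 = x" by (simp add: \<gamma>_def \<psi>_\<phi> x)
  moreover have "(\<gamma> has_vector_derivative v) (at 0)"
  proof -
    have "((\<lambda>s. \<phi> x + s *\<^sub>R ?a) has_derivative (\<lambda>s. s *\<^sub>R ?a)) (at 0)"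
      by (auto intro!: derivative_eq_intros)
    then have "(\<gamma> has_derivative (\<lambda>s. D\<psi> (\<phi> x) (s *\<^sub>R ?a))) (at 0)"
      unfolding \<gamma>_def using has_derivative_compose[of _ _ "0::real" UNIV \<psi> "D\<psi> (\<phi> x)"] \<psi>_deriv x by simp
    then show ?thesis
      by (simp add: has_vector_derivative_def linear_scale[OF linear_D\<psi>[OF x]] D\<psi>_D\<phi>[OF x])
  qed
  ultimately show ?thesis using that e by blast
qed

lemma tangent_space_plaque:
  assumes x: "x \<in> W" and y: "y \<in> plaque c x"
  shows "tangent_space (plaque c x) y = chart_tangent c y"
proof -
  have yW: "y \<in> W" using y by (simp add: plaque_def)
  have eq: "plaque c x = plaque c y" using plaque_eq[OF y] by simp
  show ?thesis
    unfolding eq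
  proof (intro equalityI subsetI)
    fix v assume "v \<in> tangent_space (plaque c y) y"
    then obtain \<gamma> e where g: "0 < e" "\<gamma> ` {-e<..<e::real} \<subseteq> plaque c y" "\<gamma> 0 = y" "(\<gamma> has_vector_derivative v) (at 0)"
      unfolding tangent_space_def by blast
    have "\<forall>\<^sub>F s in nhds 0. s \<in> {-e<..<e}" using g(1) by (intro eventually_nhds_in_open) auto
    then have "\<forall>\<^sub>F s in nhds 0. \<gamma> s \<in> plaque c y" by eventually_elim (use g(2) in blast)
    then show "v \<in> chart_tangent c y" by (rule plaque_curve_velocity[OF yW g(4) g(3)])
  next
    fix v assume "v \<in> chart_tangent c y"
    then obtain \<gamma> e where "0 < e" "smooth_on {-e<..<e::real} \<gamma>" "\<gamma> ` {-e<..<e} \<subseteq> plaque c y" "\<gamma> 0 = y"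
      "(\<gamma> has_vector_derivative v) (at 0)"
      using plaque_curve_exists[OF yW] by metis
    then show "v \<in> tangent_space (plaque c y) y" unfolding tangent_space_def by blast
  qed
qed

lemma smooth_frame: "smooth_on W (\<lambda>x. D\<psi> (\<phi> x) a)"
  by (rule smooth_on_compose[OF open_W open_image order_refl smooth_\<phi> smooth_on_frechet_derivative[OF smooth_\<psi>]])

text \<open>A coordinate field with constant coefficients. It ensures that the choice of
  \<open>Y\<close> in \<open>second_fundamental_form\<close> is made among existing fields.\<close>

lemma ex_local_tangent_field:
  assumes x: "x \<in> W" and p: "p \<in> plaque c x" and v: "v \<in> tangent_space (plaque c x) p"
  shows "\<exists>Y. local_tangent_field (plaque c x) p Y \<and> Y p = v"
proof -
  have pW: "p \<in> W" using p by (simp add: plaque_def)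
  let ?a = "D\<phi> p v"
  have a: "?a \<in> V" using v unfolding tangent_space_plaque[OF x p] by (simp add: chart_tangent_def)
  have "D\<psi> (\<phi> y) ?a \<in> tangent_space (plaque c x) y" if "y \<in> plaque c x \<inter> W" for y
    using that a tangent_space_plaque[OF x, of y] by (simp add: chart_tangent_eq_image)
  then have "local_tangent_field (plaque c x) p (\<lambda>y. D\<psi> (\<phi> y) ?a)"
    unfolding local_tangent_field_def using open_W pW smooth_frame by blast
  moreover have "D\<psi> (\<phi> p) ?a = v" by (rule D\<psi>_D\<phi>[OF pW])
  ultimately show ?thesis by blast
qed

lemma smooth_submanifold_plaque:
  assumes x: "x \<in> W"
  shows "smooth_submanifold k (plaque c x)"
  unfolding smooth_submanifold_def
proof (intro ballI exI conjI)
  fix p assume "p \<in> plaque c x"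
  then show "p \<in> W" by (simp add: plaque_def)
  \<comment> \<open>The translation moves the slice of \<open>x\<close> onto the linear subspace
    \<open>V\<close>, as the definition of a submanifold asks.\<close>
  let ?f = "\<lambda>y. \<phi> y + (- \<phi> x)"
  have img: "?f ` W = (\<lambda>z. z + (- \<phi> x)) ` (\<phi> ` W)" by (simp add: image_image)
  have inj: "inj_on ?f W" using inj_\<phi> by (auto simp: inj_on_def)
  have opn: "open (?f ` W)"
    unfolding img using open_translation[OF open_image, of "- \<phi> x"] by (simp add: add.commute)
  have "smooth_on W ?f"
    by (rule smooth_on_compose[OF open_W open_UNIV _ smooth_\<phi> smooth_on_id_plus]) simp
  moreover have "smooth_on (?f ` W) (\<lambda>z. \<psi> (z + \<phi> x))"
    by (rule smooth_on_compose[OF opn open_image _ smooth_on_id_plus smooth_\<psi>]) auto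
  then have "smooth_on (?f ` W) (inv_into W ?f)"
  proof (rule smooth_on_cong[OF opn, rotated])
    fix z assume "z \<in> ?f ` W"
    then obtain y where "y \<in> W" and z: "z = ?f y" by blast
    then show "\<psi> (z + \<phi> x) = inv_into W ?f z"
      unfolding z inv_into_f_f[OF inj \<open>y \<in> W\<close>] by (simp add: \<psi>_\<phi>)
  qed
  ultimately show "diffeomorphism_on W ?f"
    using open_W opn inj by (simp add: diffeomorphism_on_def)
  show "?f ` (plaque c x \<inter> W) = ?f ` W \<inter> V"
    by (auto simp: plaque_def)
qed (use subspace_V dim_V in auto)

text \<open>The coordinate fields of a basis of \<open>V\<close> form a differentiable frame of the
  tangent spaces.\<close>

lemma orth_proj_chart_tangent_differentiable:
  assumes x: "x \<in> W"
  shows "(\<lambda>y. orth_proj (chart_tangent c y) z) differentiable (at x)"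
proof -
  obtain B where B: "B \<subseteq> V" "independent B" "V \<subseteq> span B" using basis_exists by metis
  have span: "span B = V" using B subspace_V by (metis span_minimal subset_antisym)
  have eq: "span ((\<lambda>b. D\<psi> (\<phi> y) b) ` B) = chart_tangent c y" if "y \<in> W" for y
    using span by (simp add: linear_span_image[OF linear_D\<psi>[OF that]] chart_tangent_eq_image[OF that])
  have "(\<lambda>y. orth_proj (span ((\<lambda>b. D\<psi> (\<phi> y) b) ` B)) z) differentiable (at x)"
  proof (rule orth_proj_frame_differentiable[OF independent_imp_finite[OF B(2)] open_W _ _ x])
    fix b y assume "y \<in> W"
    then show "(\<lambda>y. D\<psi> (\<phi> y) b) differentiable (at y)"
      using smooth_on_has_derivative[OF smooth_frame] by (auto simp: differentiable_def)
  next
    fix y assume y: "y \<in> W"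
    show "inj_on (D\<psi> (\<phi> y)) B \<and> independent (D\<psi> (\<phi> y) ` B)"
      using inj_D\<psi>[OF y] inj_on_subset linear_independent_injective_image[OF linear_D\<psi>[OF y] B(2)] by blast
  qed
  then show ?thesis by (rule differentiable_cong_open[OF open_W x, rotated]) (simp add: eq)
qed

text \<open>Differentiating \<open>P E\<^sub>b = E\<^sub>b\<close> for the coordinate fields \<open>E\<^sub>b = D\<psi> b\<close>
  expresses the derivative of \<open>P\<close> through the symmetric second derivative of \<open>\<psi>\<close>.\<close>

lemma chart_tangent_integrable:
  assumes x: "x \<in> W" and u: "u \<in> chart_tangent c x" and v: "v \<in> chart_tangent c x"
  shows "frechet_derivative (\<lambda>y. orth_proj (span (chart_tangent c y)) v) (at x) u =
         frechet_derivative (\<lambda>y. orth_proj (span (chart_tangent c y)) u) (at x) v"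
proof -
  \<comment> \<open>With \<open>span\<close>, \<open>?P y\<close> is linear also for
    \<open>y\<close> outside the chart, as the product rule for linear families demands.\<close>
  let ?P = "\<lambda>y. orth_proj (span (chart_tangent c y))"
  let ?D = "\<lambda>v z. frechet_derivative (\<lambda>y. ?P y z) (at x) v"
  have span: "span (chart_tangent c y) = chart_tangent c y" if "y \<in> W" for y
    using subspace_chart_tangent[OF that] by simp
  have PD: "((\<lambda>y. ?P y z) has_derivative (\<lambda>v. ?D v z)) (at x)" for z
  proof -
    have "(\<lambda>y. ?P y z) differentiable (at x)"
      by (rule differentiable_cong_open[OF open_W x _ orth_proj_chart_tangent_differentiable[OF x]]) (simp add: span)
    then show ?thesis using frechet_derivative_worksI by blast
  qed
  let ?H = "\<lambda>a b. frechet_derivative (\<lambda>z. D\<psi> z a) (at (\<phi> x)) b"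
  have formula: "?D u (D\<psi> (\<phi> x) b) = ?H b (D\<phi> x u) - ?P x (?H b (D\<phi> x u))" if b: "b \<in> V" for u b
  proof -
    let ?E = "\<lambda>y. D\<psi> (\<phi> y) b"
    have E: "(?E has_derivative (\<lambda>u. ?H b (D\<phi> x u))) (at x)"
      using has_derivative_compose[OF \<phi>_deriv[OF x] smooth_on_has_derivative[OF smooth_on_frechet_derivative[OF smooth_\<psi>]]] x
      by blast
    have "((\<lambda>y. ?P y (?E y)) has_derivative (\<lambda>u. ?D u (?E x) + ?P x (?H b (D\<phi> x u)))) (at x)"
      by (rule has_derivative_linear_family[where P = ?P and D = ?D, OF linear_orth_proj[OF subspace_span] PD has_derivative_ident E])
    moreover have "((\<lambda>y. ?P y (?E y)) has_derivative (\<lambda>u. ?H b (D\<phi> x u))) (at x)"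
    proof (rule has_derivative_transform_within_open[OF E open_W x])
      fix y assume "y \<in> W"
      then have "?E y \<in> chart_tangent c y" using b by (simp add: chart_tangent_eq_image)
      then show "?E y = ?P y (?E y)" using orth_proj_id[OF subspace_span] span_base by metis
    qed
    ultimately have "(\<lambda>u. ?D u (?E x) + ?P x (?H b (D\<phi> x u))) = (\<lambda>u. ?H b (D\<phi> x u))"
      by (rule has_derivative_unique)
    from fun_cong[OF this, of u] show ?thesis by (simp add: algebra_simps)
  qed
  have V: "D\<phi> x u \<in> V" "D\<phi> x v \<in> V" using u v by (auto simp: chart_tangent_def)
  have "?H (D\<phi> x v) (D\<phi> x u) = ?H (D\<phi> x u) (D\<phi> x v)"
    using smooth_on_symmetric_second_derivative[OF open_image _ smooth_\<psi>] x by blast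
  then show ?thesis
    using formula[OF V(1), of v] formula[OF V(2), of u] by (simp add: D\<psi>_D\<phi>[OF x])
qed

end

section \<open>Riemannian foliations\<close>

lemma orthonormal_basis_of_finite:
  assumes "orthonormal_basis_of T B"
  shows "finite B"
proof -
  have "0 \<notin> B" using assms by (auto simp: orthonormal_basis_of_def)
  then show ?thesis
    using assms pairwise_orthogonal_independent independent_imp_finite
    unfolding orthonormal_basis_of_def by blast
qed

lemma ex_orthonormal_basis_of:
  fixes T :: "'a::euclidean_space set"
  shows "subspace T \<Longrightarrow> \<exists>B. orthonormal_basis_of T B"
  using orthonormal_basis_subspace[of T] unfolding orthonormal_basis_of_def by metis

text \<open>The left-hand side involves no choice of \<open>B\<close>. It serves both to evaluate
  the mean curvature on an unspecified orthonormal basis and to compare two such bases.\<close>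

lemma trace_orthonormal_basis:
  fixes T :: "'a::euclidean_space set"
  assumes "subspace T" and B: "orthonormal_basis_of T B" and "linear X"
  shows "(\<Sum>b\<in>Basis. X (orth_proj T b) \<bullet> b) = (\<Sum>e\<in>B. X e \<bullet> e)"
proof -
  interpret X: linear X by fact
  note fin = orthonormal_basis_of_finite[OF B]
  have proj: "orth_proj T z = (\<Sum>e\<in>B. (z \<bullet> e) *\<^sub>R e)" for z
  proof (rule orth_proj_eqI[OF \<open>subspace T\<close>])
    show "(\<Sum>e\<in>B. (z \<bullet> e) *\<^sub>R e) \<in> T"
      using B by (intro subspace_sum[OF \<open>subspace T\<close>] subspace_scale[OF \<open>subspace T\<close>])
        (auto simp: orthonormal_basis_of_def)
    let ?w = "z - (\<Sum>e\<in>B. (z \<bullet> e) *\<^sub>R e)"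
    have "e \<bullet> ?w = 0" if e: "e \<in> B" for e
    proof -
      have "e \<bullet> (\<Sum>e\<in>B. (z \<bullet> e) *\<^sub>R e) = (\<Sum>f\<in>B. (z \<bullet> f) * (e \<bullet> f))" by (simp add: inner_sum_right)
      also have "\<dots> = (\<Sum>f\<in>{e}. (z \<bullet> f) * (e \<bullet> f))"
        using B e fin by (intro sum.mono_neutral_right)
          (auto simp: orthonormal_basis_of_def pairwise_def orthogonal_def)
      also have "\<dots> = z \<bullet> e" using B e by (simp add: orthonormal_basis_of_def dot_square_norm)
      finally show ?thesis by (simp add: inner_diff_right inner_commute)
    qed
    moreover have "subspace {v. v \<bullet> ?w = 0}" by (auto intro!: subspaceI simp: inner_add_left)
    ultimately have "span B \<subseteq> {v. v \<bullet> ?w = 0}" by (intro span_minimal) auto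
    then show "v \<bullet> ?w = 0" if "v \<in> T" for v using B that by (auto simp: orthonormal_basis_of_def)
  qed
  have "(\<Sum>b\<in>Basis. X (orth_proj T b) \<bullet> b) = (\<Sum>b\<in>Basis. \<Sum>e\<in>B. (b \<bullet> e) * (X e \<bullet> b))"
    by (simp add: proj X.sum X.scale inner_sum_left)
  also have "\<dots> = (\<Sum>e\<in>B. \<Sum>b\<in>Basis. (X e \<bullet> b) * (e \<bullet> b))"
    by (subst sum.swap) (simp add: mult.commute inner_commute)
  also have "\<dots> = (\<Sum>e\<in>B. X e \<bullet> e)" by (simp flip: euclidean_inner)
  finally show ?thesis .
qed

context riemannian_distribution
begin

lemma complex_imp_harmonic:
  assumes J: "linear J" "\<And>z. J (J z) = - z" "\<And>y z. J y \<bullet> J z = y \<bullet> z"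
    and JT: "\<And>y v. y \<in> U \<Longrightarrow> v \<in> T y \<Longrightarrow> J v \<in> T y"
    and x: "x \<in> U" and w: "P x w = 0"
  shows "(\<Sum>b\<in>Basis. DP x (P x b) w \<bullet> b) = 0"
proof -
  interpret J: linear J by fact
  have J': "v = J (- J v)" for v by (simp add: J.neg J)
  have PJ: "P y (J z) = J (P y z)" if y: "y \<in> U" for y z
  proof (rule orth_proj_eqI[OF subspace_T])
    show "J (P y z) \<in> T y" by (rule JT[OF y P_mem])
    fix v assume v: "v \<in> T y"
    have "v \<bullet> (J z - J (P y z)) = J (- J v) \<bullet> J (z - P y z)" by (simp add: J.diff flip: J')
    also have "\<dots> = - (J v \<bullet> (z - P y z))" by (simp only: J(3) inner_minus_left)
    also have "\<dots> = 0" by (simp add: orth_proj_orthogonal[OF subspace_T JT[OF y v]])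
    finally show "v \<bullet> (J z - J (P y z)) = 0" .
  qed
  have DPJ: "DP x v (J z) = J (DP x v z)" for v z
  proof -
    have "((\<lambda>y. J (P y z)) has_derivative (\<lambda>v. J (DP x v z))) (at x)"
      using J(1) by (intro bounded_linear.has_derivative[OF _ P_has_derivative[OF x]])
        (simp add: linear_conv_bounded_linear)
    then have "((\<lambda>y. P y (J z)) has_derivative (\<lambda>v. J (DP x v z))) (at x)"
      by (rule has_derivative_transform_within_open[OF _ open_U x]) (simp add: PJ)
    from has_derivative_unique[OF P_has_derivative[OF x] this] show ?thesis by metis
  qed
  obtain B where B: "orthonormal_basis_of (T x) B" using ex_orthonormal_basis_of[OF subspace_T] by blast
  have "J ` T x = T x"
  proof
    show "T x \<subseteq> J ` T x"
    proof
      fix v assume "v \<in> T x"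
      then have "- J v \<in> T x" by (intro subspace_neg[OF subspace_T] JT[OF x])
      then show "v \<in> J ` T x" using J' by blast
    qed
  qed (use JT[OF x] in auto)
  then have "span (J ` B) = T x"
    using B by (simp add: linear_span_image[OF J(1)] orthonormal_basis_of_def)
  then have JB: "orthonormal_basis_of (T x) (J ` B)"
    using B span_superset[of "J ` B"]
    by (auto simp: orthonormal_basis_of_def pairwise_def orthogonal_def J norm_eq_sqrt_inner)
  have "inj J" by (rule inj_on_inverseI[of _ "\<lambda>v. - J v"]) (simp add: J)
  have lin: "linear (\<lambda>v. DP x v w)" by (rule linear_DP[OF x])
  have "(\<Sum>e\<in>J ` B. DP x e w \<bullet> e) = (\<Sum>e\<in>B. DP x (J e) w \<bullet> J e)"
    by (rule sum.reindex[unfolded o_def]) (rule inj_on_subset[OF \<open>inj J\<close>], simp)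
  also have "\<dots> = (\<Sum>e\<in>B. - (DP x e w \<bullet> e))"
  proof (rule sum.cong[OF refl])
    fix e assume "e \<in> B"
    then have e: "e \<in> T x" "J e \<in> T x" using B JT[OF x] by (auto simp: orthonormal_basis_of_def)
    have "DP x (J e) w \<bullet> J e = w \<bullet> DP x (J e) (J e)" by (rule DP_inner[OF x])
    also have "DP x (J e) (J e) = J (DP x e (J e))" using integrable[OF x e] by (simp add: DPJ)
    also have "\<dots> = - DP x e e" by (simp add: DPJ J)
    also have "w \<bullet> \<dots> = - (DP x e w \<bullet> e)" by (simp add: DP_inner[OF x])
    finally show "DP x (J e) w \<bullet> J e = - (DP x e w \<bullet> e)" .
  qed
  finally have "(\<Sum>e\<in>J ` B. DP x e w \<bullet> e) = - (\<Sum>e\<in>B. DP x e w \<bullet> e)" by (simp add: sum_negf)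
  then show ?thesis
    using trace_orthonormal_basis[OF subspace_T B lin] trace_orthonormal_basis[OF subspace_T JB lin] by simp
qed

lemma parallel_imp_locally_constant:
  assumes DP0: "\<And>x v z. x \<in> U \<Longrightarrow> DP x v z = 0"
    and S: "convex S" "S \<subseteq> U" "x \<in> S" "y \<in> S"
  shows "T x = T y"
proof -
  have "P x z = P y z" for z
  proof -
    have "((\<lambda>y. P y z) has_derivative (\<lambda>v. 0)) (at s within S)" if "s \<in> S" for s
    proof -
      have sU: "s \<in> U" using S(2) that by blast
      have "(\<lambda>v. DP s v z) = (\<lambda>v. 0)" by (simp add: DP0[OF sU])
      with P_has_derivative[OF sU, of z] have "((\<lambda>y. P y z) has_derivative (\<lambda>v. 0)) (at s)" by simp
      then show ?thesis by (rule has_derivative_at_withinI)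
    qed
    then show ?thesis using has_derivative_zero_constant[OF S(1)] S(3,4) by metis
  qed
  then show ?thesis using orth_proj_eq_self_iff[OF subspace_T] by (metis subsetI subset_antisym)
qed

end

section \<open>Tangent spaces and second fundamental forms of leaves\<close>

text \<open>Coherence makes the plaques of two charts agree near \<open>x\<close>, and a velocity
  depends only on the curve near time 0; so the union over all charts is the space given by any one
  of them.\<close>

lemma leaf_tangent_space_eq:
  assumes F: "foliation k U F" and c: "c \<in> F" and x: "x \<in> chart_dom c"
  shows "leaf_tangent_space F x = chart_tangent c x"
proof -
  interpret c: flat_chart_context c k using F c by unfold_locales (simp add: foliation_def)
  have "v \<in> chart_tangent c x"
    if d: "d \<in> F" "x \<in> chart_dom d" and v: "v \<in> tangent_space (plaque d x) x" for v d
  proof -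
    have "coherent c d" using F c d by (simp add: foliation_def)
    then have "\<exists>W. open W \<and> x \<in> W \<and> W \<subseteq> chart_dom c \<inter> chart_dom d \<and> (\<forall>y\<in>W. plaque c y \<inter> W = plaque d y \<inter> W)"
      unfolding coherent_def using IntI[OF x d(2)] by (rule bspec)
    then obtain W where W: "open W" "x \<in> W" "plaque c x \<inter> W = plaque d x \<inter> W" by auto
    obtain \<gamma> e where g: "0 < e" "\<gamma> ` {-e<..<e::real} \<subseteq> plaque d x" "\<gamma> 0 = x" "(\<gamma> has_vector_derivative v) (at 0)"
      using v unfolding tangent_space_def by blast
    have "\<forall>\<^sub>F s in nhds 0. s \<in> {-e<..<e}" using g(1) by (intro eventually_nhds_in_open) auto
    moreover have "\<forall>\<^sub>F s in nhds 0. \<gamma> s \<in> W"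
      by (rule eventually_curve_in_open[OF g(4) W(1)]) (simp add: g(3) W(2))
    ultimately have "\<forall>\<^sub>F s in nhds 0. \<gamma> s \<in> plaque c x" by eventually_elim (use g(2) W(3) in blast)
    then show ?thesis by (rule c.plaque_curve_velocity[OF x g(4,3)])
  qed
  moreover have "tangent_space (plaque c x) x = chart_tangent c x"
    by (rule c.tangent_space_plaque[OF x c.plaque_self[OF x]])
  ultimately show ?thesis using c x unfolding leaf_tangent_space_def by blast
qed

text \<open>The leaf of \<open>x\<close> contains \<open>x\<close>, so its local property can be
  evaluated on \<open>plaque c x\<close>. The parameter \<open>m\<close> accommodates the complex
  dimension, which may depend on the leaf.\<close>

lemma leaf_locally_plaque:
  assumes "foliation k U F" "\<And>L. L \<in> leaves F \<Longrightarrow> \<exists>m. leaf_locally F (Q m) L" "c \<in> F" "x \<in> chart_dom c"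
  shows "\<exists>m. Q m (plaque c x)"
proof -
  interpret flat_chart_context c k using assms by unfold_locales (simp add: foliation_def)
  let ?L = "(plaque_rel F)\<^sup>+ `` {x}"
  have "(x, x) \<in> (plaque_rel F)\<^sup>+"
    using assms(3,4) plaque_self[OF assms(4)] by (auto simp: plaque_rel_def)
  moreover have "?L \<in> leaves F" unfolding leaves_def using assms(3,4) by (intro quotientI) blast
  ultimately show ?thesis using assms(2)[of ?L] assms(3,4) unfolding leaf_locally_def by blast
qed

locale riemannian_foliation_context =
  fixes k :: nat and U :: "'a::euclidean_space set" and F :: "'a flat_chart set"
  assumes riem: "riemannian_foliation k U F"
begin

lemma fol: "foliation k U F"
  using riem by (simp add: riemannian_foliation_def)

lemma chart: "c \<in> F \<Longrightarrow> flat_chart_context c k"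
  using fol by unfold_locales (simp add: foliation_def)

lemma chart_dom_subset: "c \<in> F \<Longrightarrow> chart_dom c \<subseteq> U"
  using fol by (auto simp: foliation_def)

lemma ex_chart: "x \<in> U \<Longrightarrow> \<exists>c\<in>F. x \<in> chart_dom c"
  using fol by (auto simp: foliation_def)

lemma span_leaf_tangent: "c \<in> F \<Longrightarrow> x \<in> chart_dom c \<Longrightarrow> span (leaf_tangent_space F x) = chart_tangent c x"
  using flat_chart_context.subspace_chart_tangent[OF chart] by (simp add: leaf_tangent_space_eq[OF fol])

text \<open>Outside \<open>U\<close> there is no chart and \<open>leaf_tangent_space\<close> is
  empty. The span turns it into a subspace there and changes nothing on \<open>U\<close>.\<close>

sublocale riemannian_distribution U "\<lambda>y. span (leaf_tangent_space F y)" k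
proof
  show "open U" using fol by (simp add: foliation_def)
  show "subspace (span (leaf_tangent_space F x))" for x by simp
  fix x assume x: "x \<in> U"
  then obtain c where c: "c \<in> F" "x \<in> chart_dom c" using ex_chart by blast
  interpret c: flat_chart_context c k by (rule chart[OF c(1)])
  show "dim (span (leaf_tangent_space F x)) = k"
    unfolding span_leaf_tangent[OF c] by (rule c.dim_chart_tangent[OF c(2)])
  have eq: "orth_proj (span (leaf_tangent_space F y)) z = orth_proj (chart_tangent c y) z"
      "orth_proj (span (leaf_tangent_space F y)) z = orth_proj (span (chart_tangent c y)) z"
    if "y \<in> chart_dom c" for y z
    by (simp only: span_leaf_tangent[OF c(1) that]) (simp only: leaf_tangent_space_eq[OF fol c(1) that])
  show "(\<lambda>y. orth_proj (span (leaf_tangent_space F y)) z) differentiable (at x)" for z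
    by (rule differentiable_cong_open[OF c.open_W c(2) _ c.orth_proj_chart_tangent_differentiable[OF c(2)]])
      (simp add: eq(1))
  fix u v assume "u \<in> span (leaf_tangent_space F x)" "v \<in> span (leaf_tangent_space F x)"
  then have uv: "u \<in> chart_tangent c x" "v \<in> chart_tangent c x" by (simp_all add: span_leaf_tangent[OF c])
  have "frechet_derivative (\<lambda>y. orth_proj (span (leaf_tangent_space F y)) v) (at x)
      = frechet_derivative (\<lambda>y. orth_proj (span (chart_tangent c y)) v) (at x)" for v
    by (rule frechet_derivative_cong_open[OF c.open_W c(2) eq(2)])
  then show "frechet_derivative (\<lambda>y. orth_proj (span (leaf_tangent_space F y)) v) (at x) u =
      frechet_derivative (\<lambda>y. orth_proj (span (leaf_tangent_space F y)) u) (at x) v"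
    using c.chart_tangent_integrable[OF c(2) uv] by simp
next
  fix a b x y v
  assume ab: "closed_segment a b \<subseteq> U" "x \<in> closed_segment a b" "y \<in> closed_segment a b"
    and orth: "\<And>v. v \<in> span (leaf_tangent_space F x) \<Longrightarrow> v \<bullet> (b - a) = 0"
    and v: "v \<in> span (leaf_tangent_space F y)"
  have "orthogonal_to_leaf_at F x (b - a)"
    using orth span_base unfolding orthogonal_to_leaf_at_def orthogonal_def by (metis inner_commute)
  then have "orthogonal_to_leaf_at F y (b - a)"
    using riem ab unfolding riemannian_foliation_def by blast
  moreover have "span (leaf_tangent_space F y) = leaf_tangent_space F y"
    using ex_chart[of y] ab span_leaf_tangent leaf_tangent_space_eq[OF fol] by blast
  with v have "v \<in> leaf_tangent_space F y" by blast
  ultimately show "v \<bullet> (b - a) = 0"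
    by (auto simp: orthogonal_to_leaf_at_def orthogonal_def inner_commute)
qed

text \<open>Differentiating \<open>P Y = Y\<close> along a curve in the plaque with velocity
  \<open>u\<close> gives \<open>DP p u v + P p d = d\<close>, where \<open>d\<close> is the
  derivative of \<open>Y\<close>. The normal part of \<open>d\<close> is thus
  \<open>DP p u v\<close>, whichever field \<open>Y\<close> was chosen.\<close>

lemma second_fundamental_form_plaque:
  assumes c: "c \<in> F" and x: "x \<in> chart_dom c" and p: "p \<in> plaque c x"
    and u: "u \<in> tangent_space (plaque c x) p" and v: "v \<in> tangent_space (plaque c x) p"
  shows "second_fundamental_form (plaque c x) p u v = DP p u v"
proof -
  interpret c: flat_chart_context c k by (rule chart[OF c])
  have dom: "y \<in> chart_dom c" if "y \<in> plaque c x" for y using that by (simp add: plaque_def)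
  have pU: "p \<in> U" using dom[OF p] chart_dom_subset[OF c] by blast
  have T: "tangent_space (plaque c x) y = span (leaf_tangent_space F y)" if "y \<in> plaque c x" for y
    using c.tangent_space_plaque[OF x that] span_leaf_tangent[OF c dom[OF that]] by simp
  define Y where "Y = (SOME Y. local_tangent_field (plaque c x) p Y \<and> Y p = v)"
  have "local_tangent_field (plaque c x) p Y \<and> Y p = v"
    unfolding Y_def by (rule someI_ex[OF c.ex_local_tangent_field[OF x p v]])
  then obtain W where W: "open W" "p \<in> W" "smooth_on W Y" "Y p = v"
    "\<And>y. y \<in> plaque c x \<inter> W \<Longrightarrow> Y y \<in> tangent_space (plaque c x) y"
    unfolding local_tangent_field_def by blast
  let ?d = "frechet_derivative Y (at p) u"
  have Yd: "(Y has_derivative frechet_derivative Y (at p)) (at p)"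
    by (rule smooth_on_has_derivative[OF W(3,2)])
  obtain \<gamma> e where g: "0 < e" "\<gamma> ` {-e<..<e::real} \<subseteq> plaque c x" "\<gamma> 0 = p" "(\<gamma> has_vector_derivative u) (at 0)"
    using u unfolding tangent_space_def by blast
  have Yg: "((\<lambda>s. Y (\<gamma> s)) has_vector_derivative ?d) (at 0)"
    using has_derivative_compose[OF g(4)[unfolded has_vector_derivative_def], of Y "frechet_derivative Y (at p)"] Yd g(3)
    by (simp add: has_vector_derivative_def linear_scale[OF has_derivative_linear[OF Yd]])
  have "((\<lambda>s. P (\<gamma> s) (Y (\<gamma> s))) has_vector_derivative (DP p u v + P p ?d)) (at 0)"
    using P_curve_has_vector_derivative[OF _ g(4) Yg] pU by (simp add: g(3) W(4))
  moreover have "((\<lambda>s. P (\<gamma> s) (Y (\<gamma> s))) has_vector_derivative ?d) (at 0)"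
  proof -
    have "\<forall>\<^sub>F s in nhds 0. s \<in> {-e<..<e}" using g(1) by (intro eventually_nhds_in_open) auto
    moreover have "\<forall>\<^sub>F s in nhds 0. \<gamma> s \<in> W"
      by (rule eventually_curve_in_open[OF g(4) W(1)]) (simp add: g(3) W(2))
    ultimately have "\<forall>\<^sub>F s in nhds 0. P (\<gamma> s) (Y (\<gamma> s)) = Y (\<gamma> s)"
    proof eventually_elim
      case (elim s)
      then have s: "\<gamma> s \<in> plaque c x \<inter> W" using g(2) by blast
      then have "Y (\<gamma> s) \<in> span (leaf_tangent_space F (\<gamma> s))" using W(5)[OF s] T by blast
      then show ?case by (rule orth_proj_id[OF subspace_T])
    qed
    then show ?thesis
      using Yg by (subst has_vector_derivative_cong_ev[where g = "\<lambda>s. Y (\<gamma> s)"]) (auto dest: eventually_nhds_x_imp_x)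
  qed
  ultimately have "DP p u v + P p ?d = ?d" by (rule vector_derivative_unique_at)
  moreover have "second_fundamental_form (plaque c x) p u v = normal_part (span (leaf_tangent_space F p)) ?d"
    by (simp add: second_fundamental_form_def Y_def[symmetric] T[OF p])
  ultimately show ?thesis unfolding orth_proj_def by (simp add: algebra_simps)
qed

lemma minimal_imp_harmonic:
  assumes min: "minimal_leaves k F" and x: "x \<in> U" and w: "P x w = 0"
  shows "(\<Sum>b\<in>Basis. DP x (P x b) w \<bullet> b) = 0"
proof -
  obtain c where c: "c \<in> F" "x \<in> chart_dom c" using ex_chart[OF x] by blast
  interpret c: flat_chart_context c k by (rule chart[OF c(1)])
  have px: "x \<in> plaque c x" by (rule c.plaque_self[OF c(2)])
  have T: "tangent_space (plaque c x) x = span (leaf_tangent_space F x)"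
    using c.tangent_space_plaque[OF c(2) px] span_leaf_tangent[OF c] by simp
  define B where "B = (SOME B. orthonormal_basis_of (tangent_space (plaque c x) x) B)"
  have B: "orthonormal_basis_of (span (leaf_tangent_space F x)) B"
    unfolding B_def T using ex_orthonormal_basis_of[OF subspace_span] by (rule someI_ex)
  \<comment> \<open>The dimension is fixed here, so the parameter ranges over a one-element
    type.\<close>
  have "\<exists>m::unit. minimal_submanifold k (plaque c x)"
    using leaf_locally_plaque[OF fol _ c, of "\<lambda>_::unit. minimal_submanifold k"] min
    unfolding minimal_leaves_def by blast
  then have "0 = mean_curvature (plaque c x) x"
    using px by (simp add: minimal_submanifold_def)
  also have "\<dots> = (\<Sum>e\<in>B. DP x e e)"
    unfolding mean_curvature_def B_def[symmetric]
    using B by (intro sum.cong refl second_fundamental_form_plaque[OF c px])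
      (auto simp: orthonormal_basis_of_def T)
  finally have "0 = (\<Sum>e\<in>B. DP x e e) \<bullet> w" by simp
  also have "\<dots> = (\<Sum>e\<in>B. DP x e w \<bullet> e)"
    unfolding inner_sum_left
    by (rule sum.cong[OF refl], subst DP_inner[OF x]) (rule inner_commute)
  finally show ?thesis
    using trace_orthonormal_basis[OF subspace_T B linear_DP[OF x]] by simp
qed

lemma parallel_imp_totally_geodesic:
  assumes DP0: "\<And>x v z. x \<in> U \<Longrightarrow> DP x v z = 0"
  shows "totally_geodesic_foliation k F"
proof -
  have "totally_geodesic_submanifold k (plaque c x)" if c: "c \<in> F" and x: "x \<in> chart_dom c" for c x
    unfolding totally_geodesic_submanifold_def
  proof (intro conjI ballI)
    show "smooth_submanifold k (plaque c x)"
      by (rule flat_chart_context.smooth_submanifold_plaque[OF chart[OF c] x])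
    fix p u v assume p: "p \<in> plaque c x" and "u \<in> tangent_space (plaque c x) p" "v \<in> tangent_space (plaque c x) p"
    then have "second_fundamental_form (plaque c x) p u v = DP p u v"
      by (rule second_fundamental_form_plaque[OF c x])
    moreover have "p \<in> U" using p chart_dom_subset[OF c] by (auto simp: plaque_def)
    ultimately show "second_fundamental_form (plaque c x) p u v = 0" using DP0 by simp
  qed
  then show ?thesis unfolding totally_geodesic_foliation_def leaf_locally_def by blast
qed

section \<open>Affine leaves of a parallel distribution\<close>

text \<open>Convexity of the chart image puts the segment between the images of \<open>x\<close> and
  \<open>y\<close> inside it. The inverse chart carries this segment to a curve in the plaque whose
  velocities all lie in the constant space \<open>T\<close>.\<close>

lemma parallel_plaque_displacement:
  assumes d: "d \<in> F" and G: "G \<subseteq> U" and T: "\<And>y. y \<in> G \<Longrightarrow> span (leaf_tangent_space F y) = T"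
    and c: "chart_map c = chart_map d" "chart_dir c = chart_dir d" "chart_dom c \<subseteq> chart_dom d \<inter> G"
      "convex (chart_map c ` chart_dom c)"
    and x: "x \<in> chart_dom c" and y: "y \<in> plaque c x"
  shows "y - x \<in> T"
proof -
  interpret d: flat_chart_context d k by (rule chart[OF d])
  have y': "y \<in> chart_dom c" "d.\<phi> y - d.\<phi> x \<in> d.V" using y c by (auto simp: plaque_def)
  have xd: "x \<in> d.W" "y \<in> d.W" using x y' c by auto
  let ?l = "\<lambda>s. d.\<phi> x + s *\<^sub>R (d.\<phi> y - d.\<phi> x)"
  have l: "\<exists>z\<in>chart_dom c. ?l s = d.\<phi> z" if "s \<in> {0..1}" for s
  proof -
    have "(1 - s) *\<^sub>R d.\<phi> x + s *\<^sub>R d.\<phi> y \<in> chart_map c ` chart_dom c"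
      using that x y' by (intro convexD_alt[OF c(4)]) (auto simp: c(1))
    then show ?thesis by (auto simp: c(1) algebra_simps)
  qed
  have "subspace T" using T[of x] x c(3) subspace_span by blast
  then have "d.\<psi> (?l 1) - d.\<psi> (?l 0) \<in> T"
  proof (rule curve_displacement_in_subspace)
    fix s :: real assume "s \<in> {0..1}"
    then obtain z where z: "z \<in> chart_dom c" "?l s = d.\<phi> z" using l by blast
    then have zd: "z \<in> d.W" "z \<in> G" using c by auto
    have "(?l has_derivative (\<lambda>s. s *\<^sub>R (d.\<phi> y - d.\<phi> x))) (at s)"
      by (auto intro!: derivative_eq_intros)
    then have "((\<lambda>s. d.\<psi> (?l s)) has_derivative (\<lambda>s. d.D\<psi> (d.\<phi> z) (s *\<^sub>R (d.\<phi> y - d.\<phi> x)))) (at s)"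
      by (rule has_derivative_compose) (use d.\<psi>_deriv zd(1) in \<open>simp add: z(2)\<close>)
    then show "((\<lambda>s. d.\<psi> (?l s)) has_vector_derivative d.D\<psi> (?l s) (d.\<phi> y - d.\<phi> x)) (at s)"
      by (simp add: has_vector_derivative_def z(2) linear_scale[OF d.linear_D\<psi>[OF zd(1)]])
    have "d.D\<psi> (d.\<phi> z) (d.\<phi> y - d.\<phi> x) \<in> chart_tangent d z"
      using y'(2) by (simp add: d.chart_tangent_eq_image[OF zd(1)])
    then show "d.D\<psi> (?l s) (d.\<phi> y - d.\<phi> x) \<in> T"
      using T[OF zd(2)] span_leaf_tangent[OF d zd(1)] by (simp add: z(2))
  qed
  then show ?thesis by (simp add: d.\<psi>_\<phi> xd)
qed

text \<open>A local converse of the preceding lemma, which will make the leaves open in their affine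
  hosts: the chart maps the straight segment from \<open>x\<close> to \<open>y\<close> to a curve
  with velocities in \<open>chart_dir c\<close>.\<close>

lemma parallel_ball_in_plaque:
  assumes d: "d \<in> F" and T: "\<And>y. y \<in> G \<Longrightarrow> span (leaf_tangent_space F y) = T"
    and c: "chart_map c = chart_map d" "chart_dir c = chart_dir d" "chart_dom c \<subseteq> chart_dom d \<inter> G"
    and B: "ball x e \<subseteq> chart_dom c" and y: "y \<in> ball x e" "y - x \<in> T"
  shows "y \<in> plaque c x"
proof -
  interpret d: flat_chart_context d k by (rule chart[OF d])
  let ?l = "\<lambda>s. x + s *\<^sub>R (y - x)"
  have "e > 0" using y(1) by (metis ball_empty empty_iff not_le)
  have l: "?l s \<in> chart_dom c" if "s \<in> {0..1}" for s
  proof -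
    have "(1 - s) *\<^sub>R x + s *\<^sub>R y \<in> ball x e"
      using that y \<open>e > 0\<close> by (intro convexD_alt[OF convex_ball]) auto
    then show ?thesis using B by (auto simp: algebra_simps)
  qed
  have "d.\<phi> (?l 1) - d.\<phi> (?l 0) \<in> d.V"
  proof (rule curve_displacement_in_subspace[OF d.subspace_V])
    fix s :: real assume "s \<in> {0..1}"
    then have zd: "?l s \<in> d.W" "?l s \<in> G" using l c by auto
    have "(?l has_derivative (\<lambda>s. s *\<^sub>R (y - x))) (at s)"
      by (auto intro!: derivative_eq_intros)
    then have "((\<lambda>s. d.\<phi> (?l s)) has_derivative (\<lambda>r. d.D\<phi> (?l s) (r *\<^sub>R (y - x)))) (at s)"
      by (rule has_derivative_compose) (rule d.\<phi>_deriv[OF zd(1)])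
    then show "((\<lambda>s. d.\<phi> (?l s)) has_vector_derivative d.D\<phi> (?l s) (y - x)) (at s)"
      by (simp add: has_vector_derivative_def linear_scale[OF has_derivative_linear[OF d.\<phi>_deriv[OF zd(1)]]])
    have "y - x \<in> chart_tangent d (?l s)"
      using y(2) T[OF zd(2)] span_leaf_tangent[OF d zd(1)] by simp
    then show "d.D\<phi> (?l s) (y - x) \<in> d.V" by (simp add: chart_tangent_def)
  qed
  then show ?thesis using B y(1) by (auto simp: plaque_def c)
qed

end

lemma diffeomorphism_on_id: "diffeomorphism_on UNIV (\<lambda>x::'a::euclidean_space. x)"
proof -
  have "inv_into UNIV (\<lambda>x::'a. x) = (\<lambda>x. x + 0)" by (auto intro!: inv_into_f_eq)
  then show ?thesis
    using smooth_on_id_plus[of UNIV "0::'a"] by (simp add: diffeomorphism_on_def)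
qed

lemma parallel_affine_foliation_translates:
  fixes T :: "'a::euclidean_space set"
  assumes "subspace T" "dim T = k"
  defines "Q \<equiv> {\<lparr>chart_dom = UNIV, chart_map = (\<lambda>x. x), chart_dir = T\<rparr>}"
  shows "parallel_affine_foliation k Q"
    and leaves_translates: "leaves Q = range (\<lambda>x. {y. y - x \<in> T})"
proof -
  have rel: "plaque_rel Q = {(x, y). y - x \<in> T}"
    by (auto simp: plaque_rel_def Q_def plaque_def)
  have "trans (plaque_rel Q)"
  proof (rule transI)
    fix x y z assume "(x, y) \<in> plaque_rel Q" "(y, z) \<in> plaque_rel Q"
    then show "(x, z) \<in> plaque_rel Q"
      using subspace_add[OF assms(1), of "y - x" "z - y"] by (simp add: rel)
  qed
  then have trancl: "(plaque_rel Q)\<^sup>+ = {(x, y). y - x \<in> T}" by (simp add: rel)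
  have dom: "\<Union> (chart_dom ` Q) = UNIV" by (simp add: Q_def)
  show leaves: "leaves Q = range (\<lambda>x. {y. y - x \<in> T})"
    unfolding leaves_def dom trancl quotient_def by auto
  have translate: "{y. y - x \<in> T} = (+) x ` T" for x
  proof (intro equalityI subsetI)
    fix y assume "y \<in> {y. y - x \<in> T}"
    then show "y \<in> (+) x ` T" by (intro image_eqI[of _ _ "y - x"]) auto
  qed auto
  have "affine L" if "L \<in> leaves Q" for L
    using that subspace_imp_affine[OF assms(1)] affine_translation[of T] by (auto simp: leaves translate)
  moreover have "affine_parallel L L'" if LL': "L \<in> leaves Q" "L' \<in> leaves Q" for L L'
  proof -
    obtain x x' where "L = (+) x ` T" "L' = (+) x' ` T"
      using LL' unfolding leaves translate by blast
    then have "L' = (+) (x' - x) ` L" by (simp add: image_image)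
    then show ?thesis unfolding affine_parallel_def by blast
  qed
  moreover have "foliation k UNIV Q"
    using diffeomorphism_on_id assms(1,2)
    by (auto simp: foliation_def Q_def is_flat_chart_def coherent_def)
  ultimately show "parallel_affine_foliation k Q" by (simp add: parallel_affine_foliation_def)
qed

context riemannian_foliation_context
begin

text \<open>On a ball, which is convex, the tangent space is one fixed subspace \<open>?T\<close>.
  Displacements along chains of plaques add up in \<open>?T\<close>, so each leaf lies in a single
  translate of \<open>?T\<close>.\<close>

lemma parallel_imp_locally_affine:
  assumes DP0: "\<And>x v z. x \<in> U \<Longrightarrow> DP x v z = 0" and p: "p \<in> U"
  shows "\<exists>G. open G \<and> p \<in> G \<and> G \<subseteq> U \<and> (\<exists>Q. parallel_affine_foliation k Q \<and>
    (\<forall>L \<in> leaves (restrict_foliation F G). \<exists>A \<in> leaves Q. openin (top_of_set A) L))"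
proof -
  obtain r where r: "r > 0" "ball p r \<subseteq> U" using open_U p open_contains_ball by blast
  let ?G = "ball p r" and ?T = "span (leaf_tangent_space F p)"
  let ?Q = "{\<lparr>chart_dom = UNIV, chart_map = (\<lambda>x. x), chart_dir = ?T\<rparr>}"
  let ?R = "restrict_foliation F ?G"
  have T: "span (leaf_tangent_space F y) = ?T" if "y \<in> ?G" for y
    by (rule parallel_imp_locally_constant[OF DP0 convex_ball r(2) that]) (use r in auto)
  have chartE: "\<exists>d\<in>F. chart_map c = chart_map d \<and> chart_dir c = chart_dir d \<and> open (chart_dom c) \<and>
      chart_dom c \<subseteq> chart_dom d \<inter> ?G \<and> convex (chart_map c ` chart_dom c)" if "c \<in> ?R" for c
    using that by (simp add: restrict_foliation_def)
  have step: "y - x \<in> ?T" if xy: "(x, y) \<in> plaque_rel ?R" for x y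
  proof -
    obtain c where c: "c \<in> ?R" "x \<in> chart_dom c" "y \<in> plaque c x" using xy by (auto simp: plaque_rel_def)
    obtain d where "d \<in> F" "chart_map c = chart_map d" "chart_dir c = chart_dir d"
      "chart_dom c \<subseteq> chart_dom d \<inter> ?G" "convex (chart_map c ` chart_dom c)"
      using chartE[OF c(1)] by blast
    then show ?thesis using parallel_plaque_displacement[OF _ r(2) T _ _ _ _ c(2,3)] by blast
  qed
  have chain: "y - x \<in> ?T" if "(x, y) \<in> (plaque_rel ?R)\<^sup>+" for x y
    using that
  proof induction
    case (step y z)
    then show ?case using subspace_add[OF subspace_span, of "y - x" _ "z - y"] \<open>\<And>y x. (x, y) \<in> plaque_rel ?R \<Longrightarrow> y - x \<in> ?T\<close> by simp
  qed (rule step)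
  have openin: "openin (top_of_set {y. y - x0 \<in> ?T}) L" if L: "L = (plaque_rel ?R)\<^sup>+ `` {x0}" for L x0
    unfolding openin_contains_ball
  proof (intro conjI ballI)
    show "L \<subseteq> {y. y - x0 \<in> ?T}" using chain L by auto
    fix x assume "x \<in> L"
    then have x: "(x0, x) \<in> (plaque_rel ?R)\<^sup>+" by (simp add: L)
    \<comment> \<open>The last link of the chain provides a chart of the restriction around
      \<open>x\<close>, and with it the ball for openness.\<close>
    then obtain z where "(z, x) \<in> plaque_rel ?R" by (metis tranclE)
    then obtain c where c: "c \<in> ?R" "x \<in> chart_dom c" by (auto simp: plaque_rel_def plaque_def)
    obtain d where d: "d \<in> F" "chart_map c = chart_map d" "chart_dir c = chart_dir d"
      "chart_dom c \<subseteq> chart_dom d \<inter> ?G" "open (chart_dom c)"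
      using chartE[OF c(1)] by blast
    obtain e where e: "e > 0" "ball x e \<subseteq> chart_dom c"
      using d(5) c(2) open_contains_ball by blast
    have "y \<in> L" if y: "y \<in> ball x e" "y - x0 \<in> ?T" for y
    proof -
      have yx: "y - x \<in> ?T" using subspace_diff[OF subspace_span y(2) chain[OF x]] by simp
      have "y \<in> plaque c x"
        by (rule parallel_ball_in_plaque[OF d(1) _ d(2-4) e(2) y(1) yx]) (rule T)
      then have "(x, y) \<in> plaque_rel ?R" using c by (auto simp: plaque_rel_def)
      then show ?thesis using x L by (simp add: trancl_into_trancl)
    qed
    then show "\<exists>e>0. ball x e \<inter> {y. y - x0 \<in> ?T} \<subseteq> L" using e(1) by blast
  qed
  have "\<forall>L \<in> leaves ?R. \<exists>A \<in> leaves ?Q. openin (top_of_set A) L"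
  proof
    fix L assume "L \<in> leaves ?R"
    then obtain x0 where "L = (plaque_rel ?R)\<^sup>+ `` {x0}"
      unfolding leaves_def by (elim quotientE)
    then have "openin (top_of_set {y. y - x0 \<in> ?T}) L" by (rule openin)
    moreover have "{y. y - x0 \<in> ?T} \<in> leaves ?Q"
      unfolding leaves_translates[OF subspace_span dim_T[OF p]] by (rule rangeI)
    ultimately show "\<exists>A \<in> leaves ?Q. openin (top_of_set A) L" by blast
  qed
  moreover have "parallel_affine_foliation k ?Q"
    by (rule parallel_affine_foliation_translates[OF subspace_span dim_T[OF p]])
  ultimately show ?thesis using r by (intro exI[of _ ?G]) auto
qed

end

section \<open>Complex leaves\<close>

lemma linear_complex_scale: "linear (\<lambda>z::complex^'m. c *s z)"
  by (rule linearI) (simp_all add: vec_eq_iff algebra_simps)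

lemma inner_imaginary_unit: "(\<i> *s x) \<bullet> (\<i> *s y) = x \<bullet> (y::complex^'m)"
  by (simp add: inner_vec_def inner_complex_def add.commute)

text \<open>Only the differentiability of the straightening biholomorphism is used, so that no
  regularity theory for holomorphic maps is needed.\<close>

lemma complex_plaque_tangent_invariant:
  fixes c :: "(complex^'m) flat_chart"
  assumes c: "is_flat_chart k c" and x: "x \<in> chart_dom c" and S: "complex_submanifold m (plaque c x)"
    and v: "v \<in> chart_tangent c x"
  shows "\<i> *s v \<in> chart_tangent c x"
proof -
  interpret c: flat_chart_context c k by unfold_locales (rule c)
  let ?S = "plaque c x"
  have xS: "x \<in> ?S" by (rule c.plaque_self[OF x])
  from bspec[OF S[unfolded complex_submanifold_def] xS]
  obtain W \<eta> A where W: "x \<in> W" "biholomorphism_on W \<eta>" "vec.subspace A" "\<eta> ` (?S \<inter> W) = \<eta> ` W \<inter> A"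
    by (elim exE conjE) (rule that)
  let ?\<theta> = "inv_into W \<eta>"
  have bi: "open W" "open (\<eta> ` W)" "inj_on \<eta> W" "holomorphic_map_on W \<eta>" "holomorphic_map_on (\<eta> ` W) ?\<theta>"
    using W(2) by (auto simp: biholomorphism_on_def)
  obtain D where D: "(\<eta> has_derivative D) (at x)"
    using bi(4) W(1) unfolding holomorphic_map_on_def by blast
  obtain E where E: "(?\<theta> has_derivative E) (at (\<eta> x))" "\<And>c v. E (c *s v) = c *s E v"
    using bi(5) W(1) unfolding holomorphic_map_on_def by blast
  have \<theta>_\<eta>: "?\<theta> (\<eta> y) = y" if "y \<in> W" for y by (rule inv_into_f_f[OF bi(3) that])
  have ED: "E (D v) = v" for v
  proof -
    have "((\<lambda>y. ?\<theta> (\<eta> y)) has_derivative (\<lambda>v. E (D v))) (at x)"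
      using has_derivative_compose[OF D E(1)] .
    moreover have "((\<lambda>y. ?\<theta> (\<eta> y)) has_derivative (\<lambda>v. v)) (at x)"
      by (rule has_derivative_transform_within_open[OF has_derivative_ident bi(1) W(1)]) (simp add: \<theta>_\<eta>)
    ultimately show ?thesis using has_derivative_unique by metis
  qed
  have A: "subspace A"
  proof (rule subspaceI)
    show "r *\<^sub>R a \<in> A" if "a \<in> A" for r a
    proof -
      have "r *\<^sub>R a = of_real r *s a" by (simp add: vec_eq_iff complex_eq_iff)
      then show ?thesis using vec.subspace_scale[OF W(3) that] by simp
    qed
  qed (use W(3) vec.subspace_0 vec.subspace_add in auto)
  obtain \<gamma> e where g: "0 < e" "\<gamma> ` {-e<..<e::real} \<subseteq> ?S" "\<gamma> 0 = x" "(\<gamma> has_vector_derivative v) (at 0)"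
    using c.plaque_curve_exists[OF x v] by metis
  have in_A: "\<eta> y \<in> A" if "y \<in> ?S" "y \<in> W" for y using W(4) that by blast
  \<comment> \<open>The straightening map sends a curve in the plaque with velocity \<open>v\<close>
    into \<open>A\<close>.\<close>
  have "D v \<in> A"
  proof (rule has_vector_derivative_in_subspace[OF A])
    show "((\<lambda>s. \<eta> (\<gamma> s)) has_vector_derivative D v) (at 0)"
      using has_derivative_compose[OF g(4)[unfolded has_vector_derivative_def], of \<eta> D] D g(3)
      by (simp add: has_vector_derivative_def linear_scale[OF has_derivative_linear[OF D]])
    have "\<forall>\<^sub>F s in nhds 0. s \<in> {-e<..<e}" using g(1) by (intro eventually_nhds_in_open) auto
    moreover have "\<forall>\<^sub>F s in nhds 0. \<gamma> s \<in> W"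
      by (rule eventually_curve_in_open[OF g(4) bi(1)]) (simp add: g(3) W(1))
    ultimately show "\<forall>\<^sub>F s in nhds 0. \<eta> (\<gamma> s) - \<eta> (\<gamma> 0) \<in> A"
    proof eventually_elim
      case (elim s)
      then have "\<gamma> s \<in> ?S" using g(2) by blast
      then show ?case using elim(2) in_A xS W(1) by (intro subspace_diff[OF A]) (auto simp: g(3))
    qed
  qed
  then have a: "\<i> *s D v \<in> A" by (rule vec.subspace_scale[OF W(3)])
  let ?a = "\<i> *s D v"
  \<comment> \<open>The line in direction \<open>?a\<close> stays in \<open>A\<close>; pulled back
    it is a curve in the plaque with velocity \<open>E ?a\<close>, which is \<open>\<i> *s v\<close>
    by complex linearity of \<open>E\<close>.\<close>
  have line: "((\<lambda>s. \<eta> x + s *\<^sub>R ?a) has_vector_derivative ?a) (at 0)"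
    by (auto intro!: derivative_eq_intros)
  have "((\<lambda>s. ?\<theta> (\<eta> x + s *\<^sub>R ?a)) has_vector_derivative E ?a) (at 0)"
    using has_derivative_compose[OF line[unfolded has_vector_derivative_def], of ?\<theta> E] E(1)
    by (simp add: has_vector_derivative_def linear_scale[OF has_derivative_linear[OF E(1)]])
  moreover have "\<forall>\<^sub>F s in nhds 0. \<eta> x + s *\<^sub>R ?a \<in> \<eta> ` W"
    by (rule eventually_curve_in_open[OF line bi(2)]) (simp add: W(1))
  then have "\<forall>\<^sub>F s in nhds 0. ?\<theta> (\<eta> x + s *\<^sub>R ?a) \<in> ?S"
  proof eventually_elim
    case (elim s)
    have "\<eta> x + s *\<^sub>R ?a \<in> A"
      using in_A[OF xS W(1)] a by (intro subspace_add[OF A] subspace_scale[OF A])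
    with elim have "\<eta> x + s *\<^sub>R ?a \<in> \<eta> ` (?S \<inter> W)" using W(4) by blast
    then obtain y where "y \<in> ?S" "y \<in> W" "\<eta> x + s *\<^sub>R ?a = \<eta> y" by blast
    then show ?case by (simp add: \<theta>_\<eta>)
  qed
  ultimately have "E ?a \<in> chart_tangent c x"
    using \<theta>_\<eta>[OF W(1)] by (intro c.plaque_curve_velocity[OF x]) auto
  then show ?thesis by (simp add: E(2) ED)
qed

lemma bij_axis_Basis_real: "bij_betw (\<lambda>i::'n::finite. axis i (1::real)) UNIV Basis"
  by (auto simp: bij_betw_def inj_on_def axis_eq_axis Basis_vec_def)

text \<open>The boolean selects the real or the imaginary direction of a coordinate, so the index
  type has as many elements as the real dimension.\<close>

lemma bij_axis_Basis_complex:
  "bij_betw (\<lambda>(i::'m::finite, b). axis i (if b then 1 else \<i>)) UNIV Basis"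
  by (auto simp: bij_betw_def inj_on_def axis_eq_axis Basis_vec_def Basis_complex_def image_iff split: if_splits)

theorem theorem1p4:
  "(\<forall>k (U :: (real^'n) set) F.
      riemannian_foliation k U F \<longrightarrow> minimal_leaves k F \<longrightarrow>
        totally_geodesic_foliation k F \<and>
        (\<forall>p\<in>U. \<exists>G. open G \<and> p \<in> G \<and> G \<subseteq> U \<and>
          (\<exists>P. parallel_affine_foliation k P \<and>
            (\<forall>L \<in> leaves (restrict_foliation F G). \<exists>A \<in> leaves P. openin (top_of_set A) L)))) \<and>
   (\<forall>k (U :: (complex^'m) set) F.
      complex_riemannian_foliation k U F \<longrightarrow> totally_geodesic_foliation k F)"
proof (rule conjI; intro allI impI)
  fix k and U :: "(real^'n) set" and F
  assume "riemannian_foliation k U F" and min: "minimal_leaves k F"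
  then interpret riemannian_foliation_context k U F by unfold_locales
  have "DP x v z = 0" if "x \<in> U" for x v z
    by (rule harmonic_imp_parallel[OF bij_axis_Basis_real minimal_imp_harmonic[OF min] that])
  then show "totally_geodesic_foliation k F \<and>
        (\<forall>p\<in>U. \<exists>G. open G \<and> p \<in> G \<and> G \<subseteq> U \<and>
          (\<exists>P. parallel_affine_foliation k P \<and>
            (\<forall>L \<in> leaves (restrict_foliation F G). \<exists>A \<in> leaves P. openin (top_of_set A) L)))"
    using parallel_imp_totally_geodesic parallel_imp_locally_affine by simp
next
  fix k and U :: "(complex^'m) set" and F
  assume F: "complex_riemannian_foliation k U F"
  then interpret riemannian_foliation_context k U F
    by unfold_locales (simp add: complex_riemannian_foliation_def)
  have JT: "\<i> *s v \<in> span (leaf_tangent_space F y)" if "y \<in> U" "v \<in> span (leaf_tangent_space F y)" for y v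
  proof -
    obtain c where c: "c \<in> F" "y \<in> chart_dom c" using ex_chart \<open>y \<in> U\<close> by blast
    obtain m where "complex_submanifold m (plaque c y)"
      using leaf_locally_plaque[OF fol _ c, of complex_submanifold] F
      unfolding complex_riemannian_foliation_def by blast
    moreover have "is_flat_chart k c" using fol c by (simp add: foliation_def)
    ultimately show ?thesis
      using complex_plaque_tangent_invariant[OF _ c(2)] that(2) unfolding span_leaf_tangent[OF c] by blast
  qed
  have "(\<Sum>b\<in>Basis. DP x (P x b) w \<bullet> b) = 0" if "x \<in> U" "P x w = 0" for x w
    by (rule complex_imp_harmonic[OF linear_complex_scale _ inner_imaginary_unit JT that])
      (simp_all add: vec_eq_iff)
  then have "DP x v z = 0" if "x \<in> U" for x v z
    by (rule harmonic_imp_parallel[OF bij_axis_Basis_complex _ that])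
  then show "totally_geodesic_foliation k F" by (rule parallel_imp_totally_geodesic)
qed

end
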